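(* For a positive integer $n$, let $\mathcal{T}_n$ be the set of $n\times n$ cyclic SNFs, i.e. those with at most one diagonal entry not equal to $1$. Then: (i) $$\mu(\mathcal{T}_n)=\frac{1}{\prod_{i=2}^{n}\zeta(i)}\cdot\prod_{p}\left(1+\frac1{p^2}+\frac1{p^3}+\cdots+\frac1{p^n}\right)=:Z_n,$$ the product being over all primes $p$; (ii) $Z_n$ is strictly decreasing in $n$; (iii) $$Z_2=\frac{1}{\zeta(4)}=\frac{90}{\pi^4}\approx 0.923938;$$ (iv) $$\lim_{n\to\infty}Z_n=\frac{1}{\zeta(6)\prod_{i=4}^{\infty}\zeta(i)}\approx0.846936.$$
   Context: $\zeta$ is the Riemann zeta function. For a positive integer $k$, $\mathbb{Z}_{(k)}=\{-k,\dots,k\}$. The Smith normal form (SNF) of an $n\times n$ integer matrix $M$ is the diagonal matrix $PMQ$ ($P,Q$ invertible over $\mathbb{Z}$) with nonnegative diagonal entries $d_1\mid d_2\mid\cdots\mid d_n$ (trailing entries may be $0$). For a set $\mathcal{S}$ of such diagonal matrices, $\mu^{(k)}(\mathcal{S})$ is the probability that $\mathrm{SNF}(M)\in\mathcal{S}$ for a random $n\times n$ matrix $M$ with independent entries uniform on $\mathbb{Z}_{(k)}$, and $\mu(\mathcal{S})=\lim_{k\to\infty}\mu^{(k)}(\mathcal{S})$ if the limit exists (its existence is part of the claim). $\mathrm{SNF}(M)\in\mathcal{T}_n$ if and only if the cokernel of $M$ is cyclic. *)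

theory Defs
  imports
    "HOL-Probability.Probability"
    "HOL-Computational_Algebra.Primes"
    "Jordan_Normal_Form.Matrix"
begin

(* The Riemann zeta function on the half-line s > 1, where it is given by its Dirichlet series;
   for s \<le> 1 the series diverges and the value below is meaningless. *)
definition zeta :: "real \<Rightarrow> real" where
  "zeta s = (\<Sum>m. 1 / real (Suc m) powr s)"

definition snf_shape :: "nat \<Rightarrow> int mat \<Rightarrow> bool" where
  "snf_shape n D \<longleftrightarrow> D \<in> carrier_mat n n \<and> diagonal_mat D \<and>
     (\<forall>i<n. D $$ (i, i) \<ge> 0) \<and> (\<forall>i. Suc i < n \<longrightarrow> D $$ (i, i) dvd D $$ (Suc i, Suc i))"

definition is_SNF :: "nat \<Rightarrow> int mat \<Rightarrow> int mat \<Rightarrow> bool" where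
  "is_SNF n M D \<longleftrightarrow> snf_shape n D \<and>
     (\<exists>P\<in>carrier_mat n n. \<exists>Q\<in>carrier_mat n n.
        invertible_mat P \<and> invertible_mat Q \<and> D = P * M * Q)"

(* Every n x n integer matrix M has exactly one Smith normal form, so the choice is forced. *)
definition SNF :: "nat \<Rightarrow> int mat \<Rightarrow> int mat" where
  "SNF n M = (SOME D. is_SNF n M D)"

(* Random n x n matrix with independent entries, each uniform on {-k..k}. The default value 0 of
   Pi_pmf concerns only index pairs outside the matrix. *)
definition random_mat :: "nat \<Rightarrow> nat \<Rightarrow> int mat pmf" where
  "random_mat n k = map_pmf (\<lambda>f. mat n n f)
     (Pi_pmf ({..<n} \<times> {..<n}) 0 (\<lambda>_. pmf_of_set {- int k..int k}))"

definition mu_upto :: "nat \<Rightarrow> nat \<Rightarrow> int mat set \<Rightarrow> real" where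
  "mu_upto k n S = measure_pmf.prob (random_mat n k) {M. SNF n M \<in> S}"

(* Only meaningful when the limit exists; that is asserted separately where mu is used. *)
definition mu :: "nat \<Rightarrow> int mat set \<Rightarrow> real" where
  "mu n S = lim (\<lambda>k. mu_upto k n S)"

definition cyclic_SNFs :: "nat \<Rightarrow> int mat set" where
  "cyclic_SNFs n = {D. snf_shape n D \<and> card {i. i < n \<and> D $$ (i, i) \<noteq> 1} \<le> 1}"

(* The factor 1 + 1/p^2 + ... + 1/p^n at primes p, and 1 at all other numbers, so that the product
   over the primes becomes an infinite product over nat. *)
definition Z_factor :: "nat \<Rightarrow> nat \<Rightarrow> real" where
  "Z_factor n p = (if prime p then 1 + (\<Sum>i=2..n. 1 / real p ^ i) else 1)"

definition Z :: "nat \<Rightarrow> real" where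
  "Z n = 1 / (\<Prod>i=2..n. zeta (real i)) * prodinf (Z_factor n)"

end

(* The cokernel of M is cyclic iff for every prime p the reduction of M mod p has corank at most 1.
   For a single p, adding rows one at a time is a Markov chain on the dimension of the row span, which
   gives the exact density (prod_{i=2..n} (1 - p^-i)) (1 + p^-2 + ... + p^-n). Finitely many primes are
   independent in the limit by the Chinese remainder theorem, and the primes p > L contribute O(1/L):
   if the first n - 1 rows are dependent mod p, some row falls into a span of codimension at least 2.
   For p <= 2k + 1 this has probability O(1/p^2). For all larger primes together it has probability
   O(1/k), because such p divides a polynomially bounded nonzero integer c.v, where c is a short vector
   orthogonal to the previous rows. The remaining claims follow by comparing Euler factors. *)

theory Submission
  imports Defs "HOL-Number_Theory.Cong" "HOL-Real_Asymp.Real_Asymp" "Jordan_Normal_Form.Column_Operations"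
begin

section \<open>Spans of integer vectors modulo a prime\<close>

text \<open>The cut at \<open>2 * k + 1\<close> is where residue counting stops working: beyond it a
  class modulo p meets each side of the box in at most one point, the p^-2 bound is lost, and
  infinitely many primes have to be treated as one event. Two separate coordinates make up for this.
  The vector c lives on the first l columns and is chosen before any prime is named. The case c.v =
  0, in which divisibility excludes no prime, is paid for by a coordinate of v with nonzero
  coefficient in c. Otherwise the number of primes is bounded in terms of n alone, and each of them
  is paid for by the column after the first l, whose entry is forced modulo p. This is why ranks are
  tracked on initial columns and why a column is added with every row. The zeta(6) of the limit
  comes from 1 + 1/(p(p-1)) = (1 - p^-6) / ((1 - p^-2)(1 - p^-3)): the products over the primes tend
  to zeta(2) zeta(3) / zeta(6), which cancels the first two zeta factors of the denominator.\<close>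

definition vecs :: "nat \<Rightarrow> int set \<Rightarrow> (nat \<Rightarrow> int) set" where
  "vecs n A = PiE_dflt {..<n} 0 (\<lambda>_. A)"

definition rows_of :: "nat \<Rightarrow> 'a set \<Rightarrow> 'a list set" where
  "rows_of r B = {vs. set vs \<subseteq> B \<and> length vs = r}"

(* The preimage in the integer lattice of the span of the vectors modulo p. It contains all multiples
   of p, so no reduction modulo p is needed in its definition. *)
fun latt :: "nat \<Rightarrow> (nat \<Rightarrow> int) list \<Rightarrow> (nat \<Rightarrow> int) set" where
  "latt p [] = {w. \<forall>j. int p dvd w j}"
| "latt p (v # vs) = {\<lambda>j. w j + c * v j | w c. w \<in> latt p vs}"

text \<open>Lists grow at the head, so the tail holds the earlier rows and the recursion is the rank
  process itself. That the value depends only on the span shows in \<open>card_latt\<close>.\<close>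

fun rk :: "nat \<Rightarrow> (nat \<Rightarrow> int) list \<Rightarrow> nat" where
  "rk p [] = 0"
| "rk p (v # vs) = (if v \<in> latt p vs then rk p vs else Suc (rk p vs))"

lemma finite_vecs [simp]: "finite A \<Longrightarrow> finite (vecs n A)"
  by (simp add: vecs_def finite_PiE_dflt)

lemma card_vecs: "finite A \<Longrightarrow> card (vecs n A) = card A ^ n"
  by (simp add: vecs_def card_PiE_dflt)

lemma vecs_iff: "v \<in> vecs n A \<longleftrightarrow> (\<forall>j<n. v j \<in> A) \<and> (\<forall>j\<ge>n. v j = 0)"
  by (auto simp: vecs_def PiE_dflt_def not_less)

lemma finite_rows_of [simp]: "finite B \<Longrightarrow> finite (rows_of r B)"
  using finite_lists_length_eq[of B r] by (simp add: rows_of_def)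

lemma card_rows_of: "finite B \<Longrightarrow> card (rows_of r B) = card B ^ r"
  using card_lists_length_eq[of B r] by (simp add: rows_of_def)

lemma rows_of_0: "rows_of 0 B = {[]}"
  by (auto simp: rows_of_def)

lemma rows_of_Suc_iff: "xs \<in> rows_of (Suc r) B \<longleftrightarrow> (\<exists>v vs. xs = v # vs \<and> v \<in> B \<and> vs \<in> rows_of r B)"
  by (cases xs) (auto simp: rows_of_def)

text \<open>Conditioning on the earlier rows; every count of row lists below passes through this sum
  over tails.\<close>

lemma card_rows_of_Suc:
  assumes "finite B"
  shows "card {xs \<in> rows_of (Suc r) B. P xs} = (\<Sum>vs\<in>rows_of r B. card {v \<in> B. P (v # vs)})"
proof -
  have "bij_betw (\<lambda>(vs, v). v # vs) (SIGMA vs:rows_of r B. {v \<in> B. P (v # vs)})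
          {xs \<in> rows_of (Suc r) B. P xs}"
    by (rule bij_betwI[where g = "\<lambda>xs. (tl xs, hd xs)"]) (auto simp: rows_of_Suc_iff)
  then have "card {xs \<in> rows_of (Suc r) B. P xs} = card (SIGMA vs:rows_of r B. {v \<in> B. P (v # vs)})"
    by (simp add: bij_betw_same_card)
  also have "\<dots> = (\<Sum>vs\<in>rows_of r B. card {v \<in> B. P (v # vs)})"
    using assms by (subst card_SigmaI) auto
  finally show ?thesis .
qed

lemma latt_multiples: "(\<And>j. int p dvd w j) \<Longrightarrow> w \<in> latt p vs"
proof (induction vs)
  case (Cons v vs)
  then show ?case by (auto intro!: exI[of _ w] exI[of _ 0])
qed auto

lemma latt_ConsI: "w \<in> latt p vs \<Longrightarrow> (\<lambda>j. w j + c * v j) \<in> latt p (v # vs)"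
  by auto

lemma latt_Cons_subset: "w \<in> latt p vs \<Longrightarrow> w \<in> latt p (v # vs)"
  using latt_ConsI[of w p vs 0 v] by simp

lemma latt_add: "w \<in> latt p vs \<Longrightarrow> w' \<in> latt p vs \<Longrightarrow> (\<lambda>j. w j + w' j) \<in> latt p vs"
proof (induction vs arbitrary: w w')
  case (Cons v vs)
  then obtain u c u' c' where *: "w = (\<lambda>j. u j + c * v j)" "w' = (\<lambda>j. u' j + c' * v j)"
    "u \<in> latt p vs" "u' \<in> latt p vs" by auto
  have "(\<lambda>j. (u j + u' j) + (c + c') * v j) \<in> latt p (v # vs)"
    using Cons.IH * by (intro latt_ConsI) auto
  also have "(\<lambda>j. (u j + u' j) + (c + c') * v j) = (\<lambda>j. w j + w' j)"
    by (auto simp: * algebra_simps)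
  finally show ?case .
qed auto

lemma latt_scale: "w \<in> latt p vs \<Longrightarrow> (\<lambda>j. a * w j) \<in> latt p vs"
proof (induction vs arbitrary: w)
  case (Cons v vs)
  then obtain u c where *: "w = (\<lambda>j. u j + c * v j)" "u \<in> latt p vs" by auto
  have "(\<lambda>j. a * u j + (a * c) * v j) \<in> latt p (v # vs)"
    using Cons.IH * by (intro latt_ConsI) auto
  also have "(\<lambda>j. a * u j + (a * c) * v j) = (\<lambda>j. a * w j)"
    by (auto simp: * algebra_simps)
  finally show ?case .
qed auto

lemma latt_lincomb:
  "w \<in> latt p vs \<Longrightarrow> w' \<in> latt p vs \<Longrightarrow> (\<lambda>j. a * w j + b * w' j) \<in> latt p vs"
  using latt_add latt_scale by blast

lemma latt_cong:
  assumes "w \<in> latt p vs" "\<And>j. [w j = w' j] (mod int p)"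
  shows "w' \<in> latt p vs"
proof -
  have "(\<lambda>j. w' j - w j) \<in> latt p vs"
    using assms(2) by (intro latt_multiples) (simp add: cong_iff_dvd_diff cong_sym dvd_diff_commute)
  from latt_add[OF assms(1) this] show ?thesis by simp
qed

text \<open>A scalar not divisible by the prime has an inverse modulo it, and scaling by that
  inverse stays in the lattice.\<close>

lemma latt_cancel:
  assumes "prime p" "\<not> int p dvd c" "(\<lambda>j. c * v j) \<in> latt p vs"
  shows "v \<in> latt p vs"
proof -
  have "coprime c (int p)"
    using assms by (metis coprime_commute prime_imp_coprime prime_nat_int_transfer)
  then obtain a where a: "[c * a = 1] (mod int p)"
    using cong_solve_coprime_int by blast
  show ?thesis
  proof (rule latt_cong[OF latt_scale[OF assms(3), of a]])
    fix j
    have "[(c * a) * v j = 1 * v j] (mod int p)" by (intro cong_mult a cong_refl)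
    then show "[a * (c * v j) = v j] (mod int p)" by (simp add: ac_simps)
  qed
qed

lemma latt_Cons_member: "v \<in> latt p vs \<Longrightarrow> latt p (v # vs) = latt p vs"
proof
  assume v: "v \<in> latt p vs"
  show "latt p (v # vs) \<subseteq> latt p vs"
    using latt_lincomb[of _ p vs v 1] v by fastforce
qed (use latt_Cons_subset in blast)

text \<open>Reducing w + c v modulo p is a bijection from pairs of a representative w of the old
  span and a residue c. It is injective because two different c would put a multiple of
  \<open>v\<close> by a unit into the old span.\<close>

lemma card_latt_Cons:
  assumes p: "prime p" and v: "v \<in> vecs n UNIV" "v \<notin> latt p vs"
  shows "card (latt p (v # vs) \<inter> vecs n {0..<int p}) = p * card (latt p vs \<inter> vecs n {0..<int p})"
proof -
  let ?V = "vecs n {0..<int p}"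
  have p0: "int p > 0" using p by (simp add: prime_gt_0_nat)
  define \<phi> where "\<phi> = (\<lambda>(w, c). \<lambda>j. (w j + c * v j) mod int p)"
  have "bij_betw \<phi> ((latt p vs \<inter> ?V) \<times> {0..<int p}) (latt p (v # vs) \<inter> ?V)"
  proof (rule bij_betwI')
    fix x y assume xy: "x \<in> (latt p vs \<inter> ?V) \<times> {0..<int p}" "y \<in> (latt p vs \<inter> ?V) \<times> {0..<int p}"
    obtain w c w' c' where [simp]: "x = (w, c)" "y = (w', c')" by (cases x, cases y)
    show "\<phi> x = \<phi> y \<longleftrightarrow> x = y"
    proof
      assume "\<phi> x = \<phi> y"
      then have eq: "[w j + c * v j = w' j + c' * v j] (mod int p)" for j
        by (auto simp: \<phi>_def cong_def fun_eq_iff)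
      have "c = c'"
      proof (rule ccontr)
        assume "c \<noteq> c'"
        then have "\<not> int p dvd c - c'"
          using xy p0 by (auto simp flip: cong_iff_dvd_diff simp: cong_def)
        moreover have "(\<lambda>j. (c - c') * v j) \<in> latt p vs"
        proof (rule latt_cong)
          show "(\<lambda>j. 1 * w' j + (-1) * w j) \<in> latt p vs" using xy by (intro latt_lincomb) auto
          show "[1 * w' j + (-1) * w j = (c - c') * v j] (mod int p)" for j
          proof -
            have "(1 * w' j + (-1) * w j) - (c - c') * v j = - ((w j + c * v j) - (w' j + c' * v j))"
              by (simp add: algebra_simps)
            then show ?thesis using eq[of j] unfolding cong_iff_dvd_diff by (simp only: dvd_minus_iff)
          qed
        qed
        ultimately show False using latt_cancel p v by blast
      qed
      moreover have "w j = w' j" for j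
      proof (cases "j < n")
        case True
        have "[w j = w' j] (mod int p)" using eq[of j] \<open>c = c'\<close>
          by (simp add: cong_add_rcancel)
        then show ?thesis using xy True by (auto simp: vecs_iff cong_def)
      qed (use xy in \<open>auto simp: vecs_iff\<close>)
      ultimately show "x = y" by auto
    qed auto
  next
    fix x assume x: "x \<in> (latt p vs \<inter> ?V) \<times> {0..<int p}"
    obtain w c where [simp]: "x = (w, c)" by (cases x)
    have "\<phi> x \<in> latt p (v # vs)"
      using x latt_cong[OF latt_ConsI[of w p vs c v]] by (auto simp: \<phi>_def cong_def simp del: latt.simps)
    then show "\<phi> x \<in> latt p (v # vs) \<inter> ?V"
      using x v p0 by (auto simp: \<phi>_def vecs_iff simp del: latt.simps)
  next
    fix u assume u: "u \<in> latt p (v # vs) \<inter> ?V"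
    then obtain w c where w: "w \<in> latt p vs" "u = (\<lambda>j. w j + c * v j)" by auto
    have wV: "w j = 0" if "j \<ge> n" for j
      using u v w that by (auto simp: vecs_iff fun_eq_iff)
    \<comment> \<open>Passing to the residues of w and c changes the combination only by multiples
      of p, and u is already reduced.\<close>
    have "\<phi> ((\<lambda>j. w j mod int p), c mod int p) = u"
    proof
      fix j
      have "[w j mod int p + c mod int p * v j = u j] (mod int p)"
        unfolding w by (intro cong_add cong_mult) (simp_all add: cong_def)
      then have "\<phi> ((\<lambda>j. w j mod int p), c mod int p) j = u j mod int p"
        by (simp add: \<phi>_def cong_def)
      also have "\<dots> = u j" using u p0 by (cases "j < n") (auto simp: vecs_iff)
      finally show "\<phi> ((\<lambda>j. w j mod int p), c mod int p) j = u j" .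
    qed
    moreover have "(\<lambda>j. w j mod int p) \<in> latt p vs"
      by (rule latt_cong[OF w(1)]) (simp add: cong_def)
    moreover have "(\<lambda>j. w j mod int p) \<in> ?V" using wV p0 by (auto simp: vecs_iff)
    ultimately show "\<exists>x\<in>(latt p vs \<inter> ?V) \<times> {0..<int p}. u = \<phi> x"
      using p0 by (intro bexI[of _ "((\<lambda>j. w j mod int p), c mod int p)"]) auto
  qed
  from bij_betw_same_card[OF this] show ?thesis by (simp add: card_cartesian_product mult.commute del: latt.simps)
qed

text \<open>Expresses the recursively computed rank through the size of the span. Later this shows
  that the rank modulo p is preserved by integral row and column operations.\<close>

lemma card_latt:
  assumes p: "prime p" and "set vs \<subseteq> vecs n UNIV"
  shows "card (latt p vs \<inter> vecs n {0..<int p}) = p ^ rk p vs"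
  using assms(2)
proof (induction vs)
  case Nil
  have "latt p [] \<inter> vecs n {0..<int p} = {\<lambda>_. 0}"
  proof (intro equalityI subsetI)
    fix w assume w: "w \<in> latt p [] \<inter> vecs n {0..<int p}"
    have "w j = 0" for j
      using w zdvd_not_zless[of "w j" "int p"]
      by (cases "j < n") (force simp: vecs_iff)+
    then show "w \<in> {\<lambda>_. 0}" by auto
  qed (use prime_gt_0_nat[OF p] in \<open>auto simp: vecs_iff\<close>)
  then show ?case by (simp del: latt.simps)
next
  case (Cons v vs)
  then have v: "v \<in> vecs n UNIV" and IH: "card (latt p vs \<inter> vecs n {0..<int p}) = p ^ rk p vs"
    by auto
  show ?case
  proof (cases "v \<in> latt p vs")
    case True
    then show ?thesis by (simp only: latt_Cons_member IH rk.simps if_True)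
  next
    case False
    then show ?thesis
      using card_latt_Cons[OF p v False] by (simp only: IH rk.simps if_False power_Suc)
  qed
qed

lemma rk_le_length: "rk p vs \<le> length vs"
  by (induction vs) auto

section \<open>Counting matrices over a prime field by rank\<close>

lemma prod_decreasing_powers:
  fixes x :: real
  assumes "x \<noteq> 0"
  shows "(\<Prod>i<m. 1 - x ^ i / x ^ Suc m) = (\<Prod>i=2..Suc m. 1 - 1 / x ^ i)"
proof -
  have "(\<Prod>i<m. 1 - x ^ i / x ^ Suc m) = (\<Prod>i\<in>{2..Suc m}. 1 - x ^ (Suc m - i) / x ^ Suc m)"
    by (rule prod.reindex_bij_witness[of _ "\<lambda>i. Suc m - i" "\<lambda>i. Suc m - i"]) auto
  also have "\<dots> = (\<Prod>i=2..Suc m. 1 - 1 / x ^ i)"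
    using assms by (intro prod.cong refl) (auto simp: power_diff)
  finally show ?thesis .
qed

context
  fixes n p :: nat
  assumes p: "prime p"
begin

abbreviation (input) "residue_vecs \<equiv> vecs n {0..<int p}"
abbreviation (input) "rank_count r d \<equiv> real (card {vs \<in> rows_of r residue_vecs. rk p vs = d})"

lemma card_latt_V: "vs \<in> rows_of r residue_vecs \<Longrightarrow> card (latt p vs \<inter> residue_vecs) = p ^ rk p vs"
  by (rule card_latt[OF p]) (auto simp: rows_of_def vecs_iff)

text \<open>One step of the rank chain: over a span of dimension d, p^d of the p^n rows keep the
  rank and the others raise it. The case \<open>d = 0\<close> is separate because
  \<open>d - 1\<close> is truncated subtraction.\<close>

lemma cnt_Suc:
  "rank_count (Suc r) d = real p ^ d * rank_count r d
     + (if d = 0 then 0 else (real p ^ n - real p ^ (d - 1)) * rank_count r (d - 1))"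
proof -
  have cV: "real (card residue_vecs) = real p ^ n" by (simp add: card_vecs)
  have finV: "finite residue_vecs" and finR: "finite (rows_of r residue_vecs)" by auto
  have fib: "real (card {v \<in> residue_vecs. rk p (v # vs) = d}) =
      (if rk p vs = d then real p ^ d else 0)
      + (if d \<noteq> 0 \<and> rk p vs = d - 1 then real p ^ n - real p ^ (d - 1) else 0)"
    if vs: "vs \<in> rows_of r residue_vecs" for vs
  proof -
    have "real (card (residue_vecs - latt p vs)) = real p ^ n - real p ^ rk p vs"
    proof -
      have "card residue_vecs = card (residue_vecs \<inter> latt p vs) + card (residue_vecs - latt p vs)"
        by (rule card_Int_Diff[OF finV])
      then have "real (card residue_vecs) = real (card (residue_vecs \<inter> latt p vs)) + real (card (residue_vecs - latt p vs))"
        by simp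
      then show ?thesis using card_latt_V[OF vs] cV by (simp add: Int_commute)
    qed
    moreover have "{v \<in> residue_vecs. rk p (v # vs) = d} =
        (if rk p vs = d then latt p vs \<inter> residue_vecs else if Suc (rk p vs) = d then residue_vecs - latt p vs else {})"
      by auto
    ultimately show ?thesis
      using card_latt_V[OF vs] by (auto split: if_splits)
  qed
  have "rank_count (Suc r) d = (\<Sum>vs\<in>rows_of r residue_vecs. real (card {v \<in> residue_vecs. rk p (v # vs) = d}))"
    by (subst card_rows_of_Suc[OF finV]) simp
  also have "\<dots> = (\<Sum>vs\<in>rows_of r residue_vecs. (if rk p vs = d then real p ^ d else 0)
      + (if d \<noteq> 0 \<and> rk p vs = d - 1 then real p ^ n - real p ^ (d - 1) else 0))"
    by (intro sum.cong refl fib)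
  also have "\<dots> = real p ^ d * rank_count r d
      + (if d = 0 then 0 else (real p ^ n - real p ^ (d - 1)) * rank_count r (d - 1))"
    using finR by (simp add: sum.distrib flip: sum.inter_filter)
  finally show ?thesis .
qed

lemma cnt_eq_0: "d > r \<Longrightarrow> rank_count r d = 0"
proof -
  assume "d > r"
  moreover have "rk p vs \<le> r" if "vs \<in> rows_of r residue_vecs" for vs
    using that rk_le_length[of p vs] by (simp add: rows_of_def)
  ultimately have "{vs \<in> rows_of r residue_vecs. rk p vs = d} = {}" by fastforce
  then show ?thesis by simp
qed

lemma cnt_full: "rank_count r r = (real p ^ n) ^ r * (\<Prod>i<r. 1 - real p ^ i / real p ^ n)"
proof (induction r)
  case 0
  have "{vs \<in> rows_of 0 residue_vecs. rk p vs = 0} = {[]}" by (auto simp: rows_of_0)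
  then show ?case by simp
next
  case (Suc r)
  then show ?case using cnt_eq_0[of r "Suc r"] prime_gt_0_nat[OF p]
    by (simp add: cnt_Suc field_simps)
qed

text \<open>Exactly one row fails to raise the rank. A failure at rank i has probability p^i / p^n,
  and the remaining factors are the same for every i, so the possible positions add up to a
  geometric sum, written as p^r / p^n times inverse powers.\<close>

lemma cnt_defect_1:
  "rank_count (Suc r) r = (real p ^ n) ^ Suc r * (\<Prod>i<r. 1 - real p ^ i / real p ^ n)
     * (real p ^ r / real p ^ n) * (\<Sum>i\<le>r. 1 / real p ^ i)"
proof (induction r)
  case 0
  show ?case using cnt_full[of 0] prime_gt_0_nat[OF p] by (simp add: cnt_Suc)
next
  case (Suc r)
  define y where "y = real p ^ n"
  define x where "x = real p ^ r"
  define P where "P = (\<Prod>i<r. 1 - real p ^ i / y)"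
  define G where "G = (\<Sum>i\<le>r. 1 / real p ^ i)"
  define Y where "Y = y ^ r"
  have nz: "real p \<noteq> 0" "y \<noteq> 0" using prime_gt_0_nat[OF p] by (auto simp: y_def)
  have G: "(\<Sum>i\<le>Suc r. 1 / real p ^ i) = 1 + G / real p"
    by (subst sum.atMost_Suc_shift) (simp add: G_def sum_divide_distrib mult.commute)
  have "rank_count (Suc (Suc r)) (Suc r) = real p * x * rank_count (Suc r) (Suc r) + (y - x) * rank_count (Suc r) r"
    by (subst cnt_Suc) (simp add: x_def y_def)
  also have "\<dots> = real p * x * (y * Y * (P * (1 - x / y))) + (y - x) * (y * Y * P * (x / y) * G)"
    unfolding Suc cnt_full by (simp add: P_def x_def y_def G_def Y_def)
  also have "\<dots> = y * (y * Y) * (P * (1 - x / y)) * (real p * x / y) * (1 + G / real p)"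
    using nz by (simp add: field_simps)
  also have "\<dots> = (real p ^ n) ^ Suc (Suc r) * (\<Prod>i<Suc r. 1 - real p ^ i / real p ^ n)
     * (real p ^ Suc r / real p ^ n) * (\<Sum>i\<le>Suc r. 1 / real p ^ i)"
    unfolding G by (simp add: P_def x_def y_def Y_def)
  finally show ?case .
qed

text \<open>Full rank and corank one share the product over i < n - 1. What is left is (1 - 1/q) +
  G/q = 1 + (G - 1)/q: removing the term i = 0 and dividing by q gives the sum of q^-i for i from 2
  to n.\<close>

lemma card_corank_le_1:
  assumes "n \<ge> 1"
  shows "real (card {vs \<in> rows_of n residue_vecs. n - 1 \<le> rk p vs}) =
    (real p ^ n) ^ n * ((\<Prod>i=2..n. 1 - 1 / real p ^ i) * (1 + (\<Sum>i=2..n. 1 / real p ^ i)))"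
proof -
  obtain m where n: "n = Suc m" using assms by (cases n) auto
  define q where "q = real p"
  have q: "q > 0" using prime_gt_0_nat[OF p] by (simp add: q_def)
  define P where "P = (\<Prod>i<m. 1 - q ^ i / q ^ n)"
  define G where "G = (\<Sum>i\<le>m. 1 / q ^ i)"
  have "{vs \<in> rows_of n residue_vecs. n - 1 \<le> rk p vs} =
      {vs \<in> rows_of n residue_vecs. rk p vs = n} \<union> {vs \<in> rows_of n residue_vecs. rk p vs = m}"
  proof (intro equalityI subsetI)
    fix vs assume "vs \<in> {vs \<in> rows_of n residue_vecs. n - 1 \<le> rk p vs}"
    then show "vs \<in> {vs \<in> rows_of n residue_vecs. rk p vs = n} \<union> {vs \<in> rows_of n residue_vecs. rk p vs = m}"
      using rk_le_length[of p vs] by (auto simp: rows_of_def n)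
  qed (auto simp: n)
  then have "real (card {vs \<in> rows_of n residue_vecs. n - 1 \<le> rk p vs}) = rank_count n n + rank_count n m"
    by (subst card_Un_disjoint[symmetric, unfolded of_nat_eq_iff[symmetric, where 'a = real] of_nat_add])
       (auto simp: n)
  also have "\<dots> = (q ^ n) ^ n * (P * (1 - 1 / q)) + (q ^ n) ^ n * P * (1 / q) * G"
    using q unfolding cnt_full cnt_defect_1[of m, folded n]
    by (simp add: P_def G_def q_def[symmetric]) (simp add: n)
  also have "\<dots> = (q ^ n) ^ n * (P * (1 + (G - 1) / q))"
    using q by (simp add: field_simps)
  also have "P = (\<Prod>i=2..n. 1 - 1 / q ^ i)"
    using prod_decreasing_powers[of q m] q by (simp add: P_def n)
  also have "G - 1 = (\<Sum>i=1..m. 1 / q ^ i)"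
    by (simp add: G_def atMost_atLeast0 sum.atLeast_Suc_atMost)
  also have "(\<Sum>i=1..m. 1 / q ^ i) / q = (\<Sum>i=2..n. 1 / q ^ i)"
    unfolding sum_divide_distrib n
    by (rule sum.reindex_bij_witness[of _ "\<lambda>i. i - 1" Suc]) auto
  finally show ?thesis by (simp add: q_def)
qed

end

section \<open>Large primes\<close>

text \<open>The class consists of r + p q with q in an integer interval whose ends are ceilings, so
  the count misses the real length by at most 1. The error does not depend on p, which serves both
  the densities for growing k and the uniform bounds for p up to the box width.\<close>

lemma card_residue_class:
  fixes a b r :: int and p :: nat
  assumes p: "p > 0" and ab: "a \<le> b"
  shows "\<bar>real (card {x \<in> {a..<b}. x mod int p = r mod int p}) - (b - a) / p\<bar> \<le> 1"
proof -
  define lo where "lo = \<lceil>(a - r) / p\<rceil>"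
  define hi where "hi = \<lceil>(b - r) / p\<rceil>"
  have q_lo: "lo \<le> q \<longleftrightarrow> a \<le> r + int p * q" for q
  proof -
    have "lo \<le> q \<longleftrightarrow> (a - r) / p \<le> q" by (simp add: lo_def ceiling_le_iff)
    also have "\<dots> \<longleftrightarrow> real_of_int (a - r) \<le> real_of_int (int p * q)"
      using p by (simp add: field_simps)
    finally show ?thesis by (simp only: of_int_le_iff) auto
  qed
  have q_hi: "q < hi \<longleftrightarrow> r + int p * q < b" for q
  proof -
    have "q < hi \<longleftrightarrow> q < (b - r) / p" by (simp add: hi_def less_ceiling_iff)
    also have "\<dots> \<longleftrightarrow> real_of_int (int p * q) < real_of_int (b - r)"
      using p by (simp add: field_simps)
    finally show ?thesis by (simp only: of_int_less_iff) auto
  qed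
  have "bij_betw (\<lambda>q. r + int p * q) {lo..<hi} {x \<in> {a..<b}. x mod int p = r mod int p}"
  proof (rule bij_betwI[where g = "\<lambda>x. (x - r) div int p"])
    show "(\<lambda>x. (x - r) div int p) \<in> {x \<in> {a..<b}. x mod int p = r mod int p} \<rightarrow> {lo..<hi}"
      by (auto simp: q_lo q_hi mod_eq_dvd_iff)
  qed (use p in \<open>auto simp: q_lo q_hi mod_eq_dvd_iff\<close>)
  then have "card {x \<in> {a..<b}. x mod int p = r mod int p} = nat (hi - lo)"
    by (metis bij_betw_same_card card_atLeastLessThan_int)
  moreover have "lo \<le> hi" unfolding lo_def hi_def using ab p by (intro ceiling_mono divide_right_mono) auto
  ultimately have "real (card {x \<in> {a..<b}. x mod int p = r mod int p}) = hi - lo" by simp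
  moreover have "(b - a) / p = (b - r) / p - (a - r) / p" using p by (simp add: field_simps)
  moreover have "(b - r) / p \<le> hi" "hi < (b - r) / p + 1" "(a - r) / p \<le> lo" "lo < (a - r) / p + 1"
    unfolding hi_def lo_def by linarith+
  ultimately show ?thesis by linarith
qed

lemma card_vecs_coord_0:
  assumes "j < n" and "finite A"
  shows "card {w \<in> vecs n (insert 0 A). w j = 0 \<and> (\<forall>i<n. i \<noteq> j \<longrightarrow> w i \<in> A)} = card A ^ (n - 1)"
proof -
  have "{w \<in> vecs n (insert 0 A). w j = 0 \<and> (\<forall>i<n. i \<noteq> j \<longrightarrow> w i \<in> A)}
      = PiE_dflt {..<n} 0 (\<lambda>i. if i = j then {0} else A)"
  proof (intro equalityI subsetI)
    fix w assume "w \<in> PiE_dflt {..<n} 0 (\<lambda>i. if i = j then {0} else A)"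
    then have w: "\<And>i. i < n \<Longrightarrow> w i \<in> (if i = j then {0} else A)"
      and w0: "\<And>i. \<not> i < n \<Longrightarrow> w i = 0" by (auto simp: PiE_dflt_def)
    have "w j = 0" using w[OF assms(1)] by simp
    moreover have "w i \<in> A" if "i < n" "i \<noteq> j" for i using w[OF that(1)] that(2) by simp
    ultimately show "w \<in> {w \<in> vecs n (insert 0 A). w j = 0 \<and> (\<forall>i<n. i \<noteq> j \<longrightarrow> w i \<in> A)}"
      using w0 by (auto simp: vecs_iff not_less)
  qed (auto simp: vecs_iff PiE_dflt_def)
  also have "card \<dots> = (\<Prod>i<n. card (if i = j then {0} else A))"
    using assms by (subst card_PiE_dflt) auto
  also have "\<dots> = (\<Prod>i\<in>{..<n} - {j}. card A)"
    using assms(1) by (subst prod.remove[of _ j]) auto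
  also have "\<dots> = card A ^ (n - 1)" using assms(1) by simp
  finally show ?thesis .
qed

text \<open>Projection along coordinate \<open>j\<close>: bounded intersections with the lines
  parallel to that axis save one factor \<open>card A\<close>, the source of 1/k at large
  primes.\<close>

lemma card_le_fibres:
  assumes j: "j < n" and A: "finite A" "0 \<in> A" and S: "S \<subseteq> vecs n A"
    and fib: "\<And>u. card {v \<in> S. v(j := 0) = u} \<le> t"
  shows "card S \<le> t * card A ^ (n - 1)"
proof -
  define W where "W = {w \<in> vecs n (insert 0 A). w j = 0 \<and> (\<forall>i<n. i \<noteq> j \<longrightarrow> w i \<in> A)}"
  have W: "card W = card A ^ (n - 1)" unfolding W_def by (rule card_vecs_coord_0[OF j A(1)])
  have finW: "finite W" using A by (simp add: W_def)
  have "S \<subseteq> (\<Union>u\<in>W. {v \<in> S. v(j := 0) = u})"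
  proof
    fix v assume v: "v \<in> S"
    have "v \<in> vecs n A" using v S by blast
    then have "v(j := 0) \<in> W" using j by (simp add: W_def vecs_iff)
    then show "v \<in> (\<Union>u\<in>W. {v \<in> S. v(j := 0) = u})" using v by blast
  qed
  then have "card S \<le> card (\<Union>u\<in>W. {v \<in> S. v(j := 0) = u})"
    using finW finite_subset[OF S finite_vecs[OF A(1)]] by (intro card_mono) auto
  also have "\<dots> \<le> (\<Sum>u\<in>W. card {v \<in> S. v(j := 0) = u})" by (rule card_UN_le[OF finW])
  also have "\<dots> \<le> (\<Sum>u\<in>W. t)" by (intro sum_mono fib)
  finally show ?thesis by (simp add: W mult.commute)
qed

lemma prod_primes_dvd:
  assumes "finite Q" "\<And>p. p \<in> Q \<Longrightarrow> prime p \<and> p dvd (m :: nat)"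
  shows "\<Prod>Q dvd m"
  using assms
proof (induction Q rule: finite_induct)
  case (insert p Q)
  have "coprime p (\<Prod>Q)"
    using insert by (intro prod_coprime_right primes_coprime) auto
  then show ?case using insert by (simp add: divides_mult)
qed auto

text \<open>The product of these primes divides \<open>A\<close>, so \<open>K\<close> to the power
  of their number is at most |A|.\<close>

lemma card_prime_divisors_above:
  fixes A :: int
  assumes A: "A \<noteq> 0" and K: "K \<ge> 2" and less: "\<bar>A\<bar> < int K ^ t"
  shows "finite {p. prime p \<and> p > K \<and> int p dvd A}" "card {p. prime p \<and> p > K \<and> int p dvd A} \<le> t"
proof -
  let ?Q = "{p. prime p \<and> p > K \<and> int p dvd A}"
  have "?Q \<subseteq> {..nat \<bar>A\<bar>}"
  proof
    fix p assume "p \<in> ?Q"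
    then have "\<bar>int p\<bar> \<le> \<bar>A\<bar>" using A by (intro dvd_imp_le_int) auto
    then show "p \<in> {..nat \<bar>A\<bar>}" by simp
  qed
  then show fin: "finite ?Q" using finite_subset by blast
  have "(\<Prod>p\<in>?Q. p) dvd nat \<bar>A\<bar>"
    using fin by (intro prod_primes_dvd) (auto simp flip: int_dvd_int_iff)
  then have "(\<Prod>p\<in>?Q. p) \<le> nat \<bar>A\<bar>" using A by (intro dvd_imp_le) auto
  moreover have "(\<Prod>p\<in>?Q. K) \<le> (\<Prod>p\<in>?Q. p)" by (intro prod_mono) auto
  ultimately have "K ^ card ?Q \<le> nat \<bar>A\<bar>" by simp
  also have "\<dots> < K ^ t"
  proof -
    have "int (nat \<bar>A\<bar>) < int (K ^ t)" using less by simp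
    then show ?thesis by (simp only: of_nat_less_iff)
  qed
  finally have "K ^ card ?Q < K ^ t" .
  moreover have "1 < K" using K by simp
  ultimately have "card ?Q < t" by (rule power_less_imp_less_exp[rotated])
  then show "card ?Q \<le> t" by simp
qed

section \<open>Independence modulo p on the initial columns\<close>

definition trunc :: "nat \<Rightarrow> (nat \<Rightarrow> int) \<Rightarrow> nat \<Rightarrow> int" where
  "trunc m v = (\<lambda>j. if j < m then v j else 0)"

lemma trunc_trunc: "trunc l (trunc m v) = trunc (min l m) v"
  by (auto simp: trunc_def)

lemma trunc_latt: "w \<in> latt p vs \<Longrightarrow> trunc m w \<in> latt p (map (trunc m) vs)"
proof (induction vs arbitrary: w)
  case (Cons v vs)
  then obtain u c where *: "w = (\<lambda>j. u j + c * v j)" "u \<in> latt p vs" by auto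
  have "trunc m w = (\<lambda>j. trunc m u j + c * trunc m v j)" by (rule ext) (simp add: trunc_def *)
  then show ?case using Cons.IH[OF *(2)] latt_ConsI by simp
qed (auto simp: trunc_def)

lemma full_rank_Cons: "rk p (v # vs) = Suc (length vs) \<longleftrightarrow> v \<notin> latt p vs \<and> rk p vs = length vs"
  using rk_le_length[of p vs] by auto

text \<open>A linear dependence modulo p persists when columns are zeroed, so independence on the
  first \<open>m\<close> columns is inherited by the full rows.\<close>

lemma full_rank_trunc: "rk p (map (trunc m) vs) = length vs \<Longrightarrow> rk p vs = length vs"
proof (induction vs)
  case (Cons v vs)
  then have "rk p (trunc m v # map (trunc m) vs) = Suc (length (map (trunc m) vs))" by simp
  then have "trunc m v \<notin> latt p (map (trunc m) vs)" "rk p (map (trunc m) vs) = length vs"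
    unfolding full_rank_Cons by auto
  then have "rk p (v # vs) = Suc (length vs)"
    unfolding full_rank_Cons using trunc_latt Cons.IH by blast
  then show ?case by simp
qed auto

text \<open>When the rows are independent on the first \<open>m\<close> columns, a combination
  vanishing there modulo p has all its coefficients divisible by p. Inside the span, those columns
  therefore determine all the others modulo p.\<close>

lemma latt_trunc_zero:
  assumes "prime p"
  shows "rk p (map (trunc m) vs) = length vs \<Longrightarrow> w \<in> latt p vs \<Longrightarrow> (\<And>j. int p dvd trunc m w j) \<Longrightarrow> int p dvd w j"
proof (induction vs arbitrary: w)
  case (Cons v vs)
  from Cons.prems(1) have "rk p (trunc m v # map (trunc m) vs) = Suc (length (map (trunc m) vs))" by simp
  then have v: "trunc m v \<notin> latt p (map (trunc m) vs)" and r: "rk p (map (trunc m) vs) = length vs"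
    unfolding full_rank_Cons by auto
  obtain u c where w: "w = (\<lambda>j. u j + c * v j)" "u \<in> latt p vs" using Cons.prems(2) by auto
  have cw: "trunc m w = (\<lambda>j. trunc m u j + c * trunc m v j)" by (rule ext) (simp add: trunc_def w)
  have "int p dvd c"
  proof (rule ccontr)
    assume c: "\<not> int p dvd c"
    have "(\<lambda>j. 1 * trunc m w j + (-1) * trunc m u j) \<in> latt p (map (trunc m) vs)"
      by (rule latt_lincomb[OF latt_multiples[OF Cons.prems(3)] trunc_latt[OF w(2)]])
    moreover have "(\<lambda>j. 1 * trunc m w j + (-1) * trunc m u j) = (\<lambda>j. c * trunc m v j)"
      by (simp add: cw)
    ultimately show False using latt_cancel[OF assms c] v by metis
  qed
  moreover have "int p dvd trunc m u i" for i
    using Cons.prems(3)[of i] \<open>int p dvd c\<close> by (simp add: cw dvd_add_left_iff)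
  ultimately show ?case using Cons.IH[OF r w(2)] by (simp add: w)
qed auto

lemma latt_dot:
  assumes "\<And>v. v \<in> set vs \<Longrightarrow> (\<Sum>j<m. c j * v j) = 0"
  shows "w \<in> latt p vs \<Longrightarrow> int p dvd (\<Sum>j<m. c j * w j)"
  using assms
proof (induction vs arbitrary: w)
  case (Cons v vs)
  then obtain u d where w: "w = (\<lambda>j. u j + d * v j)" "u \<in> latt p vs" by auto
  have "(\<Sum>j<m. c j * w j) = (\<Sum>j<m. c j * u j) + d * (\<Sum>j<m. c j * v j)"
    by (simp add: w algebra_simps sum.distrib sum_distrib_left)
  then show ?case using Cons.IH[OF w(2)] Cons.prems(2) by simp
qed (auto intro: dvd_sum)

lemma abs_dot_le:
  fixes c v :: "nat \<Rightarrow> int"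
  assumes "\<And>j. j < m \<Longrightarrow> \<bar>c j\<bar> \<le> X" "\<And>j. j < m \<Longrightarrow> \<bar>v j\<bar> \<le> k"
  shows "\<bar>\<Sum>j<m. c j * v j\<bar> \<le> int m * k * X"
proof -
  have "\<bar>\<Sum>j<m. c j * v j\<bar> \<le> (\<Sum>j<m. \<bar>c j * v j\<bar>)" by (rule sum_abs)
  also have "\<dots> \<le> (\<Sum>j<m. X * k)"
  proof (intro sum_mono)
    fix j assume "j \<in> {..<m}"
    then have "\<bar>c j\<bar> \<le> X" "\<bar>v j\<bar> \<le> k" using assms by auto
    then show "\<bar>c j * v j\<bar> \<le> X * k" unfolding abs_mult by (intro mult_mono) auto
  qed
  finally show ?thesis by (simp add: ac_simps)
qed

(* Siegel's lemma, by the pigeonhole principle *)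
lemma small_orthogonal_vector:
  assumes "length vs < m" and bd: "\<And>v j. v \<in> set vs \<Longrightarrow> j < m \<Longrightarrow> \<bar>v j\<bar> \<le> int k"
  shows "\<exists>c. (\<exists>j<m. c j \<noteq> 0) \<and> (\<forall>j\<ge>m. c j = 0) \<and> (\<forall>j. \<bar>c j\<bar> \<le> (2 * int m * int k + 1) ^ length vs)
      \<and> (\<forall>v\<in>set vs. (\<Sum>j<m. c j * v j) = 0)"
proof -
  define r where "r = length vs"
  \<comment> \<open>With this X the images lie in a box of (2 m k X + 1)^r <= X^(r+1) points, fewer
    than the (X + 1)^m candidate vectors because r < m.\<close>
  define X where "X = (2 * m * k + 1) ^ r"
  define f where "f = (\<lambda>c. map (\<lambda>v. \<Sum>j<m. c j * v j) vs)"
  define R where "R = rows_of r {- int (m * k * X)..int (m * k * X)}"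
  have X1: "X \<ge> 1" by (simp add: X_def)
  have "f ` vecs m {0..int X} \<subseteq> R"
  proof
    fix y assume "y \<in> f ` vecs m {0..int X}"
    then obtain c where c: "c \<in> vecs m {0..int X}" "y = f c" by auto
    have "\<bar>\<Sum>j<m. c j * v j\<bar> \<le> int m * int k * int X" if "v \<in> set vs" for v
      using c(1) bd[OF that] by (intro abs_dot_le) (auto simp: vecs_iff)
    then show "y \<in> R" by (fastforce simp: R_def rows_of_def c f_def r_def)
  qed
  then have "card (f ` vecs m {0..int X}) \<le> card R"
    by (intro card_mono) (simp_all add: R_def)
  also have "card R = (2 * m * k * X + 1) ^ r"
    by (simp add: R_def card_rows_of nat_add_distrib nat_mult_distrib) (simp add: algebra_simps)
  also have "\<dots> \<le> ((2 * m * k + 1) * X) ^ r"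
    using X1 by (intro power_mono) (simp_all add: algebra_simps)
  also have "\<dots> = X ^ Suc r" by (simp only: power_mult_distrib X_def[symmetric] power_Suc)
  also have "\<dots> \<le> X ^ m" using X1 assms(1) by (intro power_increasing) (auto simp: r_def)
  also have "\<dots> < (X + 1) ^ m" using assms(1) by (intro power_strict_mono) auto
  also have "\<dots> = card (vecs m {0..int X})" by (simp add: card_vecs nat_add_distrib)
  finally have "\<not> inj_on f (vecs m {0..int X})" using pigeonhole by blast
  then obtain a b where ab: "a \<in> vecs m {0..int X}" "b \<in> vecs m {0..int X}" "f a = f b" "a \<noteq> b"
    by (auto simp: inj_on_def)
  define c where "c = (\<lambda>j. a j - b j)"
  have "\<exists>j<m. c j \<noteq> 0"
  proof (rule ccontr)
    assume "\<not> (\<exists>j<m. c j \<noteq> 0)"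
    then have "a j = b j" for j using ab by (cases "j < m") (auto simp: c_def vecs_iff)
    then show False using ab by auto
  qed
  moreover have "\<forall>j\<ge>m. c j = 0" using ab by (auto simp: c_def vecs_iff)
  moreover have "\<bar>c j\<bar> \<le> int X" for j using ab by (cases "j < m") (fastforce simp: c_def vecs_iff)+
  moreover have "(\<Sum>j<m. c j * v j) = 0" if "v \<in> set vs" for v
    using ab(3) that by (auto simp: f_def c_def algebra_simps sum_subtractf)
  ultimately show ?thesis unfolding r_def[symmetric] by (intro exI[of _ c]) (simp add: X_def add.commute)
qed

text \<open>A single event covers all primes above \<open>K\<close>. The number \<open>m\<close> of
  columns is a separate parameter because the induction over rows gives up one column with each
  row.\<close>

definition dependent_above :: "nat \<Rightarrow> nat \<Rightarrow> nat \<Rightarrow> (nat \<Rightarrow> int) list \<Rightarrow> bool" where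
  "dependent_above K r m vs \<longleftrightarrow> (\<exists>p. prime p \<and> p > K \<and> rk p (map (trunc m) vs) < r)"

lemma finite_box [simp]: "finite {x. - int k \<le> x \<and> x \<le> int k \<and> P x}"
  by (rule finite_subset[of _ "{- int k..int k}"]) auto

context
  fixes n k :: nat
  assumes k: "k \<ge> 1"
begin

abbreviation (input) "box_vecs \<equiv> vecs n {- int k..int k}"
abbreviation (input) "width \<equiv> 2 * k + 1"

lemma card_box: "card {- int k..int k} = width"
  by simp

lemma card_B: "card box_vecs = width ^ n"
  by (simp only: card_vecs card_box finite_atLeastAtMost_int)

text \<open>For p up to the box width the discrepancy 1 is itself at most width / p, whence the
  factor 2.\<close>

lemma card_box_residue:
  assumes "p > 0" "p \<le> width"
  shows "real (card {x \<in> {- int k..int k}. x mod int p = r mod int p}) \<le> 2 * width / p"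
proof -
  have "{- int k..int k} = {- int k..<int k + 1}" by auto
  moreover have "real_of_int (int k + 1 - - int k) = real width" by simp
  moreover have "- int k \<le> int k + 1" by simp
  ultimately have "\<bar>real (card {x \<in> {- int k..int k}. x mod int p = r mod int p}) - real width / p\<bar> \<le> 1"
    using card_residue_class[OF assms(1), of "- int k" "int k + 1" r] by (simp only:)
  then have "real (card {x \<in> {- int k..int k}. x mod int p = r mod int p}) \<le> real width / p + 1"
    by linarith
  also have "\<dots> \<le> real width / p + real width / p" using assms by (simp add: divide_simps)
  finally show ?thesis by simp
qed

text \<open>At most p^(n-2) residue vectors lie in the span, and each is the reduction of at most (2
  width / p)^n points of the box; the powers of p leave p^-2.\<close>

lemma card_B_latt:
  assumes p: "prime p" "p \<le> width" and vs: "set vs \<subseteq> box_vecs" and r: "rk p vs + 2 \<le> n"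
  shows "real (card (box_vecs \<inter> latt p vs)) \<le> 2 ^ n / (real p)\<^sup>2 * real (card box_vecs)"
proof -
  have p0: "p > 0" using p prime_gt_0_nat by blast
  let ?L = "latt p vs \<inter> vecs n {0..<int p}"
  let ?F = "\<lambda>u. PiE_dflt {..<n} 0 (\<lambda>j. {x \<in> {- int k..int k}. x mod int p = u j mod int p})"
  have fin: "finite ?L" by simp
  have "box_vecs \<inter> latt p vs \<subseteq> (\<Union>u\<in>?L. ?F u)"
  proof
    fix v assume v: "v \<in> box_vecs \<inter> latt p vs"
    have "(\<lambda>j. v j mod int p) \<in> ?L"
      using v p0 latt_cong[of v p vs "\<lambda>j. v j mod int p"] by (auto simp: vecs_iff cong_def)
    moreover have "v \<in> ?F (\<lambda>j. v j mod int p)" using v by (auto simp: vecs_iff PiE_dflt_def)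
    ultimately show "v \<in> (\<Union>u\<in>?L. ?F u)" by blast
  qed
  then have "card (box_vecs \<inter> latt p vs) \<le> card (\<Union>u\<in>?L. ?F u)"
    using fin by (intro card_mono finite_UN_I finite_PiE_dflt) auto
  also have "\<dots> \<le> (\<Sum>u\<in>?L. card (?F u))" by (rule card_UN_le[OF fin])
  finally have "real (card (box_vecs \<inter> latt p vs)) \<le> (\<Sum>u\<in>?L. real (card (?F u)))"
    by (simp flip: of_nat_sum)
  also have "\<dots> \<le> (\<Sum>u\<in>?L. (2 * width / p) ^ n)"
  proof (intro sum_mono)
    fix u
    have "real (card (?F u)) = (\<Prod>j<n. real (card {x \<in> {- int k..int k}. x mod int p = u j mod int p}))"
      by (subst card_PiE_dflt) auto
    also have "\<dots> \<le> (\<Prod>j<n. 2 * width / p)"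
      by (intro prod_mono conjI card_box_residue p0 p) auto
    finally show "real (card (?F u)) \<le> (2 * width / p) ^ n" by simp
  qed
  also have "\<dots> = real p ^ rk p vs * (2 * width / p) ^ n"
    using card_latt[OF p(1), of vs n] vs by (simp add: vecs_iff subset_iff)
  also have "\<dots> = 2 ^ n * real (card box_vecs) * (real p ^ rk p vs / real p ^ n)"
    by (simp only: card_B power_divide power_mult_distrib of_nat_power of_nat_mult of_nat_numeral)
       (simp add: ac_simps)
  also have "real p ^ rk p vs / real p ^ n \<le> 1 / (real p)\<^sup>2"
    using p0 power_increasing[OF r, of "real p"] by (simp add: divide_simps flip: power_add)
  finally show ?thesis by (simp add: mult_left_mono)
qed

text \<open>Either the earlier rows are already dependent, or they are independent and the new row
  falls into their span. As fewer than n rows are involved, that span has codimension at least 2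
  when the row is added.\<close>

lemma card_dependent_small:
  assumes p: "prime p" "p \<le> width"
  shows "r < n \<Longrightarrow> real (card {vs \<in> rows_of r box_vecs. rk p vs < r}) \<le> real r * 2 ^ n / (real p)\<^sup>2 * real (card box_vecs) ^ r"
proof (induction r)
  case (Suc r)
  let ?b = "real (card box_vecs)" let ?e = "2 ^ n / (real p)\<^sup>2"
  have fin: "finite box_vecs" by simp
  have "real (card {xs \<in> rows_of (Suc r) box_vecs. rk p xs < Suc r})
      = (\<Sum>vs\<in>rows_of r box_vecs. real (card {v \<in> box_vecs. rk p (v # vs) < Suc r}))"
    by (subst card_rows_of_Suc[OF fin]) simp
  also have "\<dots> \<le> (\<Sum>vs\<in>rows_of r box_vecs. (if rk p vs < r then ?b else 0) + ?e * ?b)"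
  proof (intro sum_mono)
    fix vs assume vs: "vs \<in> rows_of r box_vecs"
    show "real (card {v \<in> box_vecs. rk p (v # vs) < Suc r}) \<le> (if rk p vs < r then ?b else 0) + ?e * ?b"
    proof (cases "rk p vs < r")
      case True
      have "card {v \<in> box_vecs. rk p (v # vs) < Suc r} \<le> card box_vecs" by (intro card_mono) auto
      then show ?thesis using True by (simp add: add_increasing2)
    next
      case False
      then have "rk p vs = r" using rk_le_length[of p vs] vs by (simp add: rows_of_def)
      then have "{v \<in> box_vecs. rk p (v # vs) < Suc r} = box_vecs \<inter> latt p vs" by auto
      moreover have "real (card (box_vecs \<inter> latt p vs)) \<le> 2 ^ n / (real p)\<^sup>2 * ?b"
        using vs Suc.prems \<open>rk p vs = r\<close> by (intro card_B_latt p) (auto simp: rows_of_def)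
      ultimately show ?thesis using False by simp
    qed
  qed
  also have "\<dots> = ?b * card {vs \<in> rows_of r box_vecs. rk p vs < r} + ?e * ?b * ?b ^ r"
    by (simp add: sum.distrib card_rows_of flip: sum.inter_filter)
  also have "\<dots> \<le> ?b * (r * ?e * ?b ^ r) + ?e * ?b * ?b ^ r"
    using Suc by (intro add_mono mult_left_mono) auto
  also have "\<dots> = real (Suc r) * 2 ^ n / (real p)\<^sup>2 * ?b ^ Suc r" by (simp add: algebra_simps add_divide_distrib)
  finally show ?case .
qed auto

(* A large prime p puts v into the span of vs only if p divides the integer c.v, which does not
   involve the last coordinate; for each of the boundedly many such p, that coordinate is determined. *)
lemma card_extend_dependent_above:
  assumes vs: "vs \<in> rows_of r box_vecs" and r: "r < l" "Suc l \<le> n" and nb: "\<not> dependent_above width r l vs"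
  shows "card {v \<in> box_vecs. dependent_above width (Suc r) (Suc l) (v # vs)} \<le> (1 + (n + 1)\<^sup>2) * width ^ (n - 1)"
proof -
  have len: "length vs = r" and vsB: "\<And>v. v \<in> set vs \<Longrightarrow> v \<in> box_vecs" using vs by (auto simp: rows_of_def)
  \<comment> \<open>The hypothesis \<open>nb\<close> gives independence on the first
    \<open>l\<close> columns for all primes above the width simultaneously.\<close>
  have full: "rk p (map (trunc l) vs) = r" if "prime p" "p > width" for p
    using nb that rk_le_length[of p "map (trunc l) vs"] len by (auto simp: dependent_above_def not_less intro: antisym)
  have "\<exists>c. (\<exists>j<l. c j \<noteq> 0) \<and> (\<forall>j\<ge>l. c j = 0) \<and> (\<forall>j. \<bar>c j\<bar> \<le> (2 * int l * int k + 1) ^ length vs)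
      \<and> (\<forall>v\<in>set vs. (\<Sum>j<l. c j * v j) = 0)"
  proof (rule small_orthogonal_vector)
    fix v j assume "v \<in> set vs" "j < l"
    then have "v j \<in> {- int k..int k}" using vsB[of v] r by (simp add: vecs_iff)
    then show "\<bar>v j\<bar> \<le> int k" by auto
  qed (use len r in simp)
  then obtain c i where i: "i < l" "c i \<noteq> 0" and cX: "\<And>j. \<bar>c j\<bar> \<le> (2 * int l * int k + 1) ^ r"
    and c0: "\<And>v. v \<in> set vs \<Longrightarrow> (\<Sum>j<l. c j * v j) = 0" using len by auto
  define dot where "dot = (\<lambda>v. \<Sum>j<l. c j * v j)"
  \<comment> \<open>\<open>S1\<close> holds the rows with c.v = 0, where divisibility excludes no
    prime; in \<open>S2\<close> the prime has to divide a nonzero integer.\<close>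
  define S1 where "S1 = {v \<in> box_vecs. dot v = 0}"
  define good where "good = (\<lambda>v p. prime p \<and> p > width \<and> trunc (Suc l) v \<in> latt p (map (trunc (Suc l)) vs))"
  define S2 where "S2 = {v \<in> box_vecs. dot v \<noteq> 0 \<and> (\<exists>p. good v p)}"
  have dot_trunc: "dot (trunc (Suc l) v) = dot v" for v
    by (auto simp: dot_def trunc_def intro!: sum.cong)
  have "{v \<in> box_vecs. dependent_above width (Suc r) (Suc l) (v # vs)} \<subseteq> S1 \<union> S2"
  proof
    fix v assume "v \<in> {v \<in> box_vecs. dependent_above width (Suc r) (Suc l) (v # vs)}"
    then obtain p where p: "v \<in> box_vecs" "prime p" "p > width" "rk p (trunc (Suc l) v # map (trunc (Suc l)) vs) < Suc r"
      by (auto simp: dependent_above_def simp del: rk.simps)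
    have "map (trunc l) (map (trunc (Suc l)) vs) = map (trunc l) vs" by (simp add: trunc_trunc)
    then have "rk p (map (trunc (Suc l)) vs) = r"
      using full_rank_trunc[of p l "map (trunc (Suc l)) vs"] full[OF p(2,3)] len
      by (simp del: map_map)
    then have "trunc (Suc l) v \<in> latt p (map (trunc (Suc l)) vs)"
      using p(4) by (simp split: if_splits)
    then have "good v p" using p unfolding good_def by blast
    then show "v \<in> S1 \<union> S2" using p(1) by (auto simp: S1_def S2_def)
  qed
  then have "card {v \<in> box_vecs. dependent_above width (Suc r) (Suc l) (v # vs)} \<le> card (S1 \<union> S2)"
    by (intro card_mono) (auto simp: S1_def S2_def)
  also have "\<dots> \<le> card S1 + card S2" by (rule card_Un_le)
  \<comment> \<open>The equation c.v = 0 determines coordinate \<open>i\<close>, where c is nonzero,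
    from the other coordinates.\<close>
  also have "card S1 \<le> 1 * card {- int k..int k} ^ (n - 1)"
  proof (rule card_le_fibres[where j = i])
    fix u
    have "v = v'" if v: "v \<in> S1" "v' \<in> S1" "v(i := 0) = u" "v'(i := 0) = u" for v v'
    proof -
      have eq: "v j = v' j" if "j \<noteq> i" for j using v that by (metis fun_upd_other)
      have "dot v - dot v' = (\<Sum>j<l. c j * (v j - v' j))"
        by (simp add: dot_def sum_subtractf algebra_simps)
      also have "\<dots> = c i * (v i - v' i)"
        using i eq by (subst sum.remove[of _ i]) (auto intro!: sum.neutral)
      finally have "v i = v' i" using i v by (simp add: S1_def)
      then show ?thesis using eq by (metis ext)
    qed
    then have "\<forall>x\<in>{v \<in> S1. v(i := 0) = u}. \<forall>y\<in>{v \<in> S1. v(i := 0) = u}. x = y" by blast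
    moreover have "finite {v \<in> S1. v(i := 0) = u}" by (simp add: S1_def)
    ultimately show "card {v \<in> S1. v(i := 0) = u} \<le> 1" by (simp add: card_le_Suc0_iff_eq)
  qed (use i r in \<open>auto simp: S1_def\<close>)
  also have "card S2 \<le> (n + 1)\<^sup>2 * card {- int k..int k} ^ (n - 1)"
  proof (rule card_le_fibres[where j = l])
    fix u
    show "card {v \<in> S2. v(l := 0) = u} \<le> (n + 1)\<^sup>2"
    proof (cases "{v \<in> S2. v(l := 0) = u} = {}")
      case False
      then obtain v0 where v0: "v0 \<in> S2" "v0(l := 0) = u" by auto
      have dot_u: "dot v = dot u" if "v(l := 0) = u" for v
        unfolding dot_def that[symmetric] by (intro sum.cong) auto
      have u0: "dot u \<noteq> 0" using v0 dot_u[OF v0(2)] by (simp add: S2_def)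
      \<comment> \<open>All constants are absorbed into powers of the width; this yields |c.v| <
        width^((n+1)^2), and the exponent then bounds the number of prime divisors above the
        width.\<close>
      have "n < 2 ^ n" by (rule less_exp)
      also have "(2::nat) ^ n \<le> width ^ n" using k by (intro power_mono) auto
      finally have nK: "int n \<le> int width ^ n" by (metis less_imp_le of_nat_le_iff of_nat_power)
      have "\<bar>dot u\<bar> = \<bar>dot v0\<bar>" using dot_u[OF v0(2)] by simp
      also have "\<dots> \<le> int l * int k * (2 * int l * int k + 1) ^ r"
        unfolding dot_def
      proof (intro abs_dot_le cX)
        fix j assume "j < l"
        then have "v0 j \<in> {- int k..int k}" using v0(1) r by (simp add: S2_def vecs_iff)
        then show "\<bar>v0 j\<bar> \<le> int k" by auto
      qed
      also have "\<dots> \<le> (int width ^ n * int k) * (int width ^ n * int width) ^ r"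
      proof (intro mult_mono power_mono)
        show l: "int l \<le> int width ^ n" using nK r by linarith
        have "2 * int l * int k + 1 = int l * (2 * int k) + 1" by simp
        also have "\<dots> \<le> int width ^ n * (2 * int k) + int width ^ n"
          using l by (intro add_mono mult_right_mono) (auto intro: one_le_power)
        finally show "2 * int l * int k + 1 \<le> int width ^ n * int width" by (simp add: algebra_simps)
      qed auto
      also have "\<dots> < (int width ^ n * int width) * (int width ^ n * int width) ^ r"
        by (intro mult_strict_right_mono mult_strict_left_mono) auto
      also have "\<dots> = (int width ^ Suc n) ^ Suc r" by (simp add: ac_simps)
      also have "\<dots> \<le> (int width ^ Suc n) ^ Suc n"
        using r by (intro power_increasing one_le_power) auto
      also have "\<dots> = int width ^ ((n + 1)\<^sup>2)" by (simp only: power_mult power2_eq_square Suc_eq_plus1)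
      finally have less: "\<bar>dot u\<bar> < int width ^ ((n + 1)\<^sup>2)" .
      let ?Q = "{p. prime p \<and> p > width \<and> int p dvd dot u}"
      have Q: "finite ?Q" "card ?Q \<le> (n + 1)\<^sup>2"
        using card_prime_divisors_above[OF u0 _ less] k by auto
      \<comment> \<open>One admissible prime is assigned to each row of \<open>S2\<close>. Rows of
        one fibre with the same prime coincide, so the fibre is no larger than the set of primes
        dividing the common value c.v.\<close>
      have ex: "\<exists>\<pi>. \<forall>v\<in>S2. good v (\<pi> v)" by (rule bchoice) (auto simp: S2_def)
      then obtain \<pi> where \<pi>: "\<And>v. v \<in> S2 \<Longrightarrow> good v (\<pi> v)" by blast
      have "inj_on \<pi> {v \<in> S2. v(l := 0) = u}"
      proof (rule inj_onI, rule ccontr)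
        fix v v' assume *: "v \<in> {v \<in> S2. v(l := 0) = u}" "v' \<in> {v \<in> S2. v(l := 0) = u}" "\<pi> v = \<pi> v'" "v \<noteq> v'"
        define p where "p = \<pi> v"
        have p: "good v p" "good v' p" using *(1,2) \<pi>[of v] \<pi>[of v'] unfolding p_def *(3) by (simp_all add: *(3))
        have eq: "v j = v' j" if "j \<noteq> l" for j using * that by (metis (mono_tags, lifting) fun_upd_other mem_Collect_eq)
        \<comment> \<open>The difference lies in the span modulo p and vanishes on the first
          \<open>l\<close> columns, so p divides its entry in column \<open>l\<close> as well. The
          box is too narrow for that entry to be a nonzero multiple of p.\<close>
        define w where "w = (\<lambda>j. 1 * trunc (Suc l) v j + (-1) * trunc (Suc l) v' j)"
        have w: "w \<in> latt p (map (trunc (Suc l)) vs)"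
          unfolding w_def using p by (intro latt_lincomb) (auto simp: good_def)
        have "trunc l w j = 0" for j using eq by (auto simp: trunc_def w_def)
        moreover have "map (trunc l) (map (trunc (Suc l)) vs) = map (trunc l) vs" by (simp add: trunc_trunc)
        ultimately have "int p dvd w l"
          using p full[of p] len
          by (intro latt_trunc_zero[OF _ _ w, of l]) (simp_all add: good_def del: map_map)
        then have "int p dvd v l - v' l" by (simp add: w_def trunc_def)
        moreover have "\<bar>v l - v' l\<bar> < int p"
        proof -
          have "v l \<in> {- int k..int k}" "v' l \<in> {- int k..int k}" "width < p"
            using *(1,2) r p by (simp_all add: S2_def vecs_iff good_def)
          then show ?thesis by auto
        qed
        ultimately have "v l = v' l" using dvd_imp_le_int[of "v l - v' l" "int p"] by linarith
        then have "v = v'" using eq by (metis ext)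
        then show False using * by simp
      qed
      moreover have "\<pi> ` {v \<in> S2. v(l := 0) = u} \<subseteq> ?Q"
      proof clarify
        fix v assume v: "v \<in> S2" "u = v(l := 0)"
        have "good v (\<pi> v)" by (rule \<pi>[OF v(1)])
        moreover have "int (\<pi> v) dvd dot (trunc (Suc l) v)"
          unfolding dot_def
        proof (rule latt_dot[of "map (trunc (Suc l)) vs"])
          show "trunc (Suc l) v \<in> latt (\<pi> v) (map (trunc (Suc l)) vs)" using \<pi>[OF v(1)] by (simp add: good_def)
          show "(\<Sum>j<l. c j * w j) = 0" if "w \<in> set (map (trunc (Suc l)) vs)" for w
            using that c0 dot_trunc unfolding dot_def by auto
        qed
        ultimately show "prime (\<pi> v) \<and> width < \<pi> v \<and> int (\<pi> v) dvd dot (v(l := 0))"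
          using dot_u[OF v(2)[symmetric]] v(2) by (simp add: dot_trunc good_def)
      qed
      ultimately have "card {v \<in> S2. v(l := 0) = u} \<le> card ?Q" by (rule card_inj_on_le[OF _ _ Q(1)])
      then show ?thesis using Q(2) by linarith
    qed (simp only: card.empty)
  qed (use r in \<open>auto simp: S2_def\<close>)
  finally show ?thesis by (simp only: card_box) (simp add: algebra_simps)
qed

text \<open>The union bound over rows as for a single prime, but with one column given up per row:
  the earlier rows are examined on m - 1 columns, so that \<open>r < m\<close> survives the step and
  leaves room for an orthogonal vector.\<close>

lemma card_dependent_above:
  "r < m \<Longrightarrow> m \<le> n \<Longrightarrow>
   real (card {vs \<in> rows_of r box_vecs. dependent_above width r m vs}) \<le> real r * real (1 + (n + 1)\<^sup>2) / real width * real (card box_vecs) ^ r"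
proof (induction r arbitrary: m)
  case 0
  then show ?case by (simp add: dependent_above_def)
next
  case (Suc r)
  then obtain l where m: "m = Suc l" by (cases m) auto
  let ?b = "real (card box_vecs)" let ?C = "real (1 + (n + 1)\<^sup>2)" let ?K = "real width"
  have fin: "finite box_vecs" by simp
  have bK: "?K ^ (n - 1) = ?b / ?K" using Suc.prems by (simp only: card_B of_nat_power power_diff) simp
  have "real (card {xs \<in> rows_of (Suc r) box_vecs. dependent_above width (Suc r) m xs})
      = (\<Sum>vs\<in>rows_of r box_vecs. real (card {v \<in> box_vecs. dependent_above width (Suc r) m (v # vs)}))"
    by (subst card_rows_of_Suc[OF fin]) simp
  also have "\<dots> \<le> (\<Sum>vs\<in>rows_of r box_vecs. (if dependent_above width r l vs then ?b else 0) + ?C * (?b / ?K))"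
  proof (intro sum_mono)
    fix vs assume vs: "vs \<in> rows_of r box_vecs"
    show "real (card {v \<in> box_vecs. dependent_above width (Suc r) m (v # vs)}) \<le> (if dependent_above width r l vs then ?b else 0) + ?C * (?b / ?K)"
    proof (cases "dependent_above width r l vs")
      case True
      have "card {v \<in> box_vecs. dependent_above width (Suc r) m (v # vs)} \<le> card box_vecs" by (intro card_mono) auto
      then show ?thesis using True by (simp add: add_increasing2)
    next
      case False
      have "real (card {v \<in> box_vecs. dependent_above width (Suc r) m (v # vs)}) \<le> real ((1 + (n + 1)\<^sup>2) * width ^ (n - 1))"
        unfolding m of_nat_le_iff using Suc.prems m by (intro card_extend_dependent_above[OF vs _ _ False]) auto
      also have "\<dots> = ?C * (?b / ?K)" by (simp only: of_nat_mult of_nat_power bK)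
      finally show ?thesis using False by simp
    qed
  qed
  also have "\<dots> = ?b * card {vs \<in> rows_of r box_vecs. dependent_above width r l vs} + ?C * (?b / ?K) * ?b ^ r"
    by (simp add: sum.distrib card_rows_of flip: sum.inter_filter)
  also have "\<dots> \<le> ?b * (real r * ?C / ?K * ?b ^ r) + ?C * (?b / ?K) * ?b ^ r"
  proof -
    have "real (card {vs \<in> rows_of r box_vecs. dependent_above width r l vs}) \<le> real r * ?C / ?K * ?b ^ r"
      using Suc.prems m by (intro Suc.IH) auto
    from mult_left_mono[OF this, of ?b] show ?thesis by linarith
  qed
  also have "\<dots> = real (Suc r) * ?C / ?K * ?b ^ Suc r" by (simp add: algebra_simps add_divide_distrib)
  finally show ?case by simp
qed

end

section \<open>Smith normal form\<close>

no_notation vec_nth (infixl "$" 90)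

text \<open>An explicit inverse in the same carrier keeps products and inverses free of dimension
  conditions; \<open>unimodular_iff\<close> links it to \<open>invertible_mat\<close>.\<close>

definition unimodular :: "nat \<Rightarrow> int mat \<Rightarrow> bool" where
  "unimodular n P \<longleftrightarrow> P \<in> carrier_mat n n \<and> (\<exists>P'\<in>carrier_mat n n. P * P' = 1\<^sub>m n \<and> P' * P = 1\<^sub>m n)"

lemma unimodular_iff: "unimodular n P \<longleftrightarrow> P \<in> carrier_mat n n \<and> invertible_mat P"
proof
  assume "P \<in> carrier_mat n n \<and> invertible_mat P"
  then obtain Q where P: "P \<in> carrier_mat n n" and Q: "P * Q = 1\<^sub>m n" "Q * P = 1\<^sub>m (dim_row Q)"
    by (auto simp: invertible_mat_def inverts_mat_def)
  have "dim_col Q = n" using arg_cong[OF Q(1), of dim_col] P by simp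
  moreover have "dim_row Q = n" using arg_cong[OF Q(2), of dim_col] P by simp
  ultimately show "unimodular n P" using P Q by (auto simp: unimodular_def)
qed (auto simp: unimodular_def invertible_mat_def inverts_mat_def)

lemma unimodular_carrier: "unimodular n P \<Longrightarrow> P \<in> carrier_mat n n"
  by (simp add: unimodular_def)

lemma unimodular_one: "unimodular n (1\<^sub>m n)"
  by (auto simp: unimodular_def intro!: bexI[of _ "1\<^sub>m n"])

lemma unimodular_mult:
  assumes "unimodular n P" "unimodular n Q"
  shows "unimodular n (P * Q)"
proof -
  from assms obtain P' Q' where *: "P \<in> carrier_mat n n" "Q \<in> carrier_mat n n" "P' \<in> carrier_mat n n"
    "Q' \<in> carrier_mat n n" "P * P' = 1\<^sub>m n" "P' * P = 1\<^sub>m n" "Q * Q' = 1\<^sub>m n" "Q' * Q = 1\<^sub>m n"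
    by (auto simp: unimodular_def)
  have "(P * Q) * (Q' * P') = P * ((Q * Q') * P')" using *(1-4)
    by (simp add: assoc_mult_mat[of _ n n _ n _ n])
  then have 1: "(P * Q) * (Q' * P') = 1\<^sub>m n" using * by simp
  have "(Q' * P') * (P * Q) = Q' * ((P' * P) * Q)" using *(1-4)
    by (simp add: assoc_mult_mat[of _ n n _ n _ n])
  then have 2: "(Q' * P') * (P * Q) = 1\<^sub>m n" using * by simp
  show ?thesis
    unfolding unimodular_def
    by (intro conjI bexI[of _ "Q' * P'"] 1 2 mult_carrier_mat[of _ n n] *(1-4))
qed

lemma unimodular_addrow: "k < n \<Longrightarrow> l < n \<Longrightarrow> k \<noteq> l \<Longrightarrow> unimodular n (addrow_mat n a k l)"
  using addrow_mat_inv[of k n l a] addrow_mat_inv[of k n l "- a"]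
  by (auto simp: unimodular_def intro!: bexI[of _ "addrow_mat n (- a) k l"])

lemma unimodular_swaprows: "k < n \<Longrightarrow> l < n \<Longrightarrow> unimodular n (swaprows_mat n k l)"
  using swaprows_mat_inv[of k n l]
  by (auto simp: unimodular_def intro!: bexI[of _ "swaprows_mat n k l"])

definition smith_equiv :: "nat \<Rightarrow> int mat \<Rightarrow> int mat \<Rightarrow> bool" where
  "smith_equiv n M N \<longleftrightarrow> (\<exists>P Q. unimodular n P \<and> unimodular n Q \<and> N = P * M * Q)"

lemma smith_equiv_refl: "M \<in> carrier_mat n n \<Longrightarrow> smith_equiv n M M"
  unfolding smith_equiv_def using unimodular_one[of n] by (intro exI[of _ "1\<^sub>m n"]) simp

lemma smith_equiv_carrier: "smith_equiv n M N \<Longrightarrow> N \<in> carrier_mat n n"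
  by (auto simp: smith_equiv_def unimodular_def)

lemma smith_equiv_left:
  assumes "M \<in> carrier_mat n n" "smith_equiv n M N" "unimodular n P"
  shows "smith_equiv n M (P * N)"
proof -
  from assms obtain P' Q where *: "unimodular n P'" "unimodular n Q" "N = P' * M * Q"
    by (auto simp: smith_equiv_def)
  have c: "P \<in> carrier_mat n n" "P' \<in> carrier_mat n n" "Q \<in> carrier_mat n n"
    using assms(3) * by (simp_all add: unimodular_carrier)
  have "P * N = (P * P') * M * Q" using assms(1) *(3) c
    by (simp add: assoc_mult_mat[of _ n n _ n _ n] mult_carrier_mat[of _ n n _ n])
  then show ?thesis using * assms unimodular_mult unfolding smith_equiv_def by blast
qed

lemma smith_equiv_right:
  assumes "M \<in> carrier_mat n n" "smith_equiv n M N" "unimodular n Q"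
  shows "smith_equiv n M (N * Q)"
proof -
  from assms obtain P Q' where *: "unimodular n P" "unimodular n Q'" "N = P * M * Q'"
    by (auto simp: smith_equiv_def)
  have c: "P \<in> carrier_mat n n" "Q' \<in> carrier_mat n n" "Q \<in> carrier_mat n n"
    using assms(3) * by (simp_all add: unimodular_carrier)
  have "N * Q = P * M * (Q' * Q)" using assms(1) *(3) c
    by (simp add: assoc_mult_mat[of _ n n _ n _ n] mult_carrier_mat[of _ n n _ n])
  then show ?thesis using * assms unimodular_mult unfolding smith_equiv_def by blast
qed

lemma smith_equiv_trans:
  assumes "M \<in> carrier_mat n n" "smith_equiv n M N" "smith_equiv n N L"
  shows "smith_equiv n M L"
  using assms smith_equiv_left smith_equiv_right by (metis smith_equiv_def)

lemma smith_equiv_sym: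
  assumes M: "M \<in> carrier_mat n n" and "smith_equiv n M N"
  shows "smith_equiv n N M"
proof -
  from assms obtain P Q P' Q' where *: "N = P * M * Q" "P \<in> carrier_mat n n" "Q \<in> carrier_mat n n"
    "P' \<in> carrier_mat n n" "Q' \<in> carrier_mat n n"
    "P * P' = 1\<^sub>m n" "P' * P = 1\<^sub>m n" "Q * Q' = 1\<^sub>m n" "Q' * Q = 1\<^sub>m n"
    by (auto simp: smith_equiv_def unimodular_def)
  have "P' * N * Q' = (P' * P) * (M * (Q * Q'))" using *(1-5) M
    by (simp add: assoc_mult_mat[of _ n n _ n _ n])
  then have "M = P' * N * Q'" using * M by simp
  then show ?thesis using * unfolding smith_equiv_def unimodular_def by blast
qed

lemma smith_equiv_addrow:
  assumes "M \<in> carrier_mat n n" "smith_equiv n M N" "k < n" "l < n" "k \<noteq> l"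
  shows "smith_equiv n M (addrow a k l N)"
  using addrow_mat[of N n n l a k] smith_equiv_left[OF assms(1,2) unimodular_addrow[OF assms(3-5)]]
    smith_equiv_carrier[OF assms(2)] assms by simp

lemma smith_equiv_addcol:
  assumes "M \<in> carrier_mat n n" "smith_equiv n M N" "k < n" "l < n" "k \<noteq> l"
  shows "smith_equiv n M (addcol a k l N)"
  using addcol_mat[of N n n l a k] smith_equiv_right[OF assms(1,2) unimodular_addrow[of l n k a]]
    smith_equiv_carrier[OF assms(2)] assms by simp

lemma smith_equiv_swap:
  assumes "M \<in> carrier_mat n n" "smith_equiv n M N" "i < n" "j < n"
  shows "smith_equiv n M (swapcols 0 j (swaprows 0 i N))"
proof -
  have n: "0 < n" using assms by auto
  have N: "N \<in> carrier_mat n n" by (rule smith_equiv_carrier[OF assms(2)])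
  have "smith_equiv n M (swaprows 0 i N)"
    unfolding swaprows_mat[OF N n assms(3)]
    by (rule smith_equiv_left[OF assms(1,2) unimodular_swaprows[OF n assms(3)]])
  from smith_equiv_right[OF assms(1) this unimodular_swaprows[OF n assms(4)]] N
  show ?thesis by (subst swapcols_mat[of _ n n]) (use n assms(4) in auto)
qed

(* The entry of least absolute value among all nonzero entries of all matrices equivalent to M
   divides everything that elementary operations can place next to it. *)
lemma smith_pivot:
  assumes M: "M \<in> carrier_mat n n" and n: "n > 0" and M0: "i < n" "j < n" "M $$ (i, j) \<noteq> 0"
  obtains N where "smith_equiv n M N" "N $$ (0, 0) \<noteq> 0"
    "\<And>i. 0 < i \<Longrightarrow> i < n \<Longrightarrow> N $$ (i, 0) = 0" "\<And>j. 0 < j \<Longrightarrow> j < n \<Longrightarrow> N $$ (0, j) = 0"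
    "\<And>i j. i < n \<Longrightarrow> j < n \<Longrightarrow> N $$ (0, 0) dvd N $$ (i, j)"
proof -
  define E where "E = (\<lambda>m. \<exists>N i j. smith_equiv n M N \<and> i < n \<and> j < n \<and> N $$ (i, j) \<noteq> 0 \<and> nat \<bar>N $$ (i, j)\<bar> = m)"
  define d where "d = (LEAST m. E m)"
  have "E (nat \<bar>M $$ (i, j)\<bar>)" using M M0 smith_equiv_refl unfolding E_def by blast
  then have Ed: "E d" unfolding d_def by (rule LeastI)
  have min: "int d \<le> \<bar>N $$ (i, j)\<bar>" if "smith_equiv n M N" "i < n" "j < n" "N $$ (i, j) \<noteq> 0" for N i j
  proof -
    have "d \<le> nat \<bar>N $$ (i, j)\<bar>" unfolding d_def by (rule Least_le) (use that in \<open>auto simp: E_def\<close>)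
    then show ?thesis by linarith
  qed
  from Ed have d0: "d > 0" by (auto simp: E_def)
  \<comment> \<open>A nonzero remainder modulo an entry of absolute value d would be smaller than
    the minimum.\<close>
  have small: "x mod y = 0" if "\<bar>y\<bar> = int d" "x mod y \<noteq> 0 \<Longrightarrow> int d \<le> \<bar>x mod y\<bar>" for x y :: int
    using that d0 abs_mod_less[of y x] by (cases "y = 0") auto
  from Ed obtain N0 i0 j0 where N0: "smith_equiv n M N0" "i0 < n" "j0 < n" "N0 $$ (i0, j0) \<noteq> 0"
    "nat \<bar>N0 $$ (i0, j0)\<bar> = d" by (auto simp: E_def)
  \<comment> \<open>The invariant of the clearing operations: a minimal entry sits in the corner.
    Minimality makes it divide its row and column, so each operation uses an exact quotient.\<close>
  define G where "G = (\<lambda>N. smith_equiv n M N \<and> \<bar>N $$ (0, 0)\<bar> = int d)"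
  have carr: "N \<in> carrier_mat n n" if "G N" for N using that smith_equiv_carrier by (auto simp: G_def)
  have G0: "G (swapcols 0 j0 (swaprows 0 i0 N0))"
    using smith_equiv_swap[OF M N0(1-3)] smith_equiv_carrier[OF N0(1)] N0 n by (auto simp: G_def)
  have dvd_col: "N $$ (0, 0) dvd N $$ (i, 0)" if G: "G N" and i: "i < n" for N i
  proof (cases "i = 0")
    case False
    define q where "q = N $$ (i, 0) div N $$ (0, 0)"
    have eq: "addrow (- q) i 0 N $$ (i, 0) = N $$ (i, 0) mod N $$ (0, 0)"
      using carr[OF G] i n by (simp add: q_def minus_div_mult_eq_mod[symmetric])
    have "smith_equiv n M (addrow (- q) i 0 N)"
      using G i n False by (intro smith_equiv_addrow[OF M]) (auto simp: G_def)
    from min[OF this i n] have "N $$ (i, 0) mod N $$ (0, 0) = 0"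
      using G unfolding eq by (intro small) (auto simp: G_def)
    then show ?thesis by auto
  qed auto
  have dvd_row: "N $$ (0, 0) dvd N $$ (0, j)" if G: "G N" and j: "j < n" for N j
  proof (cases "j = 0")
    case False
    define q where "q = N $$ (0, j) div N $$ (0, 0)"
    have eq: "addcol (- q) j 0 N $$ (0, j) = N $$ (0, j) mod N $$ (0, 0)"
      using carr[OF G] j n by (simp add: q_def minus_div_mult_eq_mod[symmetric])
    have "smith_equiv n M (addcol (- q) j 0 N)"
      using G j n False by (intro smith_equiv_addcol[OF M]) (auto simp: G_def)
    from min[OF this n j] have "N $$ (0, j) mod N $$ (0, 0) = 0"
      using G unfolding eq by (intro small) (auto simp: G_def)
    then show ?thesis by auto
  qed auto
  have "m \<le> n \<Longrightarrow> \<exists>N. G N \<and> (\<forall>i. 0 < i \<and> i < m \<longrightarrow> N $$ (i, 0) = 0)" for m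
  proof (induction m)
    case (Suc m)
    then obtain N where N: "G N" "\<And>i. 0 < i \<Longrightarrow> i < m \<Longrightarrow> N $$ (i, 0) = 0" by auto
    show ?case
    proof (cases "m = 0")
      case False
      define N' where "N' = addrow (- (N $$ (m, 0) div N $$ (0, 0))) m 0 N"
      have m: "m < n" using Suc.prems by simp
      have "G N'" using N(1) m n False smith_equiv_addrow[OF M, of N m 0] carr[OF N(1)]
        by (auto simp: G_def N'_def)
      moreover have "N' $$ (m, 0) = 0"
        using dvd_col[OF N(1) m] m n carr[OF N(1)] by (simp add: N'_def)
      moreover have "N' $$ (i, 0) = 0" if "0 < i" "i < m" for i
        using N(2)[OF that] that m n carr[OF N(1)] by (simp add: N'_def)
      ultimately show ?thesis by (intro exI[of _ N']) (auto simp: less_Suc_eq)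
    qed (use N in auto)
  qed (use G0 in auto)
  from this[OF order_refl] obtain N1 where N1: "G N1" "\<And>i. 0 < i \<Longrightarrow> i < n \<Longrightarrow> N1 $$ (i, 0) = 0"
    by auto
  have "m \<le> n \<Longrightarrow> \<exists>N. G N \<and> (\<forall>i. 0 < i \<and> i < n \<longrightarrow> N $$ (i, 0) = 0) \<and> (\<forall>i. 0 < i \<and> i < m \<longrightarrow> N $$ (0, i) = 0)" for m
  proof (induction m)
    case (Suc m)
    then obtain N where N: "G N" "\<And>i. 0 < i \<Longrightarrow> i < n \<Longrightarrow> N $$ (i, 0) = 0"
      "\<And>i. 0 < i \<Longrightarrow> i < m \<Longrightarrow> N $$ (0, i) = 0" by auto
    show ?case
    proof (cases "m = 0")
      case False
      define N' where "N' = addcol (- (N $$ (0, m) div N $$ (0, 0))) m 0 N"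
      have m: "m < n" using Suc.prems by simp
      have "G N'" using N(1) m n False smith_equiv_addcol[OF M, of N m 0] carr[OF N(1)]
        by (auto simp: G_def N'_def)
      moreover have "N' $$ (0, m) = 0"
        using dvd_row[OF N(1) m] m n carr[OF N(1)] by (simp add: N'_def)
      moreover have "N' $$ (0, i) = 0" if "0 < i" "i < m" for i
        using N(3)[OF that] that m n carr[OF N(1)] by (simp add: N'_def)
      moreover have "N' $$ (i, 0) = 0" if "0 < i" "i < n" for i
        using N(2)[OF that] that m n carr[OF N(1)] False by (simp add: N'_def)
      ultimately show ?thesis by (intro exI[of _ N']) (auto simp: less_Suc_eq)
    qed (use N in auto)
  qed (use N1 in auto)
  from this[OF order_refl] obtain N where N: "G N" "\<And>i. 0 < i \<Longrightarrow> i < n \<Longrightarrow> N $$ (i, 0) = 0"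
    "\<And>j. 0 < j \<Longrightarrow> j < n \<Longrightarrow> N $$ (0, j) = 0"
    by auto
  have "N $$ (0, 0) dvd N $$ (i, j)" if ij: "i < n" "j < n" for i j
  proof (cases "i = 0 \<or> j = 0")
    case False
    \<comment> \<open>Adding row \<open>i\<close> to row 0 keeps the corner, since column 0 is
      cleared, and moves the entry (i, j) into row 0, where divisibility by the corner is
      known.\<close>
    define N' where "N' = addrow 1 0 i N"
    have "G N'" using N ij n False smith_equiv_addrow[OF M, of N 0 i] carr[OF N(1)]
      by (auto simp: G_def N'_def)
    from dvd_row[OF this ij(2)] show ?thesis
      using N(2,3) ij n False carr[OF N(1)] by (simp add: N'_def)
  qed (use dvd_row[OF N(1) ij(2)] dvd_col[OF N(1) ij(1)] in auto)
  then show thesis using that[of N] N d0 by (auto simp: G_def)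
qed

lemma dvd_mult_mat:
  fixes A :: "int mat"
  assumes "A \<in> carrier_mat n n" "B \<in> carrier_mat n n" "i < n" "j < n"
    and "(\<forall>i<n. \<forall>j<n. d dvd A $$ (i, j)) \<or> (\<forall>i<n. \<forall>j<n. d dvd B $$ (i, j))"
  shows "d dvd (A * B) $$ (i, j)"
  using assms by (auto simp: scalar_prod_def intro!: dvd_sum)

text \<open>Split off the pivot and recurse on the remaining block. The entries of that block are
  multiples of the pivot and stay so under multiplication from both sides, which yields the
  divisibility chain.\<close>

lemma smith_form_exists:
  "M \<in> carrier_mat n n \<Longrightarrow> \<exists>D. smith_equiv n M D \<and> snf_shape n D"
proof (induction n arbitrary: M)
  case 0
  then show ?case using smith_equiv_refl[OF 0] by (auto simp: snf_shape_def diagonal_mat_def)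
next
  case (Suc n)
  note M = Suc.prems
  show ?case
  proof (cases "\<exists>i<Suc n. \<exists>j<Suc n. M $$ (i, j) \<noteq> 0")
    case False
    then have "snf_shape (Suc n) M" using M by (auto simp: snf_shape_def diagonal_mat_def)
    then show ?thesis using smith_equiv_refl[OF M] by blast
  next
    case True
    then obtain i j where ij: "i < Suc n" "j < Suc n" "M $$ (i, j) \<noteq> 0" by auto
    obtain N where N: "smith_equiv (Suc n) M N" "N $$ (0, 0) \<noteq> 0"
      "\<And>i. 0 < i \<Longrightarrow> i < Suc n \<Longrightarrow> N $$ (i, 0) = 0" "\<And>j. 0 < j \<Longrightarrow> j < Suc n \<Longrightarrow> N $$ (0, j) = 0"
      "\<And>i j. i < Suc n \<Longrightarrow> j < Suc n \<Longrightarrow> N $$ (0, 0) dvd N $$ (i, j)"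
      using smith_pivot[OF M _ ij] by auto
    have Nc: "N \<in> carrier_mat (Suc n) (Suc n)" by (rule smith_equiv_carrier[OF N(1)])
    define d where "d = N $$ (0, 0)"
    define N1 where "N1 = mat n n (\<lambda>(i, j). N $$ (Suc i, Suc j))"
    have N1c: "N1 \<in> carrier_mat n n" by (simp add: N1_def)
    from Suc.IH[OF N1c] obtain D1 P1 Q1 where D1: "snf_shape n D1" and D1eq: "D1 = P1 * N1 * Q1"
      and P1: "unimodular n P1" and Q1: "unimodular n Q1"
      by (auto simp: smith_equiv_def)
    define blk where "blk = (\<lambda>a (A :: int mat). four_block_mat (mat 1 1 (\<lambda>_. a)) (0\<^sub>m 1 n) (0\<^sub>m n 1) A)"
    have blk_mult: "blk a A * blk b B = blk (a * b) (A * B)"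
      if "A \<in> carrier_mat n n" "B \<in> carrier_mat n n" for a b A B
    proof -
      have "mat 1 1 (\<lambda>_. a) * mat 1 1 (\<lambda>_. b) = mat 1 1 (\<lambda>_. a * b)"
        by (rule eq_matI) (auto simp: scalar_prod_def)
      then show ?thesis unfolding blk_def using that
        by (subst mult_four_block_mat[of _ 1 1 _ n _ n _ _ 1 _ n]) auto
    qed
    have blk_one: "blk 1 (1\<^sub>m n) = 1\<^sub>m (Suc n)"
      by (rule eq_matI) (auto simp: blk_def)
    have blk_carrier: "A \<in> carrier_mat n n \<Longrightarrow> blk a A \<in> carrier_mat (Suc n) (Suc n)" for a A
      by (auto simp: blk_def)
    have blk_unimodular: "unimodular (Suc n) (blk a A)" if A: "unimodular n A" and a: "a * a = 1" for a A
    proof -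
      from A obtain A' where A': "A \<in> carrier_mat n n" "A' \<in> carrier_mat n n" "A * A' = 1\<^sub>m n" "A' * A = 1\<^sub>m n"
        by (auto simp: unimodular_def)
      then show ?thesis
        using blk_mult[of A A' a a] blk_mult[of A' A a a] a blk_one blk_carrier unfolding unimodular_def by metis
    qed
    have N_blk: "N = blk d N1"
      by (rule eq_matI) (use Nc N(3,4) in \<open>auto simp: blk_def N1_def d_def\<close>)
    \<comment> \<open>The unit \<open>sgn d\<close> in the corner of the left factor turns the pivot
      into its absolute value.\<close>
    have "smith_equiv (Suc n) N (blk (sgn d) P1 * N * blk 1 Q1)"
      unfolding smith_equiv_def using N(2) P1 Q1
      by (intro exI[of _ "blk (sgn d) P1"] exI[of _ "blk 1 Q1"] conjI refl blk_unimodular)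
         (auto simp: d_def sgn_if)
    also have "blk (sgn d) P1 * N * blk 1 Q1 = blk \<bar>d\<bar> D1"
      unfolding N_blk using P1 Q1 N1c
      by (simp add: blk_mult unimodular_carrier mult_carrier_mat[of _ n n] D1eq abs_sgn mult.commute)
    finally have "smith_equiv (Suc n) M (blk \<bar>d\<bar> D1)" using smith_equiv_trans[OF M N(1)] by blast
    moreover have "snf_shape (Suc n) (blk \<bar>d\<bar> D1)"
    proof -
      have D1c: "D1 \<in> carrier_mat n n" using D1 by (simp add: snf_shape_def)
      have dvd: "d dvd D1 $$ (i, j)" if "i < n" "j < n" for i j
      proof -
        have "d dvd (P1 * N1) $$ (i, j)" if "i < n" "j < n" for i j
          using that N(5) P1 by (intro dvd_mult_mat[OF _ N1c] disjI2) (auto simp: unimodular_carrier d_def N1_def)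
        then show ?thesis unfolding D1eq using that P1 Q1 N1c
          by (intro dvd_mult_mat disjI1) (auto simp: unimodular_carrier intro!: mult_carrier_mat[of _ n n])
      qed
      have idx: "blk \<bar>d\<bar> D1 $$ (i, j) = (if i = 0 \<and> j = 0 then \<bar>d\<bar> else if i = 0 \<or> j = 0 then 0 else D1 $$ (i - 1, j - 1))"
        if "i < Suc n" "j < Suc n" for i j
        using that D1c by (auto simp: blk_def)
      have "diagonal_mat (blk \<bar>d\<bar> D1)"
        using D1 blk_carrier[OF D1c, of "\<bar>d\<bar>"] unfolding diagonal_mat_def snf_shape_def
        by (auto simp: idx)
      moreover have "blk \<bar>d\<bar> D1 $$ (i, i) \<ge> 0" if "i < Suc n" for i
        using that D1 by (cases i) (auto simp: idx snf_shape_def)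
      moreover have "blk \<bar>d\<bar> D1 $$ (i, i) dvd blk \<bar>d\<bar> D1 $$ (Suc i, Suc i)" if "Suc i < Suc n" for i
        using that D1 dvd by (cases i) (auto simp: idx snf_shape_def)
      ultimately show ?thesis using blk_carrier[OF D1c] by (simp add: snf_shape_def)
    qed
    ultimately show ?thesis by blast
  qed
qed

lemma is_SNF_iff: "is_SNF n M D \<longleftrightarrow> snf_shape n D \<and> smith_equiv n M D"
  by (auto simp: is_SNF_def smith_equiv_def unimodular_iff)

lemma is_SNF_SNF: "M \<in> carrier_mat n n \<Longrightarrow> is_SNF n M (SNF n M)"
  unfolding SNF_def using smith_form_exists[of M n] by (metis is_SNF_iff someI)

section \<open>The rank modulo p as an invariant of equivalence\<close>

definition mat_rows :: "nat \<Rightarrow> int mat \<Rightarrow> (nat \<Rightarrow> int) list" where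
  "mat_rows n M = map (\<lambda>i j. if j < n then M $$ (i, j) else 0) [0..<n]"

text \<open>Passes from the recursive span to explicit coefficients, on which matrices can act.
  Distinct indices allow the coefficient of the new index to be set without disturbing the
  others.\<close>

lemma latt_map_iff:
  "distinct xs \<Longrightarrow> w \<in> latt p (map f xs) \<longleftrightarrow> (\<exists>c. \<forall>j. int p dvd w j - (\<Sum>i\<in>set xs. c i * f i j))"
proof (induction xs arbitrary: w)
  case (Cons a xs)
  have sum_upd: "(\<Sum>i\<in>set xs. (c(a := b)) i * f i j) = (\<Sum>i\<in>set xs. c i * f i j)" for c b j
    using Cons.prems by (intro sum.cong) auto
  have "w \<in> latt p (map f (a # xs)) \<longleftrightarrow> (\<exists>b. (\<lambda>j. w j - b * f a j) \<in> latt p (map f xs))"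
  proof
    assume "w \<in> latt p (map f (a # xs))"
    then obtain u b where "w = (\<lambda>j. u j + b * f a j)" "u \<in> latt p (map f xs)" by auto
    then show "\<exists>b. (\<lambda>j. w j - b * f a j) \<in> latt p (map f xs)" by (intro exI[of _ b]) simp
  next
    assume "\<exists>b. (\<lambda>j. w j - b * f a j) \<in> latt p (map f xs)"
    then obtain b where "(\<lambda>j. w j - b * f a j) \<in> latt p (map f xs)" by blast
    from latt_ConsI[OF this, of b "f a"] show "w \<in> latt p (map f (a # xs))" by simp
  qed
  also have "\<dots> \<longleftrightarrow> (\<exists>b c. \<forall>j. int p dvd w j - b * f a j - (\<Sum>i\<in>set xs. c i * f i j))"
    using Cons by auto
  also have "\<dots> \<longleftrightarrow> (\<exists>c. \<forall>j. int p dvd w j - c a * f a j - (\<Sum>i\<in>set xs. c i * f i j))"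
  proof
    assume "\<exists>b c. \<forall>j. int p dvd w j - b * f a j - (\<Sum>i\<in>set xs. c i * f i j)"
    then obtain b c where "\<forall>j. int p dvd w j - b * f a j - (\<Sum>i\<in>set xs. c i * f i j)" by blast
    then have "\<forall>j. int p dvd w j - (c(a := b)) a * f a j - (\<Sum>i\<in>set xs. (c(a := b)) i * f i j)"
      by (simp only: sum_upd fun_upd_same simp_thms)
    then show "\<exists>c. \<forall>j. int p dvd w j - c a * f a j - (\<Sum>i\<in>set xs. c i * f i j)" by blast
  qed blast
  also have "\<dots> \<longleftrightarrow> (\<exists>c. \<forall>j. int p dvd w j - (\<Sum>i\<in>set (a # xs). c i * f i j))"
    using Cons.prems by (simp add: algebra_simps)
  finally show ?case .
qed auto

lemma latt_mat_rows_iff: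
  assumes M: "M \<in> carrier_mat n n" and w: "\<And>j. j \<ge> n \<Longrightarrow> w j = 0"
  shows "w \<in> latt p (mat_rows n M) \<longleftrightarrow>
    (\<exists>c\<in>carrier_vec n. \<exists>y\<in>carrier_vec n. vec n w = M\<^sup>T *\<^sub>v c + int p \<cdot>\<^sub>v y)"
proof
  have T: "(M\<^sup>T *\<^sub>v c) $ j = (\<Sum>i<n. c $ i * M $$ (i, j))" if "c \<in> carrier_vec n" "j < n" for c j
    using M that by (simp add: scalar_prod_def mult.commute atLeast0LessThan)
  {
    assume "w \<in> latt p (mat_rows n M)"
    then obtain c where c: "\<And>j. int p dvd w j - (\<Sum>i<n. c i * (if j < n then M $$ (i, j) else 0))"
      unfolding mat_rows_def by (subst (asm) latt_map_iff) (auto simp: atLeast0LessThan)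
    then obtain y where y: "\<And>j. w j - (\<Sum>i<n. c i * (if j < n then M $$ (i, j) else 0)) = int p * y j"
      unfolding dvd_def by metis
    have "vec n w = M\<^sup>T *\<^sub>v vec n c + int p \<cdot>\<^sub>v vec n y"
    proof (rule eq_vecI)
      fix j assume "j < dim_vec (M\<^sup>T *\<^sub>v vec n c + int p \<cdot>\<^sub>v vec n y)"
      then have j: "j < n" using M by simp
      have "w j = (\<Sum>i<n. c i * M $$ (i, j)) + int p * y j" using y[of j] j by simp
      moreover have "(M\<^sup>T *\<^sub>v vec n c) $ j = (\<Sum>i<n. c i * M $$ (i, j))"
        by (subst T) (use j in auto)
      ultimately show "vec n w $ j = (M\<^sup>T *\<^sub>v vec n c + int p \<cdot>\<^sub>v vec n y) $ j"
        using j M by (simp del: index_mult_mat_vec)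
    qed (use M in simp)
    then show "\<exists>c\<in>carrier_vec n. \<exists>y\<in>carrier_vec n. vec n w = M\<^sup>T *\<^sub>v c + int p \<cdot>\<^sub>v y"
      using vec_carrier by blast
  }
  {
    assume "\<exists>c\<in>carrier_vec n. \<exists>y\<in>carrier_vec n. vec n w = M\<^sup>T *\<^sub>v c + int p \<cdot>\<^sub>v y"
    then obtain c y where cy: "c \<in> carrier_vec n" "y \<in> carrier_vec n" "vec n w = M\<^sup>T *\<^sub>v c + int p \<cdot>\<^sub>v y"
      by auto
    have "int p dvd w j - (\<Sum>i<n. c $ i * (if j < n then M $$ (i, j) else 0))" for j
    proof (cases "j < n")
      case True
      have "w j = (M\<^sup>T *\<^sub>v c + int p \<cdot>\<^sub>v y) $ j" using True by (simp flip: cy(3))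
      also have "\<dots> = (\<Sum>i<n. c $ i * M $$ (i, j)) + int p * y $ j"
        using True cy M T[OF cy(1) True] by (simp del: index_mult_mat_vec)
      finally show ?thesis using True by simp
    qed (use w in auto)
    then show "w \<in> latt p (mat_rows n M)"
      unfolding mat_rows_def by (subst latt_map_iff) (auto simp: atLeast0LessThan intro!: exI[of _ "\<lambda>i. c $ i"])
  }
qed

lemma mult_mat_smult_vec:
  fixes A :: "int mat"
  assumes "A \<in> carrier_mat nr nc" "v \<in> carrier_vec nc"
  shows "A *\<^sub>v (k \<cdot>\<^sub>v v) = k \<cdot>\<^sub>v (A *\<^sub>v v)"
  by (rule eq_vecI) (use assms in \<open>auto simp: scalar_prod_smult_distrib[of _ nc]\<close>)

text \<open>For N = P M Q the transpose of Q carries the row lattice of M into that of N, because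
  N^T (P'^T c) = Q^T (M^T c) with P' the inverse of P. The map is injective modulo p since Q is
  invertible over the integers. Symmetry of equivalence supplies the converse inequality.\<close>

lemma card_latt_smith_equiv_le:
  assumes M: "M \<in> carrier_mat n n" and MN: "smith_equiv n M N" and p: "prime p"
  shows "card (latt p (mat_rows n M) \<inter> vecs n {0..<int p}) \<le> card (latt p (mat_rows n N) \<inter> vecs n {0..<int p})"
proof -
  have p0: "int p > 0" using p prime_gt_0_nat by simp
  from MN obtain P Q P' Q' where *: "N = P * M * Q" "P \<in> carrier_mat n n" "Q \<in> carrier_mat n n"
    "P' \<in> carrier_mat n n" "Q' \<in> carrier_mat n n"
    "P * P' = 1\<^sub>m n" "P' * P = 1\<^sub>m n" "Q * Q' = 1\<^sub>m n" "Q' * Q = 1\<^sub>m n"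
    by (auto simp: smith_equiv_def unimodular_def)
  have N: "N \<in> carrier_mat n n" by (rule smith_equiv_carrier[OF MN])
  define \<phi> where "\<phi> = (\<lambda>x :: nat \<Rightarrow> int. \<lambda>j. if j < n then (Q\<^sup>T *\<^sub>v vec n x) $ j mod int p else 0)"
  have \<phi>: "\<exists>z\<in>carrier_vec n. vec n (\<phi> x) = Q\<^sup>T *\<^sub>v vec n x + int p \<cdot>\<^sub>v z" for x
  proof (intro bexI eq_vecI)
    fix j assume "j < dim_vec (Q\<^sup>T *\<^sub>v vec n x + int p \<cdot>\<^sub>v vec n (\<lambda>j. - ((Q\<^sup>T *\<^sub>v vec n x) $ j div int p)))"
    then have j: "j < n" by simp
    then show "vec n (\<phi> x) $ j = (Q\<^sup>T *\<^sub>v vec n x + int p \<cdot>\<^sub>v vec n (\<lambda>j. - ((Q\<^sup>T *\<^sub>v vec n x) $ j div int p))) $ j"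
      using *(3) by (simp add: \<phi>_def minus_mult_div_eq_mod[symmetric] del: index_mult_mat_vec)
  qed auto
  let ?L = "\<lambda>M. latt p (mat_rows n M) \<inter> vecs n {0..<int p}"
  have QT: "Q'\<^sup>T *\<^sub>v (Q\<^sup>T *\<^sub>v v) = v" if "v \<in> carrier_vec n" for v
  proof -
    have "Q'\<^sup>T *\<^sub>v (Q\<^sup>T *\<^sub>v v) = (Q'\<^sup>T * Q\<^sup>T) *\<^sub>v v"
      using * that by (intro assoc_mult_mat_vec[symmetric]) auto
    also have "Q'\<^sup>T * Q\<^sup>T = (Q * Q')\<^sup>T" using * by (intro transpose_mult[symmetric]) auto
    finally show ?thesis using * that by simp
  qed
  have "\<phi> ` ?L M \<subseteq> ?L N"
  proof clarify
    fix x assume x: "x \<in> latt p (mat_rows n M)" "x \<in> vecs n {0..<int p}"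
    then obtain c y where cy: "c \<in> carrier_vec n" "y \<in> carrier_vec n" "vec n x = M\<^sup>T *\<^sub>v c + int p \<cdot>\<^sub>v y"
      using latt_mat_rows_iff[OF M, of x p] by (auto simp: vecs_iff)
    obtain z where z: "z \<in> carrier_vec n" "vec n (\<phi> x) = Q\<^sup>T *\<^sub>v vec n x + int p \<cdot>\<^sub>v z" using \<phi> by blast
    have NT: "N\<^sup>T *\<^sub>v (P'\<^sup>T *\<^sub>v c) = Q\<^sup>T *\<^sub>v (M\<^sup>T *\<^sub>v c)"
    proof -
      have PM: "P * M \<in> carrier_mat n n" using * M by simp
      have "N\<^sup>T = Q\<^sup>T * (M\<^sup>T * P\<^sup>T)"
        using * M transpose_mult[OF PM *(3)] transpose_mult[OF *(2) M] by simp
      then have "N\<^sup>T *\<^sub>v (P'\<^sup>T *\<^sub>v c) = Q\<^sup>T *\<^sub>v (M\<^sup>T *\<^sub>v (P\<^sup>T *\<^sub>v (P'\<^sup>T *\<^sub>v c)))"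
        using * M cy by (simp add: assoc_mult_mat_vec[of _ n n _ n])
      also have "P\<^sup>T *\<^sub>v (P'\<^sup>T *\<^sub>v c) = (P\<^sup>T * P'\<^sup>T) *\<^sub>v c"
        using *(2,4) cy(1) by (intro assoc_mult_mat_vec[symmetric]) auto
      also have "P\<^sup>T * P'\<^sup>T = (P' * P)\<^sup>T"
        by (rule transpose_mult[OF *(4) *(2), symmetric])
      finally show ?thesis using * cy by simp
    qed
    have "vec n (\<phi> x) = Q\<^sup>T *\<^sub>v (M\<^sup>T *\<^sub>v c) + int p \<cdot>\<^sub>v (Q\<^sup>T *\<^sub>v y) + int p \<cdot>\<^sub>v z"
      unfolding z(2) cy(3) using * M cy z
      by (simp add: mult_add_distrib_mat_vec[of _ n n] mult_mat_smult_vec[of _ n n])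
    also have "\<dots> = N\<^sup>T *\<^sub>v (P'\<^sup>T *\<^sub>v c) + int p \<cdot>\<^sub>v (Q\<^sup>T *\<^sub>v y + z)"
      unfolding NT using * M cy z
      by (simp add: smult_add_distrib_vec[of _ n] assoc_add_vec[of _ n])
    finally have eq: "vec n (\<phi> x) = N\<^sup>T *\<^sub>v (P'\<^sup>T *\<^sub>v c) + int p \<cdot>\<^sub>v (Q\<^sup>T *\<^sub>v y + z)" .
    have "P'\<^sup>T *\<^sub>v c \<in> carrier_vec n" "Q\<^sup>T *\<^sub>v y + z \<in> carrier_vec n"
      using *(3,4) cy(1,2) z(1) by simp_all
    then have "\<phi> x \<in> latt p (mat_rows n N)"
      using eq by (subst latt_mat_rows_iff[OF N]) (auto simp: \<phi>_def[THEN fun_cong])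
    moreover have "\<phi> x \<in> vecs n {0..<int p}" using p0 by (auto simp: \<phi>_def vecs_iff)
    ultimately show "\<phi> x \<in> ?L N" by blast
  qed
  moreover have "inj_on \<phi> (?L M)"
  proof (rule inj_onI)
    fix x x' assume x: "x \<in> ?L M" "x' \<in> ?L M" "\<phi> x = \<phi> x'"
    obtain z z' where z: "z \<in> carrier_vec n" "vec n (\<phi> x) = Q\<^sup>T *\<^sub>v vec n x + int p \<cdot>\<^sub>v z"
      "z' \<in> carrier_vec n" "vec n (\<phi> x') = Q\<^sup>T *\<^sub>v vec n x' + int p \<cdot>\<^sub>v z'" using \<phi> by metis
    have inv: "Q'\<^sup>T *\<^sub>v (Q\<^sup>T *\<^sub>v vec n u + int p \<cdot>\<^sub>v t) = vec n u + int p \<cdot>\<^sub>v (Q'\<^sup>T *\<^sub>v t)"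
      if "t \<in> carrier_vec n" for u t
      using * that QT by (simp add: mult_add_distrib_mat_vec[of _ n n] mult_mat_smult_vec[of _ n n])
    have eq: "vec n x + int p \<cdot>\<^sub>v (Q'\<^sup>T *\<^sub>v z) = vec n x' + int p \<cdot>\<^sub>v (Q'\<^sup>T *\<^sub>v z')"
      using inv[OF z(1), of x] inv[OF z(3), of x'] z(2,4) x(3) by simp
    show "x = x'"
    proof
      fix j
      show "x j = x' j"
      proof (cases "j < n")
        case True
        have "x j + int p * (Q'\<^sup>T *\<^sub>v z) $ j = x' j + int p * (Q'\<^sup>T *\<^sub>v z') $ j"
          using arg_cong[OF eq, of "\<lambda>v. v $ j"] True * z by (simp del: index_mult_mat_vec)
        then have "x j mod int p = x' j mod int p"
          by (metis mod_mult_self2)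
        then show ?thesis using x True by (auto simp: vecs_iff)
      qed (use x in \<open>auto simp: vecs_iff\<close>)
    qed
  qed
  ultimately show ?thesis by (intro card_inj_on_le[of \<phi>]) auto
qed

lemma rk_smith_equiv:
  assumes M: "M \<in> carrier_mat n n" and MN: "smith_equiv n M N" and p: "prime p"
  shows "rk p (mat_rows n N) = rk p (mat_rows n M)"
proof -
  have rows: "set (mat_rows n A) \<subseteq> vecs n UNIV" for A by (auto simp: mat_rows_def vecs_iff)
  have "card (latt p (mat_rows n M) \<inter> vecs n {0..<int p}) = card (latt p (mat_rows n N) \<inter> vecs n {0..<int p})"
    using card_latt_smith_equiv_le[OF M MN p]
      card_latt_smith_equiv_le[OF smith_equiv_carrier[OF MN] smith_equiv_sym[OF M MN] p] by (rule antisym)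
  then show ?thesis
    using prime_gt_1_nat[OF p] by (simp add: card_latt[OF p rows])
qed

lemma latt_diagonal_coord:
  "a \<notin> set xs \<Longrightarrow> w \<in> latt p (map (\<lambda>i j. if j = i then d i else 0) xs) \<Longrightarrow> int p dvd w a"
  by (induction xs arbitrary: w) auto

lemma rk_diagonal:
  "distinct xs \<Longrightarrow> rk p (map (\<lambda>i j. if j = i then d i else 0) xs) = card {i \<in> set xs. \<not> int p dvd d i}"
proof (induction xs)
  case (Cons a xs)
  let ?f = "\<lambda>i j. if j = i then d i else (0 :: int)"
  have "?f a \<in> latt p (map ?f xs) \<longleftrightarrow> int p dvd d a"
  proof
    assume "?f a \<in> latt p (map ?f xs)"
    from latt_diagonal_coord[OF _ this, of a] Cons.prems show "int p dvd d a" by simp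
  qed (auto intro: latt_multiples)
  moreover have "{i \<in> set (a # xs). \<not> int p dvd d i} =
      (if int p dvd d a then {} else {a}) \<union> {i \<in> set xs. \<not> int p dvd d i}" by auto
  ultimately show ?case using Cons by (simp add: card_insert_if)
qed auto

lemma snf_shape_dvd:
  assumes "snf_shape n D" "i \<le> j" "j < n"
  shows "D $$ (i, i) dvd D $$ (j, j)"
  using assms(2,3)
proof (induction j rule: dec_induct)
  case (step m)
  then show ?case using assms(1) dvd_trans[of "D $$ (i, i)" "D $$ (m, m)"] by (auto simp: snf_shape_def)
qed auto

text \<open>The corank modulo p counts the diagonal entries divisible by p. Two entries other than 1
  would share a prime, since the earlier one divides the later one.\<close>

lemma snf_cyclic_iff:
  assumes D: "snf_shape n D" and n: "n \<ge> 1"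
  shows "D \<in> cyclic_SNFs n \<longleftrightarrow> (\<forall>p. prime p \<longrightarrow> n - 1 \<le> rk p (mat_rows n D))"
proof -
  define d where "d = (\<lambda>i. D $$ (i, i))"
  have Dc: "D \<in> carrier_mat n n" using D by (simp add: snf_shape_def)
  have rows: "mat_rows n D = map (\<lambda>i j. if j = i then d i else 0) [0..<n]"
    unfolding mat_rows_def using D Dc
    by (intro map_cong refl ext) (auto simp: snf_shape_def diagonal_mat_def d_def)
  have rk: "rk p (mat_rows n D) = n - card {i. i < n \<and> int p dvd d i}" for p
  proof -
    have "{i \<in> set [0..<n]. \<not> int p dvd d i} = {..<n} - {i. i < n \<and> int p dvd d i}" by auto
    then show ?thesis unfolding rows rk_diagonal[OF distinct_upt]
      by (simp add: card_Diff_subset Collect_conj_eq lessThan_def[symmetric])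
  qed
  have le: "card {i. i < n \<and> int p dvd d i} \<le> n" for p
    using card_mono[of "{..<n}" "{i. i < n \<and> int p dvd d i}"] by auto
  have "(\<forall>p. prime p \<longrightarrow> n - 1 \<le> rk p (mat_rows n D)) \<longleftrightarrow> (\<forall>p. prime p \<longrightarrow> card {i. i < n \<and> int p dvd d i} \<le> 1)"
  proof -
    have "n - 1 \<le> n - c \<longleftrightarrow> c \<le> 1" if "c \<le> n" for c using that n by linarith
    then show ?thesis unfolding rk using le by simp
  qed
  also have "\<dots> \<longleftrightarrow> card {i. i < n \<and> d i \<noteq> 1} \<le> 1"
  proof
    assume c1: "card {i. i < n \<and> d i \<noteq> 1} \<le> 1"
    show "\<forall>p. prime p \<longrightarrow> card {i. i < n \<and> int p dvd d i} \<le> 1"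
    proof (intro allI impI)
      fix p :: nat assume "prime p"
      then have "{i. i < n \<and> int p dvd d i} \<subseteq> {i. i < n \<and> d i \<noteq> 1}"
        using not_prime_1 by (auto simp: zdvd1_eq)
      then have "card {i. i < n \<and> int p dvd d i} \<le> card {i. i < n \<and> d i \<noteq> 1}" by (intro card_mono) auto
      then show "card {i. i < n \<and> int p dvd d i} \<le> 1" using c1 by linarith
    qed
  next
    assume c: "\<forall>p. prime p \<longrightarrow> card {i. i < n \<and> int p dvd d i} \<le> 1"
    show "card {i. i < n \<and> d i \<noteq> 1} \<le> 1"
    proof (rule ccontr)
      assume "\<not> ?thesis"
      then obtain i j where ij: "i < n" "j < n" "d i \<noteq> 1" "i < j"
        by (auto simp: card_le_Suc0_iff_eq not_le) (metis nat_neq_iff)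
      have "\<exists>p. prime p \<and> int p dvd d i"
      \<comment> \<open>A zero entry is divisible by every prime, so 2 serves as the witness; a
        nonzero entry is positive and different from 1, so it has a prime factor.\<close>
      proof (cases "d i = 0")
        case False
        then have "nat (d i) \<noteq> 1" using ij by auto
        then obtain p where "prime p" "p dvd nat (d i)" using prime_factor_nat by blast
        moreover have "d i \<ge> 0" using D ij by (simp add: snf_shape_def d_def)
        ultimately show ?thesis by (auto simp flip: int_dvd_int_iff)
      qed (auto intro: two_is_prime_nat)
      then obtain p where p: "prime p" "int p dvd d i" by auto
      moreover have "int p dvd d j"
        using p snf_shape_dvd[OF D, of i j] ij dvd_trans unfolding d_def by auto
      ultimately have "{i, j} \<subseteq> {i. i < n \<and> int p dvd d i}" using ij by auto
      then have "card {i, j} \<le> card {i. i < n \<and> int p dvd d i}" by (intro card_mono) auto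
      moreover have "card {i. i < n \<and> int p dvd d i} \<le> 1" using c p(1) by blast
      moreover have "card {i, j} = 2" using ij(4) by simp
      ultimately show False by linarith
    qed
  qed
  also have "\<dots> \<longleftrightarrow> D \<in> cyclic_SNFs n" using D by (simp add: cyclic_SNFs_def d_def)
  finally show ?thesis by blast
qed

text \<open>Ranks modulo p agree for \<open>M\<close> and its Smith form, so the diagonal criterion
  can be read off from \<open>M\<close>. This removes the normal form from the counting.\<close>

lemma SNF_cyclic_iff:
  assumes M: "M \<in> carrier_mat n n" and n: "n \<ge> 1"
  shows "SNF n M \<in> cyclic_SNFs n \<longleftrightarrow> (\<forall>p. prime p \<longrightarrow> n - 1 \<le> rk p (mat_rows n M))"
proof -
  have "snf_shape n (SNF n M)" "smith_equiv n M (SNF n M)"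
    using is_SNF_SNF[OF M] by (auto simp: is_SNF_iff)
  then show ?thesis using snf_cyclic_iff[OF _ n] rk_smith_equiv[OF M] by simp
qed

section \<open>The zeta function and Euler products\<close>

lemma zeta_of_nat: "zeta (real s) = (\<Sum>m. 1 / real (Suc m) ^ s)"
  by (simp add: zeta_def powr_realpow del: of_nat_Suc)

lemma summable_zeta: "s \<ge> 2 \<Longrightarrow> summable (\<lambda>m. 1 / real (Suc m) ^ s)"
  using inverse_power_summable[of s, where 'a = real]
  by (subst summable_Suc_iff[of "\<lambda>m. 1 / real m ^ s"]) (simp add: inverse_eq_divide power_divide)

lemma zeta_sums: "s \<ge> 2 \<Longrightarrow> (\<lambda>m. 1 / real (Suc m) ^ s) sums zeta (real s)"
  unfolding zeta_of_nat by (rule summable_sums[OF summable_zeta])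

text \<open>Unordered summation over an index set, because the sieve below removes whole sets of
  indices.\<close>

lemma zeta_has_sum:
  assumes "s \<ge> 2"
  shows "((\<lambda>n. 1 / real n ^ s) has_sum zeta (real s)) {1..}"
proof -
  have "((\<lambda>m. 1 / real (Suc m) ^ s) has_sum zeta (real s)) UNIV"
    by (rule sums_nonneg_imp_has_sum[OF zeta_sums[OF assms]]) simp
  moreover have "range Suc = {1..}" by (auto simp: image_iff Suc_le_eq gr0_conv_Suc)
  ultimately show ?thesis
    using has_sum_reindex[of Suc UNIV "\<lambda>n. 1 / real n ^ s"] by (simp add: o_def)
qed

lemma zeta_gt_1: "s \<ge> 2 \<Longrightarrow> zeta (real s) > 1"
proof -
  assume s: "s \<ge> 2"
  have "(\<Sum>m<2. 1 / real (Suc m) ^ s) \<le> zeta (real s)"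
    unfolding zeta_of_nat by (rule sum_le_suminf[OF summable_zeta[OF s]]) auto
  moreover have "(\<Sum>m<2. 1 / real (Suc m) ^ s) = 1 + 1 / 2 ^ s" by (simp add: numeral_2_eq_2)
  moreover have "1 / (2::real) ^ s > 0" by simp
  ultimately show ?thesis by linarith
qed

text \<open>For m >= 2 the term m^-s is at most m^-2 times 2^-(s-2), hence the factor 4 / 2^s. The
  geometric decay in s makes the product of the zeta values converge.\<close>

lemma zeta_le:
  assumes "s \<ge> 2"
  shows "zeta (real s) \<le> 1 + 4 * zeta 2 / 2 ^ s"
proof -
  have z: "(\<lambda>m. 1 / real (Suc (Suc m)) ^ s) sums (zeta (real s) - 1)"
    using zeta_sums[OF assms] by (subst sums_Suc_iff) simp
  have z2: "(\<lambda>m. 1 / real (Suc (Suc m)) ^ 2 * (4 / 2 ^ s)) sums ((zeta 2 - 1) * (4 / 2 ^ s))"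
    using zeta_sums[of 2] by (intro sums_mult2, subst sums_Suc_iff) simp
  have "zeta (real s) - 1 \<le> (zeta 2 - 1) * (4 / 2 ^ s)"
  proof (rule sums_le[OF _ z z2])
    fix m
    obtain t where s: "s = t + 2" using assms by (metis add.commute le_Suc_ex)
    have "(2::real) ^ t \<le> real (Suc (Suc m)) ^ t" by (intro power_mono) auto
    then show "1 / real (Suc (Suc m)) ^ s \<le> 1 / real (Suc (Suc m)) ^ 2 * (4 / 2 ^ s)"
      unfolding s power_add by (simp add: divide_simps)
  qed
  also have "\<dots> \<le> 4 * zeta 2 / 2 ^ s" by (simp add: divide_simps)
  finally show ?thesis by linarith
qed

lemma zeta_tendsto_1: "(\<lambda>n. zeta (real n)) \<longlonglongrightarrow> 1"
proof (rule tendsto_sandwich)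
  show "eventually (\<lambda>n. 1 \<le> zeta (real n)) sequentially"
    using eventually_ge_at_top[of 2] by eventually_elim (use zeta_gt_1 less_imp_le in blast)
  show "eventually (\<lambda>n. zeta (real n) \<le> 1 + 4 * zeta 2 / 2 ^ n) sequentially"
    using eventually_ge_at_top[of 2] by eventually_elim (rule zeta_le)
  show "(\<lambda>n. 1 + 4 * zeta 2 / 2 ^ n) \<longlonglongrightarrow> 1" by real_asymp
qed simp

(* Multiplying by 1 - 1/p^s removes the multiples of p from the Dirichlet series. *)
lemma euler_product_sieve:
  assumes "s \<ge> 2" "finite S" "\<And>p. p \<in> S \<Longrightarrow> prime p"
  shows "((\<lambda>n. 1 / real n ^ s) has_sum ((\<Prod>p\<in>S. 1 - 1 / real p ^ s) * zeta (real s)))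
     {n. n \<ge> 1 \<and> (\<forall>p\<in>S. \<not> p dvd n)}"
  using assms(2,3)
proof (induction S rule: finite_induct)
  case empty
  have "{n. n \<ge> 1 \<and> (\<forall>p\<in>{}. \<not> p dvd n)} = {1::nat..}" by auto
  then show ?case using zeta_has_sum[OF assms(1)] by simp
next
  case (insert p S)
  let ?A = "{n. n \<ge> 1 \<and> (\<forall>p\<in>S. \<not> p dvd n)}"
  let ?x = "(\<Prod>p\<in>S. 1 - 1 / real p ^ s) * zeta (real s)"
  have p: "prime p" "p > 0" using insert.prems by (auto simp: prime_gt_0_nat)
  have IH: "((\<lambda>n. 1 / real n ^ s) has_sum ?x) ?A" using insert by simp
  have "((\<lambda>n. 1 / real (p * n) ^ s) has_sum (?x * (1 / real p ^ s))) ?A"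
    using has_sum_cmult_left[OF IH, of "1 / real p ^ s"] by (simp add: power_mult_distrib mult.commute)
  then have img: "((\<lambda>n. 1 / real n ^ s) has_sum (?x * (1 / real p ^ s))) ((*) p ` ?A)"
    using p by (subst has_sum_reindex) (auto simp: inj_on_def o_def)
  have "q dvd p * n \<longleftrightarrow> q dvd n" if "q \<in> S" for q n
  proof -
    have "prime q" "q \<noteq> p" using that insert by auto
    then show ?thesis using p primes_dvd_imp_eq by (auto simp: prime_dvd_mult_iff)
  qed
  then have "(*) p ` ?A = {n \<in> ?A. p dvd n}"
    using p by (auto simp: dvd_def image_iff) (metis mult_eq_0_iff not_gr_zero not_less_eq_eq)+
  then have "?A - (*) p ` ?A = {n. n \<ge> 1 \<and> (\<forall>p\<in>insert p S. \<not> p dvd n)}" "(*) p ` ?A \<subseteq> ?A"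
    by auto
  with has_sum_Diff[OF IH img] insert.hyps show ?case by (simp add: algebra_simps)
qed

definition euler_factor :: "nat \<Rightarrow> nat \<Rightarrow> real" where
  "euler_factor s p = (if prime p then 1 - 1 / real p ^ s else 1)"

text \<open>After sieving by the primes up to N, only 1 and integers above N remain. The partial
  product times zeta(s) is therefore at least 1 and exceeds 1 by at most a tail of the
  series.\<close>

lemma euler_product:
  assumes s: "s \<ge> 2"
  shows "euler_factor s has_prod (1 / zeta (real s))"
proof -
  let ?f = "\<lambda>n. 1 / real n ^ s"
  define x where "x = (\<lambda>N. (\<Prod>i\<le>N. euler_factor s i) * zeta (real s))"
  have z0: "zeta (real s) > 0" using zeta_gt_1[OF s] by simp
  have sum: "(?f has_sum x N) {n. n \<ge> 1 \<and> (\<forall>p\<in>{p. prime p \<and> p \<le> N}. \<not> p dvd n)}" for N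
  proof -
    have "(\<Prod>i\<le>N. euler_factor s i) = (\<Prod>p\<in>{p. prime p \<and> p \<le> N}. 1 - 1 / real p ^ s)"
      unfolding euler_factor_def by (subst prod.inter_filter[symmetric]) (auto intro!: prod.cong)
    then show ?thesis unfolding x_def by (simp only:) (rule euler_product_sieve[OF s], auto)
  qed
  have lower: "1 \<le> x N" for N
  proof -
    have "(?f has_sum 1) {1}" by (simp add: has_sum_finiteI)
    then show ?thesis by (rule has_sum_mono2[OF _ sum]) auto
  qed
  have upper: "x N \<le> zeta (real s) - (\<Sum>n\<in>{2..N}. ?f n)" for N
  proof (rule has_sum_mono2[OF sum])
    show "(?f has_sum (zeta (real s) - (\<Sum>n\<in>{2..N}. ?f n))) ({1..} - {2..N})"
      by (rule has_sum_Diff[OF zeta_has_sum[OF s]]) auto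
    show "{n. n \<ge> 1 \<and> (\<forall>p\<in>{p. prime p \<and> p \<le> N}. \<not> p dvd n)} \<subseteq> {1..} - {2..N}"
    proof clarify
      fix n :: nat assume n: "\<forall>p\<in>{p. prime p \<and> p \<le> N}. \<not> p dvd n" "1 \<le> n"
      show "n \<in> {1..} - {2..N}"
      proof (cases "n = 1")
        case False
        then obtain p where "prime p" "p dvd n" using prime_factor_nat by blast
        moreover have "p \<le> n" using \<open>p dvd n\<close> n(2) by (simp add: dvd_imp_le)
        ultimately show ?thesis using n by force
      qed auto
    qed
  qed auto
  have "(\<lambda>N. \<Sum>m<N. 1 / real (Suc m) ^ s) \<longlonglongrightarrow> zeta (real s)"
    using zeta_sums[OF s] by (simp add: sums_def)
  then have "(\<lambda>N. 1 + (zeta (real s) - (\<Sum>m<N. 1 / real (Suc m) ^ s))) \<longlonglongrightarrow> 1 + (zeta (real s) - zeta (real s))"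
    by (intro tendsto_intros)
  moreover have "eventually (\<lambda>N. 1 + (zeta (real s) - (\<Sum>m<N. 1 / real (Suc m) ^ s))
      = zeta (real s) - (\<Sum>n\<in>{2..N}. ?f n)) sequentially"
    using eventually_ge_at_top[of 1]
  proof eventually_elim
    case (elim N)
    have "(\<Sum>m<N. 1 / real (Suc m) ^ s) = (\<Sum>n\<in>{1..N}. ?f n)"
      by (rule sum.reindex_bij_witness[of _ "\<lambda>n. n - 1" Suc]) auto
    also have "\<dots> = 1 + (\<Sum>n\<in>{2..N}. ?f n)"
      using elim by (subst sum.atLeast_Suc_atMost) (auto simp: numeral_2_eq_2)
    finally show ?case by simp
  qed
  ultimately have "(\<lambda>N. zeta (real s) - (\<Sum>n\<in>{2..N}. ?f n)) \<longlonglongrightarrow> 1"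
    using tendsto_cong[THEN iffD1] by fastforce
  then have "x \<longlonglongrightarrow> 1"
    by (rule tendsto_sandwich[rotated 2, OF tendsto_const]) (auto intro: always_eventually lower upper)
  then have "(\<lambda>N. x N / zeta (real s)) \<longlonglongrightarrow> 1 / zeta (real s)"
    using z0 by (intro tendsto_divide tendsto_const) auto
  then have "(\<lambda>N. \<Prod>i\<le>N. euler_factor s i) \<longlonglongrightarrow> 1 / zeta (real s)"
    using z0 by (simp add: x_def)
  then show ?thesis using z0 by (simp add: has_prod_def raw_has_prod_def)
qed

lemma euler_factor_bounds:
  assumes "s \<ge> 1"
  shows "0 < euler_factor s p" "euler_factor s p \<le> 1"
proof -
  have "real p ^ s > 1" if "prime p"
    using prime_gt_1_nat[OF that] assms by (intro one_less_power) auto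
  then show "0 < euler_factor s p" "euler_factor s p \<le> 1"
    by (auto simp: euler_factor_def divide_simps)
qed

section \<open>The local factors of \<open>Z\<close> and their products over the primes\<close>

lemma geometric_tail:
  fixes x :: real
  assumes "x > 1" "n \<ge> 1"
  shows "1 + (\<Sum>i=2..n. 1 / x ^ i) + 1 / (x ^ n * (x - 1)) = 1 + 1 / (x * (x - 1))"
  using assms(2)
proof (induction n rule: dec_induct)
  case (step n)
  have "1 / x ^ Suc n + 1 / (x ^ Suc n * (x - 1)) = 1 / (x ^ n * (x - 1))"
    using assms(1) by (simp add: divide_simps)
  then show ?case using step by simp
qed (use assms in simp)

text \<open>The limit of \<open>Z_factor n p\<close> for growing n: the geometric series of p^-i
  over i >= 2 sums to 1/(p(p-1)).\<close>

definition Z_factor_lim :: "nat \<Rightarrow> real" where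
  "Z_factor_lim p = (if prime p then 1 + 1 / (real p * (real p - 1)) else 1)"

lemma Z_factor_ge_1: "1 \<le> Z_factor n p"
  by (auto simp: Z_factor_def intro!: sum_nonneg)

lemma Z_factor_le_lim:
  assumes "n \<ge> 1"
  shows "Z_factor n p \<le> Z_factor_lim p"
proof (cases "prime p")
  case True
  then have p: "real p > 1" using prime_gt_1_nat by simp
  have "1 / (real p ^ n * (real p - 1)) \<ge> 0" using p by simp
  then have "1 + (\<Sum>i=2..n. 1 / real p ^ i) \<le> 1 + 1 / (real p * (real p - 1))"
    unfolding geometric_tail[OF p assms, symmetric] by linarith
  then show ?thesis using True by (simp add: Z_factor_def Z_factor_lim_def)
qed (simp add: Z_factor_def Z_factor_lim_def)

text \<open>The missing tail 1/(p^n (p-1)) is at most p^-n, so a factor 1 - p^-n covers it. Over all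
  primes these factors multiply to 1/zeta(n), which tends to 1.\<close>

lemma Z_factor_lim_le:
  assumes "n \<ge> 1"
  shows "Z_factor_lim p * euler_factor n p \<le> Z_factor n p"
proof (cases "prime p")
  case True
  then have p: "real p > 1" "real p \<ge> 2" using prime_ge_2_nat[OF True] by simp_all
  let ?x = "1 / real p ^ n" and ?L = "Z_factor_lim p"
  have "?L = Z_factor n p + 1 / (real p ^ n * (real p - 1))"
    using geometric_tail[OF p(1) assms] True by (simp add: Z_factor_def Z_factor_lim_def)
  moreover have "1 / (real p ^ n * (real p - 1)) \<le> ?x" using p by (simp add: divide_simps)
  moreover have "1 * ?x \<le> ?L * ?x"
    using Z_factor_ge_1[of n p] Z_factor_le_lim[OF assms, of p] by (intro mult_right_mono) auto
  moreover have "?L * euler_factor n p = ?L - ?L * ?x"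
    using True by (simp add: euler_factor_def right_diff_distrib)
  ultimately show ?thesis by linarith
qed (simp add: Z_factor_def Z_factor_lim_def euler_factor_def)

text \<open>At a prime x, the Euler factor for 6 divided by those for 2 and 3 is (x^3 + 1) / (x (x^2
  - 1)), and cancelling x + 1 leaves 1 + 1/(x (x - 1)).\<close>

lemma Z_factor_lim_has_prod: "Z_factor_lim has_prod (zeta 2 * zeta 3 / zeta 6)"
proof -
  have e: "euler_factor 2 has_prod (1 / zeta 2)" "euler_factor 3 has_prod (1 / zeta 3)"
    "euler_factor 6 has_prod (1 / zeta 6)"
    using euler_product[of 2] euler_product[of 3] euler_product[of 6] by simp_all
  have "(\<lambda>p. euler_factor 6 p / (euler_factor 2 p * euler_factor 3 p)) has_prod
      ((1 / zeta 6) / (1 / zeta 2 * (1 / zeta 3)))"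
    by (intro has_prod_divide has_prod_mult e)
  also have "(\<lambda>p. euler_factor 6 p / (euler_factor 2 p * euler_factor 3 p)) = Z_factor_lim"
  proof
    fix p
    show "euler_factor 6 p / (euler_factor 2 p * euler_factor 3 p) = Z_factor_lim p"
    proof (cases "prime p")
      case True
      define x where "x = real p"
      have x: "x > 1" using prime_gt_1_nat[OF True] by (simp add: x_def)
      have "x\<^sup>2 > 1" "x ^ 3 > 1" using one_less_power[OF x] by simp_all
      then have nz: "x\<^sup>2 - 1 \<noteq> 0" "x ^ 3 - 1 \<noteq> 0" "x - 1 \<noteq> 0" "x \<noteq> 0"
        using x by linarith+
      have "(1 - 1 / x ^ 6) = (x ^ 3 - 1) * (x ^ 3 + 1) / x ^ 6"
        "1 - 1 / x\<^sup>2 = (x\<^sup>2 - 1) / x\<^sup>2" "1 - 1 / x ^ 3 = (x ^ 3 - 1) / x ^ 3"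
        using nz by (simp_all add: field_simps eval_nat_numeral)
      then have "(1 - 1 / x ^ 6) / ((1 - 1 / x\<^sup>2) * (1 - 1 / x ^ 3)) = (x ^ 3 + 1) / (x * (x\<^sup>2 - 1))"
        using nz by (simp add: divide_simps) (simp add: eval_nat_numeral)
      also have "\<dots> = 1 + 1 / (x * (x - 1))"
      proof -
        have "x\<^sup>2 - 1 = (x - 1) * (x + 1)" by (simp add: power2_eq_square algebra_simps)
        moreover have "x ^ 3 + 1 = (x + 1) * (x * (x - 1) + 1)" by (simp add: power3_eq_cube algebra_simps)
        ultimately show ?thesis using nz x by (simp add: divide_simps)
      qed
      finally show ?thesis using True by (simp add: euler_factor_def Z_factor_lim_def x_def)
    qed (simp add: euler_factor_def Z_factor_lim_def)
  qed
  also have "(1 / zeta 6) / (1 / zeta 2 * (1 / zeta 3)) = zeta 2 * zeta 3 / zeta 6" by simp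
  finally show ?thesis .
qed

text \<open>For p >= 2 the excess over 1 is at most 1/(p(p-1)) <= 2/p^2, which is summable.\<close>

lemma convergent_Z_factor: "convergent_prod (Z_factor n)"
proof (cases "n \<ge> 1")
  case True
  have bd: "norm (Z_factor n p - 1) \<le> 2 * (1 / real p ^ 2)" for p
  proof (cases "prime p")
    case p: True
    then have x: "real p \<ge> 2" using prime_ge_2_nat by simp
    have "norm (Z_factor n p - 1) \<le> 1 / (real p * (real p - 1))"
      using Z_factor_ge_1[of n p] Z_factor_le_lim[OF True, of p] p by (simp add: Z_factor_lim_def)
    also have "\<dots> \<le> 2 * (1 / real p ^ 2)" using x by (simp add: divide_simps power2_eq_square)
    finally show ?thesis .
  qed (simp add: Z_factor_def)
  have "summable (\<lambda>p. 2 * (1 / real p ^ 2))"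
    using inverse_power_summable[of 2, where 'a = real]
    by (intro summable_mult) (simp add: inverse_eq_divide power_divide)
  then have "summable (\<lambda>p. norm (Z_factor n p - 1))"
    by (rule summable_comparison_test[rotated]) (use bd in auto)
  then show ?thesis
    by (intro abs_convergent_prod_imp_convergent_prod summable_imp_abs_convergent_prod)
next
  case False
  then have "Z_factor n = (\<lambda>_. 1)" by (auto simp: Z_factor_def fun_eq_iff)
  then show ?thesis by simp
qed

lemma Z_factor_has_prod: "Z_factor n has_prod prodinf (Z_factor n)"
  using convergent_Z_factor by (rule convergent_prod_has_prod)

lemma prodinf_Z_factor_le_lim:
  assumes "n \<ge> 1"
  shows "prodinf (Z_factor n) \<le> zeta 2 * zeta 3 / zeta 6"
  by (rule has_prod_le[OF Z_factor_has_prod Z_factor_lim_has_prod])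
     (use Z_factor_ge_1[of n] Z_factor_le_lim[OF assms] in \<open>auto intro: order_trans[OF zero_le_one]\<close>)

lemma prodinf_Z_factor_ge:
  assumes "n \<ge> 2"
  shows "zeta 2 * zeta 3 / zeta 6 / zeta (real n) \<le> prodinf (Z_factor n)"
proof (rule has_prod_le[OF _ Z_factor_has_prod])
  show "(\<lambda>p. Z_factor_lim p * euler_factor n p) has_prod (zeta 2 * zeta 3 / zeta 6 / zeta (real n))"
    using has_prod_mult[OF Z_factor_lim_has_prod euler_product[OF assms]] by simp
  fix p
  have "0 \<le> Z_factor_lim p" using Z_factor_ge_1[of n p] Z_factor_le_lim[of n p] assms by linarith
  then show "0 \<le> Z_factor_lim p * euler_factor n p \<and> Z_factor_lim p * euler_factor n p \<le> Z_factor n p"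
    using euler_factor_bounds[of n p] Z_factor_lim_le[of n p] assms by simp
qed

lemma prodinf_Z_factor_tendsto: "(\<lambda>n. prodinf (Z_factor n)) \<longlonglongrightarrow> zeta 2 * zeta 3 / zeta 6"
proof (rule tendsto_sandwich)
  show "eventually (\<lambda>n. zeta 2 * zeta 3 / zeta 6 / zeta (real n) \<le> prodinf (Z_factor n)) sequentially"
    using eventually_ge_at_top[of 2] by eventually_elim (rule prodinf_Z_factor_ge)
  show "eventually (\<lambda>n. prodinf (Z_factor n) \<le> zeta 2 * zeta 3 / zeta 6) sequentially"
    using eventually_ge_at_top[of 1] by eventually_elim (rule prodinf_Z_factor_le_lim)
  have "(\<lambda>n. zeta 2 * zeta 3 / zeta 6 / zeta (real n)) \<longlonglongrightarrow> zeta 2 * zeta 3 / zeta 6 / 1"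
    by (intro tendsto_intros zeta_tendsto_1) auto
  then show "(\<lambda>n. zeta 2 * zeta 3 / zeta 6 / zeta (real n)) \<longlonglongrightarrow> zeta 2 * zeta 3 / zeta 6" by simp
qed simp

text \<open>Adding x = p^-(n+1) to a factor that is at least 1 gives no more than multiplying it by
  1 + x = (1 - x^2)/(1 - x), and the product of these over the primes is
  zeta(n+1)/zeta(2n+2).\<close>

lemma prodinf_Z_factor_Suc_le:
  assumes "n \<ge> 1"
  shows "prodinf (Z_factor (Suc n)) \<le> prodinf (Z_factor n) * (zeta (real (Suc n)) / zeta (real (2 * Suc n)))"
proof (rule has_prod_le[OF Z_factor_has_prod])
  have "(\<lambda>p. Z_factor n p * (euler_factor (2 * Suc n) p / euler_factor (Suc n) p)) has_prod
    (prodinf (Z_factor n) * ((1 / zeta (real (2 * Suc n))) / (1 / zeta (real (Suc n)))))"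
    using assms by (intro has_prod_mult has_prod_divide Z_factor_has_prod euler_product) auto
  then show "(\<lambda>p. Z_factor n p * (euler_factor (2 * Suc n) p / euler_factor (Suc n) p)) has_prod
    (prodinf (Z_factor n) * (zeta (real (Suc n)) / zeta (real (2 * Suc n))))" by simp
  fix p
  have "Z_factor (Suc n) p \<le> Z_factor n p * (euler_factor (2 * Suc n) p / euler_factor (Suc n) p)"
  proof (cases "prime p")
    case True
    define x where "x = 1 / real p ^ Suc n"
    have pos: "0 < 1 - x" using euler_factor_bounds(1)[of "Suc n" p] True by (simp add: euler_factor_def x_def)
    have "x * x = 1 / real p ^ (2 * Suc n)" by (simp add: x_def mult_2 power_add)
    then have "euler_factor (2 * Suc n) p / euler_factor (Suc n) p = (1 - x * x) / (1 - x)"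
      using True by (simp add: euler_factor_def x_def)
    also have "\<dots> = 1 + x" using pos by (simp add: field_simps)
    finally have eq: "euler_factor (2 * Suc n) p / euler_factor (Suc n) p = 1 + x" .
    have "x \<ge> 0" by (simp add: x_def)
    then have "Z_factor n p + x \<le> Z_factor n p * (1 + x)"
      using mult_right_mono[OF Z_factor_ge_1[of n p], of x] by (simp add: algebra_simps)
    moreover have "Z_factor (Suc n) p = Z_factor n p + x"
      using True assms by (simp add: Z_factor_def x_def)
    ultimately show ?thesis unfolding eq by simp
  qed (simp add: Z_factor_def euler_factor_def)
  then show "0 \<le> Z_factor (Suc n) p \<and>
      Z_factor (Suc n) p \<le> Z_factor n p * (euler_factor (2 * Suc n) p / euler_factor (Suc n) p)"
    using Z_factor_ge_1[of "Suc n" p] by simp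
qed

lemma prodinf_Z_factor_pos: "prodinf (Z_factor n) > 0"
proof (rule has_prod_pos[OF Z_factor_has_prod])
  show "0 < Z_factor n p" for p using Z_factor_ge_1[of n p] by linarith
qed

lemma prod_zeta_pos: "(\<Prod>i=2..n. zeta (real i)) > 0"
proof (rule prod_pos)
  fix i assume "i \<in> {2..n}"
  then show "0 < zeta (real i)" using zeta_gt_1[of i] by simp
qed

text \<open>The new zeta(n+1) in the denominator cancels the possible growth of the product over the
  primes, leaving at most Z(n)/zeta(2n+2), and zeta(2n+2) > 1.\<close>

lemma Z_Suc_less:
  assumes "n \<ge> 1"
  shows "Z (Suc n) < Z n"
proof -
  let ?P = "\<Prod>i=2..n. zeta (real i)"
  let ?z = "zeta (real (Suc n))" and ?y = "zeta (real (2 * Suc n))"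
  have z: "?z > 1" "?y > 1" using assms by (auto intro!: zeta_gt_1 simp del: of_nat_mult of_nat_Suc)
  have "Z (Suc n) = prodinf (Z_factor (Suc n)) / (?P * ?z)"
    using assms by (simp add: Z_def mult.commute del: of_nat_Suc)
  also have "\<dots> \<le> prodinf (Z_factor n) * (?z / ?y) / (?P * ?z)"
    using prod_zeta_pos[of n] z by (intro divide_right_mono prodinf_Z_factor_Suc_le assms) (auto simp del: of_nat_Suc)
  also have "\<dots> = Z n / ?y" using z by (simp add: Z_def del: of_nat_Suc of_nat_mult)
  also have "\<dots> < Z n"
  proof -
    have "Z n > 0" using prodinf_Z_factor_pos prod_zeta_pos by (simp add: Z_def)
    then show ?thesis using z by (simp add: divide_less_eq)
  qed
  finally show ?thesis .
qed

lemma Z_strict_antimono: "strict_antimono_on {1..} Z"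
proof (rule monotone_onI)
  fix m n :: nat assume "m \<in> {1..}" "n \<in> {1..}" "m < n"
  then have "Suc m \<le> n" "m \<ge> 1" by auto
  then show "Z m > Z n"
  proof (induction n rule: dec_induct)
    case (step k)
    then show ?case using Z_Suc_less[of k] by fastforce
  qed (rule Z_Suc_less)
qed

text \<open>1 + p^-2 = (1 - p^-4)/(1 - p^-2), and zeta(2) cancels.\<close>

lemma Z_2: "Z 2 = 1 / zeta 4"
proof -
  have "(\<lambda>p. euler_factor 4 p / euler_factor 2 p) has_prod ((1 / zeta 4) / (1 / zeta 2))"
    using euler_product[of 4] euler_product[of 2] by (intro has_prod_divide) simp_all
  also have "(\<lambda>p. euler_factor 4 p / euler_factor 2 p) = Z_factor 2"
  proof
    fix p
    show "euler_factor 4 p / euler_factor 2 p = Z_factor 2 p"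
    proof (cases "prime p")
      case True
      define x where "x = 1 / real p ^ 2"
      have "0 < 1 - x" using euler_factor_bounds(1)[of 2 p] True by (simp add: euler_factor_def x_def)
      moreover have "1 - 1 / real p ^ 4 = (1 - x) * (1 + x)"
        by (simp add: x_def algebra_simps power_numeral_reduce)
      ultimately show ?thesis using True by (simp add: euler_factor_def Z_factor_def x_def)
    qed (simp add: euler_factor_def Z_factor_def)
  qed
  finally have "prodinf (Z_factor 2) = zeta 2 / zeta 4" using has_prod_unique by force
  moreover have "zeta 2 > 0" using zeta_gt_1[of 2] by simp
  ultimately show ?thesis by (simp add: Z_def)
qed

lemma convergent_prod_zeta: "convergent_prod (\<lambda>i. zeta (real (i + 4)))"
proof -
  have z2: "zeta 2 > 0" using zeta_gt_1[of 2] by simp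
  have bd: "norm (zeta (real (i + 4)) - 1) \<le> 4 * zeta 2 * (1 / 2) ^ i" for i
  proof -
    have "norm (zeta (real (i + 4)) - 1) \<le> 4 * zeta 2 / 2 ^ (i + 4)"
      using zeta_gt_1[of "i + 4"] zeta_le[of "i + 4"] by simp
    also have "\<dots> \<le> 4 * zeta 2 / 2 ^ i"
      using z2 by (intro divide_left_mono power_increasing mult_pos_pos) auto
    finally show ?thesis by (simp add: power_divide)
  qed
  have "summable (\<lambda>i. norm (zeta (real (i + 4)) - 1))"
    by (rule summable_comparison_test[of _ "\<lambda>i. 4 * zeta 2 * (1 / 2) ^ i"])
       (use bd in \<open>auto intro!: summable_mult summable_geometric simp del: of_nat_add\<close>)
  then show ?thesis
    by (intro abs_convergent_prod_imp_convergent_prod summable_imp_abs_convergent_prod)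
qed

text \<open>The factors zeta(2) and zeta(3) of the denominator cancel against the limit of
  \<open>prodinf (Z_factor n)\<close>. The index is shifted by 4 so that the remaining factors start
  at zeta(4).\<close>

lemma Z_tendsto: "Z \<longlonglongrightarrow> 1 / (zeta 6 * prodinf (\<lambda>i. zeta (real (i + 4))))"
proof -
  let ?P = "prodinf (\<lambda>i. zeta (real (i + 4)))"
  have z: "zeta 2 > 0" "zeta 3 > 0" "zeta 6 > 0"
    using zeta_gt_1[of 2] zeta_gt_1[of 3] zeta_gt_1[of 6] by simp_all
  have Ppos: "?P > 0"
  proof (rule has_prod_pos[OF convergent_prod_has_prod[OF convergent_prod_zeta]])
    show "0 < zeta (real (i + 4))" for i using zeta_gt_1[of "i + 4"] by linarith
  qed
  have "(\<lambda>n. 1 / (zeta 2 * zeta 3 * (\<Prod>i\<le>n. zeta (real (i + 4)))) * prodinf (Z_factor (n + 4)))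
      \<longlonglongrightarrow> 1 / (zeta 2 * zeta 3 * ?P) * (zeta 2 * zeta 3 / zeta 6)"
    using z Ppos
    by (intro tendsto_mult tendsto_divide tendsto_const convergent_prod_LIMSEQ convergent_prod_zeta
          LIMSEQ_ignore_initial_segment[OF prodinf_Z_factor_tendsto]) auto
  also have "1 / (zeta 2 * zeta 3 * ?P) * (zeta 2 * zeta 3 / zeta 6) = 1 / (zeta 6 * ?P)"
    using z by simp
  also have "(\<lambda>n. 1 / (zeta 2 * zeta 3 * (\<Prod>i\<le>n. zeta (real (i + 4)))) * prodinf (Z_factor (n + 4)))
      = (\<lambda>n. Z (n + 4))"
  proof
    fix n
    have "(\<Prod>i=2..n + 4. zeta (real i)) = (\<Prod>i\<in>{2, 3} \<union> {4..n + 4}. zeta (real i))"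
      by (intro prod.cong) auto
    also have "\<dots> = zeta 2 * zeta 3 * (\<Prod>i=4..n + 4. zeta (real i))"
      by (subst prod.union_disjoint) auto
    also have "(\<Prod>i=4..n + 4. zeta (real i)) = (\<Prod>i\<le>n. zeta (real (i + 4)))"
      by (rule prod.reindex_bij_witness[of _ "\<lambda>i. i + 4" "\<lambda>i. i - 4"]) auto
    finally show "1 / (zeta 2 * zeta 3 * (\<Prod>i\<le>n. zeta (real (i + 4)))) * prodinf (Z_factor (n + 4)) = Z (n + 4)"
      by (simp add: Z_def)
  qed
  finally show ?thesis by (rule LIMSEQ_offset)
qed

section \<open>Numerical values\<close>

text \<open>The product formula for sine at x and at ix: the factors combine to (1 - x^2/k^2)(1 +
  x^2/k^2), and sin(iy) = i sinh y.\<close>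

lemma sin_sinh_product:
  assumes "x \<noteq> (0::real)"
  shows "(\<lambda>n. \<Prod>k=1..n. 1 - x ^ 4 / real k ^ 4) \<longlonglongrightarrow> sin (pi * x) * sinh (pi * x) / (pi * x)\<^sup>2"
proof -
  have "(\<lambda>n. (of_real pi * of_real x * (\<Prod>k=1..n. 1 - (of_real x)\<^sup>2 / of_nat k ^ 2)) *
      (of_real pi * (\<i> * of_real x) * (\<Prod>k=1..n. 1 - (\<i> * of_real x)\<^sup>2 / of_nat k ^ 2)))
    \<longlonglongrightarrow> sin (of_real pi * of_real x) * sin (of_real pi * (\<i> * of_real x :: complex))"
    by (intro tendsto_mult sin_product_formula_complex)
  also have "(\<lambda>n. (of_real pi * of_real x * (\<Prod>k=1..n. 1 - (of_real x)\<^sup>2 / of_nat k ^ 2)) *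
      (of_real pi * (\<i> * of_real x) * (\<Prod>k=1..n. 1 - (\<i> * of_real x)\<^sup>2 / of_nat k ^ 2)))
    = (\<lambda>n. \<i> * complex_of_real ((pi * x)\<^sup>2 * (\<Prod>k=1..n. 1 - x ^ 4 / real k ^ 4)))"
  proof
    fix n
    have "(\<Prod>k=1..n. 1 - (complex_of_real x)\<^sup>2 / of_nat k ^ 2) * (\<Prod>k=1..n. 1 - (\<i> * complex_of_real x)\<^sup>2 / of_nat k ^ 2)
        = (\<Prod>k=1..n. complex_of_real (1 - x ^ 4 / real k ^ 4))"
      unfolding prod.distrib[symmetric]
      by (intro prod.cong refl) (simp add: power_mult_distrib field_simps power_numeral_reduce)
    then show "(of_real pi * of_real x * (\<Prod>k=1..n. 1 - (of_real x)\<^sup>2 / of_nat k ^ 2)) *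
      (of_real pi * (\<i> * of_real x) * (\<Prod>k=1..n. 1 - (\<i> * of_real x)\<^sup>2 / of_nat k ^ 2))
      = \<i> * complex_of_real ((pi * x)\<^sup>2 * (\<Prod>k=1..n. 1 - x ^ 4 / real k ^ 4))"
      by (simp add: power2_eq_square ac_simps)
  qed
  also have "sin (of_real pi * of_real x) * sin (of_real pi * (\<i> * of_real x :: complex))
      = \<i> * complex_of_real (sin (pi * x) * sinh (pi * x))"
  proof -
    have "sin (of_real pi * (\<i> * of_real x :: complex)) = \<i> * complex_of_real (sinh (pi * x))"
      by (simp add: sin_exp_eq sinh_def exp_of_real[symmetric] scaleR_conv_of_real field_simps)
    then show ?thesis by (simp add: sin_of_real[symmetric])
  qed
  \<comment> \<open>Both sides are i times a real number, so the imaginary part carries the limit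
    back to the reals.\<close>
  finally have "(\<lambda>n. Im (\<i> * complex_of_real ((pi * x)\<^sup>2 * (\<Prod>k=1..n. 1 - x ^ 4 / real k ^ 4))))
      \<longlonglongrightarrow> Im (\<i> * complex_of_real (sin (pi * x) * sinh (pi * x)))"
    by (rule tendsto_Im)
  then have "(\<lambda>n. (pi * x)\<^sup>2 * (\<Prod>k=1..n. 1 - x ^ 4 / real k ^ 4)) \<longlonglongrightarrow> sin (pi * x) * sinh (pi * x)"
    by (simp del: of_real_mult of_real_prod of_real_power)
  then have "(\<lambda>n. (pi * x)\<^sup>2 * (\<Prod>k=1..n. 1 - x ^ 4 / real k ^ 4) / (pi * x)\<^sup>2)
      \<longlonglongrightarrow> sin (pi * x) * sinh (pi * x) / (pi * x)\<^sup>2"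
    using assms by (intro tendsto_divide tendsto_const) auto
  then show ?thesis using assms by simp
qed

(* Compare the x^4 coefficients of the product formula above; the product over k is
   squeezed between 1 - x^4 zeta 4 and exp (- x^4 zeta 4). *)
lemma zeta_4: "zeta 4 = pi ^ 4 / 90"
proof -
  let ?K = "zeta 4"
  define g where "g = (\<lambda>x::real. sin (pi * x) * sinh (pi * x) / (pi * x)\<^sup>2)"
  have sum: "(\<lambda>n. \<Sum>k=1..n. 1 / real k ^ 4) \<longlonglongrightarrow> ?K"
  proof -
    have "(\<lambda>n. \<Sum>m<n. 1 / real (Suc m) ^ 4) \<longlonglongrightarrow> ?K" using zeta_sums[of 4] by (simp add: sums_def)
    also have "(\<lambda>n. \<Sum>m<n. 1 / real (Suc m) ^ 4) = (\<lambda>n. \<Sum>k=1..n. 1 / real k ^ 4)"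
      by (intro ext sum.reindex_bij_witness[of _ "\<lambda>n. n - 1" Suc]) auto
    finally show ?thesis .
  qed
  have bounds: "1 - x ^ 4 * ?K \<le> g x \<and> g x \<le> exp (- (x ^ 4 * ?K))" if x: "x > 0" "x < 1" for x
  proof
    have x4: "0 \<le> x ^ 4 / real k ^ 4 \<and> x ^ 4 / real k ^ 4 \<le> 1" if "k \<ge> 1" for k
    proof -
      have "x ^ 4 \<le> 1 ^ 4" using x by (intro power_mono) auto
      also have "1 ^ 4 \<le> real k ^ 4" using that by (intro power_mono) auto
      finally show ?thesis using x that by simp
    qed
    have lim: "(\<lambda>n. \<Prod>k=1..n. 1 - x ^ 4 / real k ^ 4) \<longlonglongrightarrow> g x"
      unfolding g_def by (rule sin_sinh_product) (use x in simp)
    have s: "(\<lambda>n. \<Sum>k=1..n. x ^ 4 / real k ^ 4) \<longlonglongrightarrow> x ^ 4 * ?K"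
      using tendsto_mult_left[OF sum, of "x ^ 4"] by (simp add: sum_distrib_left)
    show "1 - x ^ 4 * ?K \<le> g x"
    proof (rule LIMSEQ_le[OF tendsto_diff[OF tendsto_const s] lim])
      show "\<exists>N. \<forall>n\<ge>N. 1 - (\<Sum>k=1..n. x ^ 4 / real k ^ 4) \<le> (\<Prod>k=1..n. 1 - x ^ 4 / real k ^ 4)"
        using x4 by (intro exI allI impI Weierstrass_prod_ineq) auto
    qed
    show "g x \<le> exp (- (x ^ 4 * ?K))"
    proof (rule LIMSEQ_le[OF lim tendsto_exp[OF tendsto_minus[OF s]]])
      have "(\<Prod>k=1..n. 1 - x ^ 4 / real k ^ 4) \<le> exp (- (\<Sum>k=1..n. x ^ 4 / real k ^ 4))" for n
      proof -
        have "(\<Prod>k=1..n. 1 - x ^ 4 / real k ^ 4) \<le> (\<Prod>k=1..n. exp (- (x ^ 4 / real k ^ 4)))"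
        proof (intro prod_mono conjI)
          fix k assume "k \<in> {1..n}"
          then show "0 \<le> 1 - x ^ 4 / real k ^ 4" using x4[of k] by auto
          show "1 - x ^ 4 / real k ^ 4 \<le> exp (- (x ^ 4 / real k ^ 4))"
            using exp_ge_add_one_self[of "- (x ^ 4 / real k ^ 4)"] by simp
        qed
        then show ?thesis by (simp add: exp_sum sum_negf[symmetric])
      qed
      then show "\<exists>N. \<forall>n\<ge>N. (\<Prod>k=1..n. 1 - x ^ 4 / real k ^ 4) \<le> exp (- (\<Sum>k=1..n. x ^ 4 / real k ^ 4))"
        by blast
    qed
  qed
  have K0: "?K > 0" using zeta_gt_1[of 4] by simp
  have "((\<lambda>x. (1 - g x) / x ^ 4) \<longlongrightarrow> ?K) (at_right 0)"
  proof (rule tendsto_sandwich)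
    have ev: "eventually (\<lambda>x. x > 0 \<and> x < 1) (at_right (0::real))"
      by (auto simp: eventually_at_right_field intro!: exI[of _ 1])
    show "eventually (\<lambda>x. (1 - exp (- (x ^ 4 * ?K))) / x ^ 4 \<le> (1 - g x) / x ^ 4) (at_right 0)"
      using ev by eventually_elim (use bounds in \<open>auto intro!: divide_right_mono\<close>)
    show "eventually (\<lambda>x. (1 - g x) / x ^ 4 \<le> ?K) (at_right 0)"
      using ev
    proof eventually_elim
      case (elim x)
      then show ?case using bounds[of x] by (simp add: divide_le_eq mult.commute)
    qed
    show "((\<lambda>x. (1 - exp (- (x ^ 4 * ?K))) / x ^ 4) \<longlongrightarrow> ?K) (at_right 0)"
      using K0 by real_asymp
  qed simp
  moreover have "((\<lambda>x. (1 - g x) / x ^ 4) \<longlongrightarrow> pi ^ 4 / 90) (at_right 0)"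
  proof -
    \<comment> \<open>The y^6 coefficient of sin y sinh y is 2/120 - 1/36 = -1/90; the substitution
      y = pi x then brings in pi^4.\<close>
    have "((\<lambda>y::real. (1 - sin y * sinh y / y\<^sup>2) / y ^ 4) \<longlongrightarrow> 1 / 90) (at_right 0)"
      unfolding sinh_field_def by real_asymp
    moreover have "filterlim (\<lambda>x. pi * x) (at_right 0) (at_right 0)" by real_asymp
    ultimately have "((\<lambda>x. (1 - sin (pi * x) * sinh (pi * x) / (pi * x)\<^sup>2) / (pi * x) ^ 4) \<longlongrightarrow> 1 / 90) (at_right 0)"
      by (rule filterlim_compose)
    from tendsto_mult_left[OF this, of "pi ^ 4"] show ?thesis
      by (simp add: g_def power_mult_distrib[of pi _ 4])
  qed
  ultimately show ?thesis by (intro tendsto_unique[OF _ _ ]) auto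
qed

(* Accumulates in the argument a so that the simplifier only ever sees ground numerals. *)
function div_sum :: "nat \<Rightarrow> nat \<Rightarrow> nat \<Rightarrow> nat \<Rightarrow> nat" where
  "div_sum s m M a = (if m > M then a else div_sum s (m + 1) M (a + 10 ^ 12 div m ^ s))"
  by auto
termination by (relation "Wellfounded.measure (\<lambda>(s, m, M, a). Suc M - m)") auto

declare div_sum.simps [simp del]

lemma div_sum_eq: "div_sum s m M a = a + (\<Sum>i=m..M. 10 ^ 12 div i ^ s)"
proof (induction s m M a rule: div_sum.induct)
  case (1 s m M a)
  show ?case
  proof (cases "m > M")
    case False
    then have "(\<Sum>i=m..M. 10 ^ 12 div i ^ s) = 10 ^ 12 div m ^ s + (\<Sum>i=m + 1..M. 10 ^ 12 div i ^ s)"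
      by (subst sum.atLeast_Suc_atMost) auto
    then show ?thesis using 1 False by (subst div_sum.simps) simp
  qed (simp add: div_sum.simps)
qed

text \<open>Fixed-point arithmetic with twelve decimals. The sum starts at 2 because the first term
  of the series is exactly 1 and is added separately.\<close>

definition scaled_sum :: "nat \<Rightarrow> nat \<Rightarrow> nat" where
  "scaled_sum s M = div_sum s 2 M 0"

text \<open>Each integer quotient loses less than one unit, so all of them together lose at most
  \<open>M\<close> units of 10^-12.\<close>

lemma scaled_sum_bounds:
  "real (scaled_sum s M) / 10 ^ 12 \<le> (\<Sum>m=2..M. 1 / real m ^ s)"
  "(\<Sum>m=2..M. 1 / real m ^ s) \<le> (real (scaled_sum s M) + M) / 10 ^ 12"
proof -
  have eq: "real (scaled_sum s M) = (\<Sum>m=2..M. real (10 ^ 12 div m ^ s))"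
    by (simp add: scaled_sum_def div_sum_eq)
  have bd: "real (10 ^ 12 div m ^ s) \<le> 10 ^ 12 * (1 / real m ^ s)"
     "10 ^ 12 * (1 / real m ^ s) \<le> real (10 ^ 12 div m ^ s) + 1" if "m \<in> {2..M}" for m
  proof -
    show "real (10 ^ 12 div m ^ s) \<le> 10 ^ 12 * (1 / real m ^ s)"
      using of_nat_div_le_of_nat[where 'a = real, of "10 ^ 12" "m ^ s"] by simp
    show "10 ^ 12 * (1 / real m ^ s) \<le> real (10 ^ 12 div m ^ s) + 1"
    proof -
      have "x / y \<le> of_int \<lfloor>x / y\<rfloor> + 1" for x y :: real by linarith
      from this[of "real (10 ^ 12)" "real (m ^ s)"] show ?thesis
        unfolding floor_divide_of_nat_eq by simp
    qed
  qed
  have "(\<Sum>m=2..M. real (10 ^ 12 div m ^ s)) \<le> (\<Sum>m=2..M. 10 ^ 12 * (1 / real m ^ s))"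
    by (intro sum_mono bd)
  then show "real (scaled_sum s M) / 10 ^ 12 \<le> (\<Sum>m=2..M. 1 / real m ^ s)"
    unfolding eq sum_distrib_left[symmetric] by simp
  have "(\<Sum>m=2..M. 10 ^ 12 * (1 / real m ^ s)) \<le> (\<Sum>m=2..M. real (10 ^ 12 div m ^ s) + 1)"
    by (intro sum_mono bd)
  also have "\<dots> \<le> real (scaled_sum s M) + M" unfolding eq by (simp add: sum.distrib)
  finally show "(\<Sum>m=2..M. 1 / real m ^ s) \<le> (real (scaled_sum s M) + M) / 10 ^ 12"
    unfolding sum_distrib_left[symmetric] by simp
qed

text \<open>A discrete form of comparing 1/x^(t+1) with its integral. Both parts are Bernoulli's
  inequality for a ratio of consecutive powers, at -1/(m+1) and at 1/m.\<close>

lemma inverse_power_telescope: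
  assumes "m \<ge> 1"
  shows "1 / real m ^ t - 1 / real (Suc m) ^ t \<le> real t / real m ^ Suc t"
    "real t / real (Suc m) ^ Suc t \<le> 1 / real m ^ t - 1 / real (Suc m) ^ t"
proof -
  have m: "real m > 0" using assms by simp
  have "1 + real t * (- 1 / real (Suc m)) \<le> (1 + (- 1 / real (Suc m))) ^ t"
    by (rule Bernoulli_inequality) simp
  also have "1 + (- 1 / real (Suc m)) = real m / real (Suc m)" by (simp add: field_simps)
  finally have "1 - real m ^ t / real (Suc m) ^ t \<le> real t / real (Suc m)"
    by (simp add: power_divide)
  also have "\<dots> \<le> real t / real m" using m by (intro divide_left_mono) auto
  finally have "(1 - real m ^ t / real (Suc m) ^ t) / real m ^ t \<le> real t / real m / real m ^ t"
    by (intro divide_right_mono) auto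
  then show "1 / real m ^ t - 1 / real (Suc m) ^ t \<le> real t / real m ^ Suc t"
    using m by (simp add: diff_divide_distrib)
  have "1 + real t * (1 / real m) \<le> (1 + 1 / real m) ^ t"
    by (rule Bernoulli_inequality) (use m in \<open>simp add: order_trans[of _ 0]\<close>)
  also have "1 + 1 / real m = real (Suc m) / real m" using m by (simp add: field_simps)
  finally have "real t / real m \<le> real (Suc m) ^ t / real m ^ t - 1"
    by (simp add: power_divide)
  moreover have "real t / real (Suc m) \<le> real t / real m" using m by (intro divide_left_mono) auto
  ultimately have "real t / real (Suc m) / real (Suc m) ^ t \<le> (real (Suc m) ^ t / real m ^ t - 1) / real (Suc m) ^ t"
    by (intro divide_right_mono) auto
  then show "real t / real (Suc m) ^ Suc t \<le> 1 / real m ^ t - 1 / real (Suc m) ^ t"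
    by (simp add: diff_divide_distrib del: of_nat_Suc)
qed

text \<open>The tail beyond \<open>M\<close> lies between telescoping sums started at M + 1 and at
  M. Their gap is of order M^-s, which is why \<open>zeta_table\<close> can use ever fewer terms as
  s grows.\<close>

lemma zeta_enclosure:
  assumes s: "s \<ge> 2" and M: "M \<ge> 1"
  shows "1 + real (scaled_sum s M) / 10 ^ 12 + 1 / (real (s - 1) * real (Suc M) ^ (s - 1)) \<le> zeta (real s)" (is ?lo)
    and "zeta (real s) \<le> 1 + (real (scaled_sum s M) + M) / 10 ^ 12 + 1 / (real (s - 1) * real M ^ (s - 1))" (is ?hi)
proof -
  have combine: "1 + a + c \<le> z" if "c \<le> z - (1 + b)" "a \<le> b" for a b c z :: real using that by linarith
  have combine': "z \<le> 1 + a + c" if "z - (1 + b) \<le> c" "b \<le> a" for a b c z :: real using that by linarith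
  obtain t where t: "s = Suc t" "t \<ge> 1" using s by (cases s) auto
  have tail: "(\<lambda>m. 1 / real (Suc (m + M)) ^ s) sums (zeta (real s) - (\<Sum>m<M. 1 / real (Suc m) ^ s))"
    using sums_split_initial_segment[OF zeta_sums[OF s], of M] by simp
  have head: "(\<Sum>m<M. 1 / real (Suc m) ^ s) = 1 + (\<Sum>m=2..M. 1 / real m ^ s)"
  proof -
    have "(\<Sum>m<M. 1 / real (Suc m) ^ s) = (\<Sum>m=1..M. 1 / real m ^ s)"
      by (rule sum.reindex_bij_witness[of _ "\<lambda>n. n - 1" Suc]) auto
    then show ?thesis using M by (subst (asm) sum.atLeast_Suc_atMost) (auto simp: numeral_2_eq_2)
  qed
  have tele: "(\<lambda>m. 1 / t * (1 / real (m + N) ^ t - 1 / real (Suc m + N) ^ t)) sums (1 / t * (1 / real (0 + N) ^ t - 0))" for N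
  proof (intro sums_mult telescope_sums')
    show "(\<lambda>m. 1 / real (m + N) ^ t) \<longlonglongrightarrow> 0" using t(2) by real_asymp
  qed
  have "1 / t * (1 / real (0 + Suc M) ^ t - 0) \<le> zeta (real s) - (\<Sum>m<M. 1 / real (Suc m) ^ s)"
  proof (rule sums_le[OF _ tele tail])
    fix m
    have "1 / real (m + Suc M) ^ t - 1 / real (Suc m + Suc M) ^ t \<le> real t / real (m + Suc M) ^ Suc t"
      using inverse_power_telescope(1)[of "m + Suc M" t] by simp
    then show "1 / t * (1 / real (m + Suc M) ^ t - 1 / real (Suc m + Suc M) ^ t) \<le> 1 / real (Suc (m + M)) ^ s"
      using t by (simp add: field_simps del: power_Suc)
  qed
  moreover have "1 / t * (1 / real (0 + Suc M) ^ t - 0) = 1 / (real (s - 1) * real (Suc M) ^ (s - 1))"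
    by (simp add: t)
  ultimately have "1 / (real (s - 1) * real (Suc M) ^ (s - 1)) \<le> zeta (real s) - (1 + (\<Sum>m=2..M. 1 / real m ^ s))"
    unfolding head by (simp only:)
  then show ?lo by (rule combine[OF _ scaled_sum_bounds(1)])
  have "zeta (real s) - (\<Sum>m<M. 1 / real (Suc m) ^ s) \<le> 1 / t * (1 / real (0 + M) ^ t - 0)"
  proof (rule sums_le[OF _ tail tele])
    fix m
    have "real t / real (Suc m + M) ^ Suc t \<le> 1 / real (m + M) ^ t - 1 / real (Suc m + M) ^ t"
      using inverse_power_telescope(2)[of "m + M" t] M by simp
    then show "1 / real (Suc (m + M)) ^ s \<le> 1 / t * (1 / real (m + M) ^ t - 1 / real (Suc m + M) ^ t)"
      using t by (simp add: field_simps del: power_Suc)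
  qed
  moreover have "1 / t * (1 / real (0 + M) ^ t - 0) = 1 / (real (s - 1) * real M ^ (s - 1))"
    by (simp add: t)
  ultimately have "zeta (real s) - (1 + (\<Sum>m=2..M. 1 / real m ^ s)) \<le> 1 / (real (s - 1) * real M ^ (s - 1))"
    unfolding head by (simp only:)
  then show ?hi by (rule combine'[OF _ scaled_sum_bounds(2)])
qed

(* An entry (s, M, lo, hi) stands for lo <= 10^10 zeta(s) <= hi, obtained from the first M terms. *)
definition zeta_table :: "(nat \<times> nat \<times> nat \<times> nat) list" where
  "zeta_table =
    [(4, 50, 10823231588, 10823233127), (5, 30, 10369277371, 10369277752),
     (6, 20, 10173430558, 10173430695), (7, 12, 10083492687, 10083492900),
     (8, 10, 10040773535, 10040773606), (9, 8, 10020083913, 10020083959),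
     (10, 7, 10009945745, 10009945765), (11, 6, 10004941882, 10004941896),
     (12, 6, 10002460865, 10002460868), (13, 5, 10001227132, 10001227137),
     (14, 5, 10000612481, 10000612482), (15, 4, 10000305882, 10000305885)]"

lemma scaled_sum_values:
  "scaled_sum 4 50 = 82320645961"
  "scaled_sum 5 30 = 36927466495"
  "scaled_sum 6 20 = 17343006900"
  "scaled_sum 7 12 = 8349234171"
  "scaled_sum 8 10 = 4077346253"
  "scaled_sum 9 8 = 2008388419"
  "scaled_sum 10 7 = 994573739"
  "scaled_sum 11 6 = 494187933"
  "scaled_sum 12 6 = 246086460"
  "scaled_sum 13 5 = 122713257"
  "scaled_sum 14 5 = 61248119"
  "scaled_sum 15 4 = 30588200"
  by (simp_all add: scaled_sum_def div_sum.simps[of _ "numeral x" for x])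

lemma zeta_table: "list_all (\<lambda>(s, M, lo, hi). real lo / 10 ^ 10 \<le> zeta (real s) \<and> zeta (real s) \<le> real hi / 10 ^ 10) zeta_table"
proof -
  have *: "real lo / 10 ^ 10 \<le> zeta (real s) \<and> zeta (real s) \<le> real hi / 10 ^ 10"
    if "s \<ge> 2" "M \<ge> 1"
      "real lo / 10 ^ 10 \<le> 1 + real (scaled_sum s M) / 10 ^ 12 + 1 / (real (s - 1) * real (Suc M) ^ (s - 1))"
      "1 + (real (scaled_sum s M) + M) / 10 ^ 12 + 1 / (real (s - 1) * real M ^ (s - 1)) \<le> real hi / 10 ^ 10"
    for s M lo hi
    using zeta_enclosure[OF that(1,2)] that(3,4) by (meson order_trans)
  have "list_all (\<lambda>(s, M, lo, hi). s \<ge> 2 \<and> M \<ge> 1 \<and>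
      real lo / 10 ^ 10 \<le> 1 + real (scaled_sum s M) / 10 ^ 12 + 1 / (real (s - 1) * real (Suc M) ^ (s - 1)) \<and>
      1 + (real (scaled_sum s M) + M) / 10 ^ 12 + 1 / (real (s - 1) * real M ^ (s - 1)) \<le> real hi / 10 ^ 10) zeta_table"
    by (simp add: zeta_table_def scaled_sum_values)
  then show ?thesis by (rule list.pred_mono_strong) (use * in blast)
qed

lemma zeta_table_prod:
  fixes f :: "nat \<Rightarrow> real"
  shows "(\<Prod>i<12. f (i + 4)) = prod_list (map (\<lambda>(s, _). f s) zeta_table)"
proof -
  have "(\<Prod>i<12. f (i + 4)) = (\<Prod>i\<in>{4..<16}. f i)"
    by (rule prod.reindex_bij_witness[of _ "\<lambda>i. i - 4" "\<lambda>i. i + 4"]) auto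
  also have "{4..<16} = set [4..<16::nat]" by (simp only: set_upt)
  also have "(\<Prod>i\<in>set [4..<16]. f i) = prod_list (map f [4..<16])" by (rule prod.distinct_set_conv_list) simp
  also have "map f [4..<16] = map (\<lambda>(s, _). f s) zeta_table" by (simp add: zeta_table_def)
  finally show ?thesis .
qed

lemma prod_list_mono:
  fixes f g :: "'a \<Rightarrow> real"
  assumes "\<And>x. x \<in> set xs \<Longrightarrow> 0 \<le> f x \<and> f x \<le> g x"
  shows "prod_list (map f xs) \<le> prod_list (map g xs)"
proof -
  have "0 \<le> prod_list (map f xs) \<and> prod_list (map f xs) \<le> prod_list (map g xs)"
    using assms
  proof (induction xs)
    case (Cons a xs)
    then have "0 \<le> f a" "f a \<le> g a" "0 \<le> prod_list (map f xs)" "prod_list (map f xs) \<le> prod_list (map g xs)"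
      by auto
    then show ?case by (auto intro: mult_mono order_trans)
  qed auto
  then show ?thesis by blast
qed

lemma zeta_table_prod_bounds:
  "prod_list (map (\<lambda>(s, M, lo, hi). real lo / 10 ^ 10) zeta_table) \<le> (\<Prod>i<12. zeta (real (i + 4)))"
  "(\<Prod>i<12. zeta (real (i + 4))) \<le> prod_list (map (\<lambda>(s, M, lo, hi). real hi / 10 ^ 10) zeta_table)"
proof -
  have z: "(\<Prod>i<12. zeta (real (i + 4))) = prod_list (map (\<lambda>(s, _). zeta (real s)) zeta_table)"
    by (rule zeta_table_prod[of "\<lambda>s. zeta (real s)"])
  show "prod_list (map (\<lambda>(s, M, lo, hi). real lo / 10 ^ 10) zeta_table) \<le> (\<Prod>i<12. zeta (real (i + 4)))"
    unfolding z by (rule prod_list_mono) (use zeta_table in \<open>fastforce simp: list_all_iff\<close>)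
  show "(\<Prod>i<12. zeta (real (i + 4))) \<le> prod_list (map (\<lambda>(s, M, lo, hi). real hi / 10 ^ 10) zeta_table)"
    unfolding z
  proof (rule prod_list_mono)
    fix x assume x: "x \<in> set zeta_table"
    obtain s M lo hi where [simp]: "x = (s, M, lo, hi)" by (cases x)
    have "real lo / 10 ^ 10 \<le> zeta (real s)" "zeta (real s) \<le> real hi / 10 ^ 10"
      using zeta_table x by (auto simp: list_all_iff)
    moreover have "0 \<le> real lo / 10 ^ 10" by simp
    ultimately show "0 \<le> (case x of (s, _) \<Rightarrow> zeta (real s)) \<and>
        (case x of (s, _) \<Rightarrow> zeta (real s)) \<le> (case x of (s, M, lo, hi) \<Rightarrow> real hi / 10 ^ 10)"
      by simp
  qed
qed

text \<open>By telescoping, the terms from 4 on add up to at most 1/((s-1) 3^(s-1)), which is at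
  most 3^-s because s - 1 >= 3. Together with the term at 3 this gives 2 / 3^s.\<close>

lemma zeta_tail_bounds:
  assumes "s \<ge> 4"
  shows "1 + 1 / 2 ^ s \<le> zeta (real s)" "zeta (real s) \<le> 1 + (1 / 2 ^ s + 2 / 3 ^ s)"
proof -
  have s: "s \<ge> 2" using assms by simp
  have tail: "(\<Sum>m<2. 1 / real (Suc m) ^ s) \<le> zeta (real s)"
    unfolding zeta_of_nat by (rule sum_le_suminf[OF summable_zeta[OF s]]) auto
  then show "1 + 1 / 2 ^ s \<le> zeta (real s)" by (simp add: numeral_2_eq_2)
  obtain t where t: "s = Suc t" "t \<ge> 3" using assms by (cases s) auto
  have "(\<lambda>m. 1 / real (Suc (m + 2)) ^ s) sums (zeta (real s) - (\<Sum>m<2. 1 / real (Suc m) ^ s))"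
    using sums_split_initial_segment[OF zeta_sums[OF s], of 2] by simp
  then have tail: "(\<lambda>m. 1 / real (Suc (Suc m + 2)) ^ s) sums (zeta (real s) - (\<Sum>m<2. 1 / real (Suc m) ^ s) - 1 / 3 ^ s)"
    by (subst sums_Suc_iff) simp
  have tele: "(\<lambda>m. 1 / t * (1 / real (m + 3) ^ t - 1 / real (Suc m + 3) ^ t)) sums (1 / t * (1 / real (0 + 3) ^ t - 0))"
  proof (intro sums_mult telescope_sums')
    show "(\<lambda>m. 1 / real (m + 3) ^ t) \<longlonglongrightarrow> 0" using t(2) by real_asymp
  qed
  have "zeta (real s) - (\<Sum>m<2. 1 / real (Suc m) ^ s) - 1 / 3 ^ s \<le> 1 / t * (1 / real (0 + 3) ^ t - 0)"
  proof (rule sums_le[OF _ tail tele])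
    fix m
    have "real t / real (Suc m + 3) ^ Suc t \<le> 1 / real (m + 3) ^ t - 1 / real (Suc m + 3) ^ t"
      using inverse_power_telescope(2)[of "m + 3" t] by simp
    then show "1 / real (Suc (Suc m + 2)) ^ s \<le> 1 / t * (1 / real (m + 3) ^ t - 1 / real (Suc m + 3) ^ t)"
      using t by (simp add: field_simps del: power_Suc)
  qed
  also have "1 / t * (1 / real (0 + 3) ^ t - 0) \<le> 1 / 3 ^ s"
    using t by (simp add: divide_simps)
  finally show "zeta (real s) \<le> 1 + (1 / 2 ^ s + 2 / 3 ^ s)" by (simp add: numeral_2_eq_2)
qed

text \<open>The first twelve factors, zeta(4) to zeta(15), are left to the table. Over s >= 16 the
  bounds 2^-s and 2 / 3^s sum to 2^-15 and 3^-15, whence the constants; the upper bound is 1 + x <=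
  exp x followed by exp d <= 1/(1 - d).\<close>

lemma prod_zeta_bounds:
  defines "P \<equiv> prodinf (\<lambda>i. zeta (real (i + 4)))"
  shows "(\<Prod>i<12. zeta (real (i + 4))) * (1 + 1 / 2 ^ 15 - 1 / 2 ^ 24) \<le> P"
    and "P \<le> (\<Prod>i<12. zeta (real (i + 4))) / (1 - (1 / 2 ^ 15 + 1 / 3 ^ 15))"
proof -
  let ?z = "\<lambda>i. zeta (real (i + 4))"
  let ?Q = "\<Prod>i<12. ?z i"
  let ?d = "1 / 2 ^ 15 + 1 / 3 ^ 15 :: real"
  have z1: "1 \<le> ?z i" for i using zeta_gt_1[of "i + 4"] by linarith
  have hp: "?z has_prod P" unfolding P_def by (rule convergent_prod_has_prod[OF convergent_prod_zeta])
  have z0: "0 \<le> ?z i" for i using z1[of i] by linarith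
  have Qpos: "?Q \<ge> 0" by (intro prod_nonneg z0)
  have split: "(\<Prod>i<n. ?z i) = ?Q * (\<Prod>i\<in>{12..<n}. ?z i)" if "n \<ge> 12" for n
  proof -
    have "{..<n} = {..<12} \<union> {12..<n}" using that by auto
    then show ?thesis by (simp add: prod.union_disjoint ivl_disj_int_one)
  qed
  have "n \<ge> 12 \<Longrightarrow> 1 + 1 / 2 ^ 15 - 1 / 2 ^ (n + 3) \<le> (\<Prod>i\<in>{12..<n}. ?z i)" for n
  proof (induction n rule: dec_induct)
    case (step n)
    define b :: real where "b = 1 / 2 ^ (n + 3)"
    have "(2::real) ^ 15 \<le> 2 ^ (n + 3)" using step.hyps by (intro power_increasing) auto
    then have b: "b \<le> 1 / 2 ^ 15" "b \<ge> 0" unfolding b_def by (simp_all add: divide_simps)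
    have "1 + b / 2 \<le> ?z n" using zeta_tail_bounds(1)[of "n + 4"] by (simp add: b_def power_add)
    moreover have "0 \<le> 1 + 1 / 2 ^ 15 - b" using b by simp
    ultimately have "(1 + 1 / 2 ^ 15 - b) * (1 + b / 2) \<le> (\<Prod>i\<in>{12..<n}. ?z i) * ?z n"
      using step.IH b by (intro mult_mono) (auto simp: b_def)
    moreover have "(1 + 1 / 2 ^ 15 - b) * (1 + b / 2) = 1 + 1 / 2 ^ 15 - b / 2 + b / 2 * (1 / 2 ^ 15 - b)"
      by (simp add: algebra_simps)
    moreover have "b / 2 * (1 / 2 ^ 15 - b) \<ge> 0" using b by (intro mult_nonneg_nonneg) auto
    moreover have "1 / 2 ^ (Suc n + 3) = b / 2" by (simp only: b_def add_Suc power_Suc) simp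
    ultimately show ?case using step.hyps by (simp only: prod.atLeastLessThan_Suc)
  qed simp
  \<comment> \<open>Nine more factors, s = 16 to 24, leave a defect of 2^-24, well below the
    required precision.\<close>
  from this[of 21] have "?Q * (1 + 1 / 2 ^ 15 - 1 / 2 ^ 24) \<le> ?Q * (\<Prod>i\<in>{12..<21}. ?z i)"
    using Qpos by (intro mult_left_mono) simp_all
  also have "\<dots> = (\<Prod>i<21. ?z i)" by (rule split[symmetric]) simp
  also have "\<dots> \<le> P"
    using prod_le_prodinf[OF hp, of 21] z1 z0 unfolding P_def by blast
  finally show "?Q * (1 + 1 / 2 ^ 15 - 1 / 2 ^ 24) \<le> P" .
  have tail: "(\<Prod>i\<in>{12..<n}. ?z i) \<le> 1 / (1 - ?d)" for n
  proof -
    define e where "e = (\<lambda>i. 1 / 2 ^ (i + 4) + 2 / 3 ^ (i + 4) :: real)"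
    have "(\<Prod>i\<in>{12..<n}. ?z i) \<le> (\<Prod>i\<in>{12..<n}. 1 + e i)"
    proof (intro prod_mono conjI)
      fix i
      show "0 \<le> ?z i" by (rule z0)
      show "?z i \<le> 1 + e i" unfolding e_def by (rule zeta_tail_bounds(2)) simp
    qed
    also have "\<dots> \<le> exp (\<Sum>i\<in>{12..<n}. e i)"
      by (rule prod_le_exp_sum) (simp add: e_def)
    also have "(\<Sum>i\<in>{12..<n}. e i) \<le> ?d"
    proof (cases "n \<ge> 12")
      case True
      then have "(\<Sum>i\<in>{12..<n}. e i) = ?d - (1 / 2 ^ (n + 3) + 1 / 3 ^ (n + 3))"
      proof (induction n rule: dec_induct)
        case (step k)
        have "e k = 1 / 2 ^ (k + 3) + 1 / 3 ^ (k + 3) - (1 / 2 ^ (Suc k + 3) + 1 / 3 ^ (Suc k + 3))"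
          by (simp add: e_def power_add divide_simps)
        then show ?case using step by (simp del: power_Suc)
      qed simp
      moreover have "0 \<le> 1 / 2 ^ (n + 3) + (1 / 3 ^ (n + 3) :: real)" by (intro add_nonneg_nonneg) simp_all
      ultimately show ?thesis by linarith
    qed simp
    then have "exp (\<Sum>i\<in>{12..<n}. e i) \<le> exp ?d" by simp
    also have "exp ?d \<le> 1 / (1 - ?d)"
    proof -
      have "1 - ?d \<le> exp (- ?d)" using exp_ge_add_one_self[of "- ?d"] by simp
      moreover have "0 < 1 - ?d" by simp
      ultimately show ?thesis by (simp add: exp_minus field_simps)
    qed
    finally show ?thesis .
  qed
  show "P \<le> ?Q / (1 - ?d)"
  proof (rule LIMSEQ_le_const2)
    show "(\<lambda>n. \<Prod>i\<le>n. ?z i) \<longlonglongrightarrow> P"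
      unfolding P_def by (rule convergent_prod_LIMSEQ[OF convergent_prod_zeta])
    have "(\<Prod>i\<le>n. ?z i) \<le> ?Q / (1 - ?d)" if "n \<ge> 12" for n
    proof -
      have "(\<Prod>i\<le>n. ?z i) = ?Q * (\<Prod>i\<in>{12..<Suc n}. ?z i)"
        using split[of "Suc n"] that by (simp add: lessThan_Suc_atMost)
      also have "\<dots> \<le> ?Q * (1 / (1 - ?d))" by (intro mult_left_mono tail Qpos)
      finally show ?thesis by simp
    qed
    then show "\<exists>N. \<forall>n\<ge>N. (\<Prod>i\<le>n. ?z i) \<le> ?Q / (1 - ?d)" by blast
  qed
qed

text \<open>The tolerance is half a unit of the sixth decimal. Since a reciprocal is to be located,
  zeta(6) times the product is enclosed between 1/0.8469365 and 1/0.8469355.\<close>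

lemma Z_limit_approx: "\<bar>1 / (zeta 6 * prodinf (\<lambda>i. zeta (real (i + 4)))) - 0.846936\<bar> \<le> 5 / 10 ^ 7"
proof -
  let ?P = "prodinf (\<lambda>i. zeta (real (i + 4)))"
  define L where "L = prod_list (map (\<lambda>(s, M, lo, hi). real lo / 10 ^ 10) zeta_table)"
  define H where "H = prod_list (map (\<lambda>(s, M, lo, hi). real hi / 10 ^ 10) zeta_table)"
  have 6: "10173430558 / 10 ^ 10 \<le> zeta 6" "zeta 6 \<le> 10173430695 / 10 ^ 10"
    using zeta_table by (simp_all add: zeta_table_def)
  have lo: "L * (1 + 1 / 2 ^ 15 - 1 / 2 ^ 24) \<le> ?P"
    using zeta_table_prod_bounds(1) unfolding L_def
    by (intro order_trans[OF mult_right_mono prod_zeta_bounds(1)]) auto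
  have hi: "?P \<le> H / (1 - (1 / 2 ^ 15 + 1 / 3 ^ 15))"
    using zeta_table_prod_bounds(2) unfolding H_def
    by (intro order_trans[OF prod_zeta_bounds(2) divide_right_mono]) auto
  have "1 / 0.8469365 \<le> 10173430558 / 10 ^ 10 * (L * (1 + 1 / 2 ^ 15 - 1 / 2 ^ 24))"
    unfolding L_def by (simp add: zeta_table_def)
  also have "\<dots> \<le> zeta 6 * ?P"
  proof (intro mult_mono 6 lo)
    show "0 \<le> L * (1 + 1 / 2 ^ 15 - 1 / 2 ^ 24)" unfolding L_def by (simp add: zeta_table_def)
  qed (use 6 in simp)
  finally have lower: "1 / 0.8469365 \<le> zeta 6 * ?P" .
  have "zeta 6 * ?P \<le> 10173430695 / 10 ^ 10 * (H / (1 - (1 / 2 ^ 15 + 1 / 3 ^ 15)))"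
  proof (intro mult_mono 6 hi)
    show "0 \<le> ?P" by (rule order_trans[OF _ lo]) (simp add: L_def zeta_table_def)
  qed simp
  also have "\<dots> \<le> 1 / 0.8469355" unfolding H_def by (simp add: zeta_table_def)
  finally have upper: "zeta 6 * ?P \<le> 1 / 0.8469355" .
  have "zeta 6 * ?P > 0" using lower by (rule less_le_trans[rotated]) simp
  then have "1 / (zeta 6 * ?P) \<le> 0.8469365" "0.8469355 \<le> 1 / (zeta 6 * ?P)"
    using lower upper by (simp_all add: field_simps)
  moreover have "\<bar>x - 0.846936\<bar> \<le> 5 / 10 ^ 7" if "x \<le> 0.8469365" "0.8469355 \<le> x" for x :: real
    using that unfolding abs_le_iff by simp
  ultimately show ?thesis by blast
qed

lemma ninety_div_pi_pow4_approx: "\<bar>90 / pi ^ 4 - 0.923938\<bar> \<le> 5 / 10 ^ 7"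
proof -
  have "90 / pi ^ 4 = 1 / zeta 4" by (simp add: zeta_4)
  moreover have "10823231588 / 10 ^ 10 \<le> zeta 4" "zeta 4 \<le> 10823233127 / 10 ^ 10"
    using zeta_table by (simp_all add: zeta_table_def)
  ultimately show ?thesis by (simp add: abs_le_iff divide_simps)
qed

section \<open>Limit density\<close>

text \<open>Span and rank go through the induction together, because the rank of a longer list
  refers to the span of the shorter one.\<close>

lemma rk_cong:
  assumes "list_all2 (\<lambda>v v'. \<forall>j. [v j = v' j] (mod int p)) vs vs'"
  shows "latt p vs = latt p vs' \<and> rk p vs = rk p vs'"
  using assms
proof (induction rule: list_all2_induct)
  case (Cons v vs v' vs')
  have sub: "latt p (u # us) \<subseteq> latt p (u' # us')"
    if "latt p us = latt p us'" "\<forall>j. [u j = u' j] (mod int p)" for u u' :: "nat \<Rightarrow> int" and us us'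
  proof
    fix x assume "x \<in> latt p (u # us)"
    then obtain w c where w: "w \<in> latt p us" "x = (\<lambda>j. w j + c * u j)" by auto
    show "x \<in> latt p (u' # us')"
    proof (rule latt_cong)
      show "(\<lambda>j. w j + c * u' j) \<in> latt p (u' # us')" using w(1) that(1) by (intro latt_ConsI) simp
      show "[w j + c * u' j = x j] (mod int p)" for j
        unfolding w(2) using that(2) by (intro cong_add cong_mult cong_refl) (simp add: cong_sym)
    qed
  qed
  have "latt p (v # vs) = latt p (v' # vs')"
    using sub[of vs vs' v v'] sub[of vs' vs v' v] Cons by (auto simp: cong_sym)
  moreover have "v \<in> latt p vs \<longleftrightarrow> v' \<in> latt p vs'"
    using Cons latt_cong[of v p vs v'] latt_cong[of v' p vs v] by (auto simp: cong_sym)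
  ultimately show ?case using Cons by simp
qed simp

section \<open>Densities of predicates that depend on residues only\<close>

abbreviation fun_box :: "'i set \<Rightarrow> int set \<Rightarrow> ('i \<Rightarrow> int) set" where
  "fun_box I A \<equiv> PiE_dflt I 0 (\<lambda>_. A)"

definition periodic :: "nat \<Rightarrow> (('i \<Rightarrow> int) \<Rightarrow> bool) \<Rightarrow> bool" where
  "periodic N Q \<longleftrightarrow> (\<forall>f g. (\<forall>i. [f i = g i] (mod int N)) \<longrightarrow> Q f = Q g)"

lemma fun_box_mod: "f \<in> fun_box I A \<Longrightarrow> N > 0 \<Longrightarrow> (\<lambda>i. f i mod int N) \<in> fun_box I {0..<int N}"
  by (auto simp: PiE_dflt_def)

lemma periodic_mod: "periodic N Q \<Longrightarrow> Q (\<lambda>i. f i mod int N) = Q f"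
  unfolding periodic_def by (rule allE, assumption, rule allE, assumption) (auto simp: cong_def)

lemma residue_density:
  assumes N: "N > 0"
  shows "(\<lambda>k. real (card {x \<in> {- int k..int k}. x mod int N = r mod int N}) / (2 * real k + 1)) \<longlonglongrightarrow> 1 / N"
proof -
  let ?c = "\<lambda>k. real (card {x \<in> {- int k..int k}. x mod int N = r mod int N})"
  have "\<bar>?c k / (2 * real k + 1) - 1 / N\<bar> \<le> 1 / (2 * real k + 1)" for k
  proof -
    have "{- int k..int k} = {- int k..<int k + 1}" by auto
    moreover have "real_of_int (int k + 1 - - int k) = 2 * real k + 1" by simp
    moreover have "- int k \<le> int k + 1" by simp
    ultimately have "\<bar>?c k - (2 * real k + 1) / N\<bar> \<le> 1"
      using card_residue_class[OF N, of "- int k" "int k + 1" r] by (simp only:)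
    then have "\<bar>?c k - (2 * real k + 1) / N\<bar> / (2 * real k + 1) \<le> 1 / (2 * real k + 1)"
      by (intro divide_right_mono) auto
    also have "\<bar>?c k - (2 * real k + 1) / N\<bar> / (2 * real k + 1) = \<bar>?c k / (2 * real k + 1) - 1 / N\<bar>"
    proof -
      have "?c k / (2 * real k + 1) - 1 / N = (?c k - (2 * real k + 1) / N) / (2 * real k + 1)"
        by (simp add: diff_divide_distrib)
      then show ?thesis by (simp add: abs_divide)
    qed
    finally show ?thesis .
  qed
  then have "\<forall>\<^sub>F k in sequentially. norm (?c k / (2 * real k + 1) - 1 / N) \<le> 1 / (2 * real k + 1)"
    by (intro always_eventually allI) (simp only: real_norm_def)
  moreover have "(\<lambda>k. 1 / (2 * real k + 1)) \<longlonglongrightarrow> 0" by real_asymp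
  ultimately have "(\<lambda>k. ?c k / (2 * real k + 1) - 1 / N) \<longlonglongrightarrow> 0"
    by (rule Lim_null_comparison)
  then show ?thesis by (simp add: LIM_zero_iff)
qed

text \<open>The box splits by residue vectors into products of residue classes, each class having
  density 1/N in its coordinate. Only finitely many residue vectors occur, so the limit is taken
  termwise.\<close>

lemma periodic_density:
  assumes I: "finite I" and N: "N > 0" and Q: "periodic N Q"
  shows "(\<lambda>k. real (card {f \<in> fun_box I {- int k..int k}. Q f}) / (2 * real k + 1) ^ card I)
    \<longlonglongrightarrow> real (card {f \<in> fun_box I {0..<int N}. Q f}) / real N ^ card I"
proof -
  let ?G = "{g \<in> fun_box I {0..<int N}. Q g}"
  let ?fib = "\<lambda>k g. PiE_dflt I 0 (\<lambda>i. {x \<in> {- int k..int k}. x mod int N = g i mod int N})"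
  have finG: "finite ?G" using I by (auto intro: finite_subset[OF _ finite_PiE_dflt])
  have card: "card {f \<in> fun_box I {- int k..int k}. Q f} = (\<Sum>g\<in>?G. \<Prod>i\<in>I. card {x \<in> {- int k..int k}. x mod int N = g i mod int N})" for k
  proof -
    have U: "{f \<in> fun_box I {- int k..int k}. Q f} = (\<Union>g\<in>?G. ?fib k g)"
    proof (intro equalityI subsetI)
      fix f assume f: "f \<in> {f \<in> fun_box I {- int k..int k}. Q f}"
      have "(\<lambda>i. f i mod int N) \<in> ?G" using f fun_box_mod[of f I _ N] N periodic_mod[OF Q] by auto
      moreover have "f \<in> ?fib k (\<lambda>i. f i mod int N)" using f by (auto simp: PiE_dflt_def)
      ultimately show "f \<in> (\<Union>g\<in>?G. ?fib k g)" by blast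
    next
      fix f assume "f \<in> (\<Union>g\<in>?G. ?fib k g)"
      then obtain g where g: "g \<in> ?G" "f \<in> ?fib k g" by blast
      have "[f i = g i] (mod int N)" for i
        using g by (cases "i \<in> I") (auto simp: PiE_dflt_def cong_def)
      then have "Q f = Q g" using Q unfolding periodic_def by blast
      then show "f \<in> {f \<in> fun_box I {- int k..int k}. Q f}" using g by (auto simp: PiE_dflt_def)
    qed
    have "card {f \<in> fun_box I {- int k..int k}. Q f} = (\<Sum>g\<in>?G. card (?fib k g))"
      unfolding U
    proof (rule card_UN_disjoint[OF finG])
      show "\<forall>g\<in>?G. finite (?fib k g)" using I by (auto intro!: finite_PiE_dflt)
      show "\<forall>g\<in>?G. \<forall>h\<in>?G. g \<noteq> h \<longrightarrow> ?fib k g \<inter> ?fib k h = {}"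
      proof (intro ballI impI equals0I)
        fix g h f assume *: "g \<in> ?G" "h \<in> ?G" "g \<noteq> h" "f \<in> ?fib k g \<inter> ?fib k h"
        have "g i = h i" for i
        proof (cases "i \<in> I")
          case True
          then have "g i mod int N = h i mod int N" using *(4) by (auto simp: PiE_dflt_def)
          then show ?thesis using True *(1,2) by (auto simp: PiE_dflt_def)
        qed (use * in \<open>auto simp: PiE_dflt_def\<close>)
        then show False using *(3) by auto
      qed
    qed
    also have "\<dots> = (\<Sum>g\<in>?G. \<Prod>i\<in>I. card {x \<in> {- int k..int k}. x mod int N = g i mod int N})"
    proof (rule sum.cong[OF refl])
      fix g
      show "card (?fib k g) = (\<Prod>i\<in>I. card {x \<in> {- int k..int k}. x mod int N = g i mod int N})"
        by (rule card_PiE_dflt[OF I]) simp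
    qed
    finally show ?thesis .
  qed
  have "(\<lambda>k. \<Sum>g\<in>?G. \<Prod>i\<in>I. real (card {x \<in> {- int k..int k}. x mod int N = g i mod int N}) / (2 * real k + 1))
      \<longlonglongrightarrow> (\<Sum>g\<in>?G. \<Prod>i\<in>I. 1 / real N)"
    by (intro tendsto_sum tendsto_prod residue_density N)
  also have "(\<Sum>g\<in>?G. \<Prod>i\<in>I. 1 / real N) = real (card ?G) / real N ^ card I"
    by (simp add: power_one_over)
  also have "(\<lambda>k. \<Sum>g\<in>?G. \<Prod>i\<in>I. real (card {x \<in> {- int k..int k}. x mod int N = g i mod int N}) / (2 * real k + 1))
      = (\<lambda>k. real (card {f \<in> fun_box I {- int k..int k}. Q f}) / (2 * real k + 1) ^ card I)"
    unfolding card by (simp add: prod_dividef sum_divide_distrib)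
  finally show ?thesis .
qed

lemma card_fun_box: "finite I \<Longrightarrow> finite A \<Longrightarrow> card (fun_box I A) = card A ^ card I"
  by (simp add: card_PiE_dflt)

text \<open>The Chinese remainder theorem in every coordinate. Reduction modulo both numbers is
  injective on the box, and equal cardinalities make it onto.\<close>

lemma periodic_count_coprime:
  assumes I: "finite I" and N: "N1 > 0" "N2 > 0" "coprime N1 N2"
    and Q: "periodic N1 Q1" "periodic N2 Q2"
  shows "card {f \<in> fun_box I {0..<int (N1 * N2)}. Q1 f \<and> Q2 f} =
    card {f \<in> fun_box I {0..<int N1}. Q1 f} * card {f \<in> fun_box I {0..<int N2}. Q2 f}"
proof -
  let ?F = "\<lambda>N. fun_box I {0..<int N}"
  define \<phi> where "\<phi> = (\<lambda>f :: 'a \<Rightarrow> int. (\<lambda>i. f i mod int N1, \<lambda>i. f i mod int N2))"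
  have fin: "finite (?F N)" for N using I by (intro finite_PiE_dflt) auto
  have inj: "inj_on \<phi> (?F (N1 * N2))"
  proof (rule inj_onI)
    fix f g assume fg: "f \<in> ?F (N1 * N2)" "g \<in> ?F (N1 * N2)" "\<phi> f = \<phi> g"
    show "f = g"
    proof
      fix i
      show "f i = g i"
      proof (cases "i \<in> I")
        case True
        have "[f i = g i] (mod int N1)" "[f i = g i] (mod int N2)"
          using fg(3) by (auto simp: \<phi>_def cong_def fun_eq_iff)
        then have "[f i = g i] (mod (int N1 * int N2))"
          using N(3) by (intro coprime_cong_mult) auto
        then show ?thesis using fg True by (auto simp: cong_def PiE_dflt_def)
      qed (use fg in \<open>auto simp: PiE_dflt_def\<close>)
    qed
  qed
  have sub: "\<phi> ` ?F (N1 * N2) \<subseteq> ?F N1 \<times> ?F N2"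
    using N by (auto simp: \<phi>_def intro!: fun_box_mod)
  have surj: "\<phi> ` ?F (N1 * N2) = ?F N1 \<times> ?F N2"
  proof (rule card_subset_eq[OF _ sub])
    show "finite (?F N1 \<times> ?F N2)" using fin by blast
    show "card (\<phi> ` ?F (N1 * N2)) = card (?F N1 \<times> ?F N2)"
      unfolding card_image[OF inj] using I
      by (simp add: card_fun_box card_cartesian_product nat_mult_distrib power_mult_distrib)
  qed
  have img: "\<phi> ` {f \<in> ?F (N1 * N2). Q1 f \<and> Q2 f} = {f \<in> ?F N1. Q1 f} \<times> {f \<in> ?F N2. Q2 f}"
  proof (intro equalityI subsetI)
    fix y assume "y \<in> \<phi> ` {f \<in> ?F (N1 * N2). Q1 f \<and> Q2 f}"
    then obtain f where "f \<in> ?F (N1 * N2)" "Q1 f" "Q2 f" "y = \<phi> f" by blast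
    then show "y \<in> {f \<in> ?F N1. Q1 f} \<times> {f \<in> ?F N2. Q2 f}"
      using sub periodic_mod[OF Q(1), of f] periodic_mod[OF Q(2), of f] by (auto simp: \<phi>_def)
  next
    fix y assume y: "y \<in> {f \<in> ?F N1. Q1 f} \<times> {f \<in> ?F N2. Q2 f}"
    then have "y \<in> \<phi> ` ?F (N1 * N2)" unfolding surj by auto
    then obtain f where "f \<in> ?F (N1 * N2)" "y = \<phi> f" by blast
    then show "y \<in> \<phi> ` {f \<in> ?F (N1 * N2). Q1 f \<and> Q2 f}"
      using y periodic_mod[OF Q(1), of f] periodic_mod[OF Q(2), of f] by (auto simp: \<phi>_def)
  qed
  have "card {f \<in> ?F (N1 * N2). Q1 f \<and> Q2 f} = card (\<phi> ` {f \<in> ?F (N1 * N2). Q1 f \<and> Q2 f})"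
    by (intro card_image[symmetric] inj_on_subset[OF inj]) auto
  then show ?thesis unfolding img by (simp add: card_cartesian_product)
qed

lemma periodic_dvd: "periodic N Q \<Longrightarrow> N dvd M \<Longrightarrow> periodic M Q"
  unfolding periodic_def by (meson cong_dvd_modulus int_dvd_int_iff)

lemma periodic_count_primes:
  assumes I: "finite I" and S: "finite S" "\<And>p. p \<in> S \<Longrightarrow> prime p"
    and Q: "\<And>p. p \<in> S \<Longrightarrow> periodic p (Q p)"
  shows "periodic (\<Prod>S) (\<lambda>f. \<forall>p\<in>S. Q p f) \<and>
    card {f \<in> fun_box I {0..<int (\<Prod>S)}. \<forall>p\<in>S. Q p f} = (\<Prod>p\<in>S. card {f \<in> fun_box I {0..<int p}. Q p f})"
  using S Q
proof (induction S rule: finite_induct)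
  case empty
  have "{f \<in> fun_box I {0..<int (\<Prod>{})}. \<forall>p\<in>{}. Q p f} = {\<lambda>_. 0}"
  proof (intro equalityI subsetI)
    fix f assume "f \<in> {f \<in> fun_box I {0..<int (\<Prod>{})}. \<forall>p\<in>{}. Q p f}"
    then have "(i \<in> I \<longrightarrow> 0 \<le> f i \<and> f i < 1) \<and> (i \<notin> I \<longrightarrow> f i = 0)" for i
      by (simp add: PiE_dflt_def)
    then have "f i = 0" for i by (cases "i \<in> I") force+
    then show "f \<in> {\<lambda>_. 0}" by auto
  qed (simp add: PiE_dflt_def)
  then show ?case unfolding periodic_def by simp
next
  case (insert p S)
  have per: "periodic (\<Prod>(insert p S)) (\<lambda>f. \<forall>p\<in>insert p S. Q p f)"
  proof -
    have "periodic (\<Prod>(insert p S)) (Q q)" if "q \<in> insert p S" for q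
    proof (rule periodic_dvd)
      show "periodic q (Q q)" using insert.prems(2) that by blast
      show "q dvd \<Prod>(insert p S)" using that insert.hyps(1) by (intro dvd_prodI finite.insertI)
    qed
    then show ?thesis unfolding periodic_def by blast
  qed
  have "coprime p (\<Prod>S)" using insert by (intro prod_coprime_right primes_coprime) auto
  moreover have "\<Prod>S > 0" using insert.prems by (intro prod_pos) (auto simp: prime_gt_0_nat)
  moreover have "p > 0" using insert.prems by (auto simp: prime_gt_0_nat)
  ultimately have "card {f \<in> fun_box I {0..<int (p * \<Prod>S)}. Q p f \<and> (\<forall>p\<in>S. Q p f)} =
      card {f \<in> fun_box I {0..<int p}. Q p f} * card {f \<in> fun_box I {0..<int (\<Prod>S)}. \<forall>p\<in>S. Q p f}"
    using insert.IH insert.prems by (intro periodic_count_coprime I) auto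
  moreover have "card {f \<in> fun_box I {0..<int (\<Prod>S)}. \<forall>p\<in>S. Q p f} = (\<Prod>p\<in>S. card {f \<in> fun_box I {0..<int p}. Q p f})"
    using insert.IH insert.prems by blast
  moreover have "(\<forall>q\<in>insert p S. Q q f) \<longleftrightarrow> Q p f \<and> (\<forall>q\<in>S. Q q f)" for f by blast
  ultimately show ?case using per insert.hyps by (simp only: prod.insert simp_thms)
qed

section \<open>Matrices as functions on index pairs, and the limit of their densities\<close>

definition sq :: "nat \<Rightarrow> (nat \<times> nat) set" where
  "sq n = {..<n} \<times> {..<n}"

definition fun_rows :: "nat \<Rightarrow> (nat \<times> nat \<Rightarrow> int) \<Rightarrow> (nat \<Rightarrow> int) list" where
  "fun_rows n f = mat_rows n (mat n n f)"

definition corank_le_1 :: "nat \<Rightarrow> nat \<Rightarrow> (nat \<times> nat \<Rightarrow> int) \<Rightarrow> bool" where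
  "corank_le_1 n p f \<longleftrightarrow> n - 1 \<le> rk p (fun_rows n f)"

lemma finite_sq [simp]: "finite (sq n)" and card_sq: "card (sq n) = n * n"
  by (simp_all add: sq_def card_cartesian_product)

lemma fun_rows_eq: "fun_rows n f = map (\<lambda>i j. if j < n then f (i, j) else 0) [0..<n]"
  unfolding fun_rows_def mat_rows_def by (intro map_cong) auto

lemma bij_fun_rows: "bij_betw (fun_rows n) (fun_box (sq n) A) (rows_of n (vecs n A))"
proof (rule bij_betwI[where g = "\<lambda>vs (i, j). if i < n \<and> j < n then (vs ! i) j else 0"])
  show "fun_rows n \<in> fun_box (sq n) A \<rightarrow> rows_of n (vecs n A)"
    by (auto simp: fun_rows_eq rows_of_def vecs_iff PiE_dflt_def sq_def)
  show "(\<lambda>vs (i, j). if i < n \<and> j < n then (vs ! i) j else 0) \<in> rows_of n (vecs n A) \<rightarrow> fun_box (sq n) A"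
  proof
    fix vs assume "vs \<in> rows_of n (vecs n A)"
    then have "vs ! i \<in> vecs n A" if "i < n" for i using that by (auto simp: rows_of_def)
    then show "(\<lambda>(i, j). if i < n \<and> j < n then (vs ! i) j else 0) \<in> fun_box (sq n) A"
      by (auto simp: PiE_dflt_def sq_def vecs_iff)
  qed
  show "(\<lambda>(i, j). if i < n \<and> j < n then (fun_rows n f ! i) j else 0) = f" if "f \<in> fun_box (sq n) A" for f
    using that by (auto simp: fun_rows_eq PiE_dflt_def sq_def)
  show "fun_rows n (\<lambda>(i, j). if i < n \<and> j < n then (vs ! i) j else 0) = vs" if vs: "vs \<in> rows_of n (vecs n A)" for vs
  proof (rule nth_equalityI)
    show "length (fun_rows n (\<lambda>(i, j). if i < n \<and> j < n then (vs ! i) j else 0)) = length vs"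
      using vs by (simp add: fun_rows_eq rows_of_def)
    fix i assume "i < length (fun_rows n (\<lambda>(i, j). if i < n \<and> j < n then (vs ! i) j else 0))"
    then have i: "i < n" by (simp add: fun_rows_eq)
    then have "vs ! i \<in> vecs n A" using vs by (auto simp: rows_of_def)
    then show "fun_rows n (\<lambda>(i, j). if i < n \<and> j < n then (vs ! i) j else 0) ! i = vs ! i"
      using i by (auto simp: fun_rows_eq vecs_iff fun_eq_iff)
  qed
qed

lemma card_fun_rows: "card {f \<in> fun_box (sq n) A. Q (fun_rows n f)} = card {vs \<in> rows_of n (vecs n A). Q vs}"
proof (rule bij_betw_same_card[of "fun_rows n"])
  have "bij_betw (fun_rows n) {f \<in> fun_box (sq n) A. Q (fun_rows n f)} (fun_rows n ` {f \<in> fun_box (sq n) A. Q (fun_rows n f)})"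
    by (rule bij_betw_subset[OF bij_fun_rows[of n A]]) auto
  moreover have "fun_rows n ` {f \<in> fun_box (sq n) A. Q (fun_rows n f)} = {vs \<in> rows_of n (vecs n A). Q vs}"
    using bij_betw_imp_surj_on[OF bij_fun_rows[of n A]] by auto
  ultimately show "bij_betw (fun_rows n) {f \<in> fun_box (sq n) A. Q (fun_rows n f)} {vs \<in> rows_of n (vecs n A). Q vs}"
    by simp
qed

lemma periodic_corank_le_1: "periodic p (corank_le_1 n p)"
  unfolding periodic_def corank_le_1_def
proof (intro allI impI)
  fix f g :: "nat \<times> nat \<Rightarrow> int" assume "\<forall>i. [f i = g i] (mod int p)"
  then have "list_all2 (\<lambda>v v'. \<forall>j. [v j = v' j] (mod int p)) (fun_rows n f) (fun_rows n g)"
    by (auto simp: fun_rows_eq list_all2_map1 list_all2_map2 list_all2_same)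
  from rk_cong[OF this] show "n - 1 \<le> rk p (fun_rows n f) \<longleftrightarrow> n - 1 \<le> rk p (fun_rows n g)" by simp
qed

text \<open>Independent uniform entries amount to the uniform distribution on the box, so the
  probability is a quotient of cardinalities.\<close>

lemma mu_upto_cyclic:
  assumes "n \<ge> 1"
  shows "mu_upto k n (cyclic_SNFs n) =
    real (card {f \<in> fun_box (sq n) {- int k..int k}. \<forall>p. prime p \<longrightarrow> corank_le_1 n p f}) / (2 * real k + 1) ^ (n * n)"
proof -
  let ?F = "fun_box (sq n) {- int k..int k}"
  have fin: "finite ?F" by (intro finite_PiE_dflt) auto
  have card: "card ?F = (2 * k + 1) ^ (n * n)" by (simp add: card_fun_box card_sq nat_add_distrib nat_mult_distrib)
  then have ne: "?F \<noteq> {}" by auto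
  have "mu_upto k n (cyclic_SNFs n) =
      measure_pmf.prob (pmf_of_set ?F) {f. SNF n (mat n n f) \<in> cyclic_SNFs n}"
    unfolding mu_upto_def random_mat_def sq_def[symmetric]
    by (subst Pi_pmf_of_set) (auto simp: vimage_def)
  also have "\<dots> = real (card (?F \<inter> {f. SNF n (mat n n f) \<in> cyclic_SNFs n})) / card ?F"
    by (rule measure_pmf_of_set[OF ne fin])
  also have "?F \<inter> {f. SNF n (mat n n f) \<in> cyclic_SNFs n} = {f \<in> ?F. \<forall>p. prime p \<longrightarrow> corank_le_1 n p f}"
    using SNF_cyclic_iff[OF _ assms] by (auto simp: corank_le_1_def fun_rows_def)
  finally show ?thesis by (simp add: card add.commute)
qed

text \<open>At a prime this is the proportion of matrices modulo p with corank at most 1, by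
  \<open>local_density_prime\<close>; elsewhere it is 1. In this form the product over all p is a
  product of known Euler products.\<close>

definition local_density :: "nat \<Rightarrow> nat \<Rightarrow> real" where
  "local_density n p = (\<Prod>i=2..n. euler_factor i p) * Z_factor n p"

lemma local_density_prime:
  assumes "prime p" "n \<ge> 1"
  shows "real (card {f \<in> fun_box (sq n) {0..<int p}. corank_le_1 n p f}) / real p ^ (n * n) = local_density n p"
  unfolding corank_le_1_def card_fun_rows[of n _ "\<lambda>vs. n - 1 \<le> rk p vs"] card_corank_le_1[OF assms]
  using assms by (simp add: local_density_def euler_factor_def Z_factor_def power_mult prime_gt_0_nat)

lemma local_density_has_prod: "local_density n has_prod Z n"
proof -
  have "(\<lambda>p. \<Prod>i=2..n. euler_factor i p) has_prod (\<Prod>i=2..n. 1 / zeta (real i))"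
    by (intro has_prod_prod euler_product) auto
  from has_prod_mult[OF this Z_factor_has_prod[of n]] show ?thesis
    by (simp add: local_density_def[abs_def] Z_def prod_dividef)
qed

lemma density_small_primes:
  assumes "n \<ge> 1"
  shows "(\<lambda>k. real (card {f \<in> fun_box (sq n) {- int k..int k}. \<forall>p. prime p \<and> p \<le> L \<longrightarrow> corank_le_1 n p f}) / (2 * real k + 1) ^ (n * n))
    \<longlonglongrightarrow> (\<Prod>p\<le>L. local_density n p)"
proof -
  define S where "S = {p. prime p \<and> p \<le> L}"
  have S: "finite S" "\<And>p. p \<in> S \<Longrightarrow> prime p" by (auto simp: S_def)
  note cnt = periodic_count_primes[OF finite_sq[of n] S periodic_corank_le_1[of _ n]]
  have "\<Prod>S > 0" using S(2) by (intro prod_pos) (auto simp: prime_gt_0_nat)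
  from periodic_density[OF finite_sq[of n] this conjunct1[OF cnt]]
  have "(\<lambda>k. real (card {f \<in> fun_box (sq n) {- int k..int k}. \<forall>p\<in>S. corank_le_1 n p f}) / (2 * real k + 1) ^ (n * n))
    \<longlonglongrightarrow> real (\<Prod>p\<in>S. card {f \<in> fun_box (sq n) {0..<int p}. corank_le_1 n p f}) / real (\<Prod>S) ^ (n * n)"
    by (simp only: conjunct2[OF cnt] card_sq)
  also have "real (\<Prod>p\<in>S. card {f \<in> fun_box (sq n) {0..<int p}. corank_le_1 n p f}) / real (\<Prod>S) ^ (n * n)
      = (\<Prod>p\<in>S. local_density n p)"
    using S(2) by (simp add: prod_power_distrib prod_dividef[symmetric] local_density_prime[OF _ assms] cong: prod.cong)
  also have "(\<Prod>p\<in>S. local_density n p) = (\<Prod>p\<le>L. local_density n p)"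
    by (rule prod.mono_neutral_left)
       (auto simp: S_def local_density_def euler_factor_def Z_factor_def)
  finally show ?thesis by (simp add: S_def)
qed

lemma sum_inverse_squares_tail:
  fixes L M :: nat
  assumes "L \<ge> 1"
  shows "(\<Sum>m\<in>{Suc L..M}. 1 / (real m)\<^sup>2) \<le> 1 / L"
proof (cases "L \<le> M")
  case True
  then have "(\<Sum>m\<in>{Suc L..M}. 1 / (real m)\<^sup>2) \<le> 1 / L - 1 / M"
  proof (induction M rule: dec_induct)
    case (step M)
    have "M > 0" using step assms by simp
    then have "1 / (real (Suc M))\<^sup>2 \<le> 1 / M - 1 / Suc M"
      by (simp add: divide_simps power2_eq_square)
    then show ?case using step by simp
  qed simp
  then show ?thesis by (rule order_trans) simp
qed (use assms in auto)

text \<open>Rank below n - 1 for all n rows forces the n - 1 rows of the tail to be dependent, since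
  a further row cannot lower the rank. The head row is then left free and contributes only its
  number of choices.\<close>

lemma large_primes_tail:
  fixes L :: nat
  assumes n: "n \<ge> 1" and k: "k \<ge> 1" and L: "L \<ge> 1"
  shows "real (card {f \<in> fun_box (sq n) {- int k..int k}. \<exists>p. prime p \<and> p > L \<and> \<not> corank_le_1 n p f}) / (2 * real k + 1) ^ (n * n)
    \<le> real n * 2 ^ n / L + real n * (1 + (real n + 1)\<^sup>2) / (2 * real k + 1)"
proof -
  let ?B = "vecs n {- int k..int k}" let ?K = "2 * k + 1"
  define b where "b = real (card ?B)"
  define r where "r = n - 1"
  have finB: "finite ?B" by simp
  have b: "b > 0" unfolding b_def card_B[OF k] by simp
  have bn: "b * b ^ r = (2 * real k + 1) ^ (n * n)"
    using n by (simp add: b_def card_B[OF k] r_def power_Suc[symmetric] power_mult add.commute del: power_Suc)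
  let ?D = "{us \<in> rows_of r ?B. \<exists>p. prime p \<and> p > L \<and> rk p us < r}"
  let ?P = "{p \<in> {Suc L..?K}. prime p}"
  have "card {f \<in> fun_box (sq n) {- int k..int k}. \<exists>p. prime p \<and> p > L \<and> \<not> corank_le_1 n p f}
      = card {vs \<in> rows_of (Suc r) ?B. \<exists>p. prime p \<and> p > L \<and> rk p vs < r}"
    using card_fun_rows[of n "{- int k..int k}" "\<lambda>vs. \<exists>p. prime p \<and> p > L \<and> rk p vs < r"] n
    by (simp add: corank_le_1_def r_def not_le)
  also have "\<dots> = (\<Sum>us\<in>rows_of r ?B. card {v \<in> ?B. \<exists>p. prime p \<and> p > L \<and> rk p (v # us) < r})"
    by (rule card_rows_of_Suc[OF finB])
  also have "\<dots> \<le> (\<Sum>us\<in>rows_of r ?B. if us \<in> ?D then card ?B else 0)"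
  proof (intro sum_mono)
    fix us assume us: "us \<in> rows_of r ?B"
    show "card {v \<in> ?B. \<exists>p. prime p \<and> p > L \<and> rk p (v # us) < r} \<le> (if us \<in> ?D then card ?B else 0)"
    proof (cases "us \<in> ?D")
      case True
      have "card {v \<in> ?B. \<exists>p. prime p \<and> p > L \<and> rk p (v # us) < r} \<le> card ?B" by (intro card_mono) auto
      then show ?thesis using True by simp
    next
      case False
      then have "{v \<in> ?B. \<exists>p. prime p \<and> p > L \<and> rk p (v # us) < r} = {}"
        using us by (auto split: if_splits)
      then show ?thesis by (simp only: card.empty)
    qed
  qed
  also have "\<dots> = card ?D * card ?B"
    by (simp add: sum.inter_filter[symmetric] finite_rows_of)
  finally have 1: "real (card {f \<in> fun_box (sq n) {- int k..int k}. \<exists>p. prime p \<and> p > L \<and> \<not> corank_le_1 n p f}) \<le> real (card ?D) * b"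
    unfolding b_def of_nat_mult[symmetric] of_nat_le_iff .
  \<comment> \<open>The cut at the box width: up to it the primes are summed one at a time, above it
    they form one event.\<close>
  have "?D \<subseteq> (\<Union>p\<in>?P. {us \<in> rows_of r ?B. rk p us < r}) \<union> {us \<in> rows_of r ?B. dependent_above ?K r n us}"
  proof
    fix us assume "us \<in> ?D"
    then obtain p where us: "us \<in> rows_of r ?B" "prime p" "p > L" "rk p us < r" by blast
    \<comment> \<open>Vectors of the box vanish from index \<open>n\<close> on, so truncation to all
      \<open>n\<close> columns changes nothing.\<close>
    have "map (trunc n) us = us"
    proof (rule map_idI)
      fix v assume "v \<in> set us"
      then have "v \<in> ?B" using us by (auto simp: rows_of_def)
      then show "trunc n v = v" by (auto simp: trunc_def vecs_iff fun_eq_iff)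
    qed
    then show "us \<in> (\<Union>p\<in>?P. {us \<in> rows_of r ?B. rk p us < r}) \<union> {us \<in> rows_of r ?B. dependent_above ?K r n us}"
      using us by (cases "p \<le> ?K") (auto simp: dependent_above_def)
  qed
  then have "card ?D \<le> card ((\<Union>p\<in>?P. {us \<in> rows_of r ?B. rk p us < r}) \<union> {us \<in> rows_of r ?B. dependent_above ?K r n us})"
    by (intro card_mono) auto
  also have "\<dots> \<le> (\<Sum>p\<in>?P. card {us \<in> rows_of r ?B. rk p us < r}) + card {us \<in> rows_of r ?B. dependent_above ?K r n us}"
    by (intro order_trans[OF card_Un_le] add_mono card_UN_le order_refl) auto
  finally have "real (card ?D) \<le> (\<Sum>p\<in>?P. real (card {us \<in> rows_of r ?B. rk p us < r})) + real (card {us \<in> rows_of r ?B. dependent_above ?K r n us})"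
    unfolding of_nat_sum[symmetric] of_nat_add[symmetric] of_nat_le_iff .
  also have "\<dots> \<le> (\<Sum>p\<in>?P. real r * 2 ^ n / (real p)\<^sup>2 * b ^ r) + real r * real (1 + (n + 1)\<^sup>2) / real ?K * b ^ r"
    unfolding b_def using n by (intro add_mono sum_mono card_dependent_small card_dependent_above k) (auto simp: r_def)
  also have "(\<Sum>p\<in>?P. real r * 2 ^ n / (real p)\<^sup>2 * b ^ r) = real r * 2 ^ n * b ^ r * (\<Sum>p\<in>?P. 1 / (real p)\<^sup>2)"
    by (simp add: sum_distrib_left mult_ac)
  also have "(\<Sum>p\<in>?P. 1 / (real p)\<^sup>2) \<le> (\<Sum>m\<in>{Suc L..?K}. 1 / (real m)\<^sup>2)"
    by (intro sum_mono2) auto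
  also have "\<dots> \<le> 1 / L" by (rule sum_inverse_squares_tail[OF L])
  also have "real r * 2 ^ n * b ^ r * (1 / L) + real r * real (1 + (n + 1)\<^sup>2) / real ?K * b ^ r
      = real r * (2 ^ n / L + real (1 + (n + 1)\<^sup>2) / real ?K) * b ^ r"
    by (simp add: algebra_simps)
  also have "\<dots> \<le> real n * (2 ^ n / L + real (1 + (n + 1)\<^sup>2) / real ?K) * b ^ r"
    using b by (intro mult_right_mono) (auto simp: r_def)
  finally have "real (card ?D) \<le> real n * (2 ^ n / L + real (1 + (n + 1)\<^sup>2) / real ?K) * b ^ r"
    using b by (simp add: mult_left_mono)
  then have "real (card ?D) * b \<le> real n * (2 ^ n / L + real (1 + (n + 1)\<^sup>2) / real ?K) * b ^ r * b"
    using b by (intro mult_right_mono) auto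
  with 1 have "real (card {f \<in> fun_box (sq n) {- int k..int k}. \<exists>p. prime p \<and> p > L \<and> \<not> corank_le_1 n p f})
      \<le> real n * (2 ^ n / L + real (1 + (n + 1)\<^sup>2) / real ?K) * (b * b ^ r)"
    by (simp add: mult_ac)
  then have "real (card {f \<in> fun_box (sq n) {- int k..int k}. \<exists>p. prime p \<and> p > L \<and> \<not> corank_le_1 n p f}) / (b * b ^ r)
      \<le> real n * (2 ^ n / L + real (1 + (n + 1)\<^sup>2) / real ?K)"
    using b by (simp add: divide_le_eq)
  also have "\<dots> = real n * 2 ^ n / L + real n * (1 + (real n + 1)\<^sup>2) / (2 * real k + 1)"
    by (simp add: distrib_left add.commute)
  finally show ?thesis unfolding bn .
qed

text \<open>The two limits are taken in turn. The upper bound ignores the conditions at primes above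
  \<open>L\<close>; for the lower bound \<open>L\<close> is fixed first, large enough to absorb the
  loss A / L, and only then does k tend to infinity.\<close>

lemma mu_upto_tendsto:
  assumes n: "n \<ge> 1"
  shows "(\<lambda>k. mu_upto k n (cyclic_SNFs n)) \<longlonglongrightarrow> Z n"
proof -
  define D where "D = (\<lambda>L k. real (card {f \<in> fun_box (sq n) {- int k..int k}. \<forall>p. prime p \<and> p \<le> L \<longrightarrow> corank_le_1 n p f}) / (2 * real k + 1) ^ (n * n))"
  define P where "P = (\<lambda>L. \<Prod>p\<le>L. local_density n p)"
  define A where "A = real n * 2 ^ n"
  define C where "C = real n * (1 + (real n + 1)\<^sup>2)"
  have D: "(\<lambda>k. D L k) \<longlonglongrightarrow> P L" for L
    unfolding D_def P_def by (rule density_small_primes[OF n])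
  have P: "P \<longlonglongrightarrow> Z n"
    unfolding P_def by (rule has_prod_imp_tendsto[OF local_density_has_prod])
  have upper: "mu_upto k n (cyclic_SNFs n) \<le> D L k" for L k
    unfolding mu_upto_cyclic[OF n] D_def
    by (intro divide_right_mono of_nat_mono card_mono) (auto intro: finite_subset[OF _ finite_PiE_dflt[of "sq n"]])
  have lower: "D L k - A / L - C / (2 * real k + 1) \<le> mu_upto k n (cyclic_SNFs n)" if "L \<ge> 1" "k \<ge> 1" for L k
  proof -
    let ?F = "fun_box (sq n) {- int k..int k}"
    have fin: "finite ?F" by (intro finite_PiE_dflt) auto
    have "{f \<in> ?F. \<forall>p. prime p \<and> p \<le> L \<longrightarrow> corank_le_1 n p f} \<subseteq>
        {f \<in> ?F. \<forall>p. prime p \<longrightarrow> corank_le_1 n p f} \<union> {f \<in> ?F. \<exists>p. prime p \<and> p > L \<and> \<not> corank_le_1 n p f}"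
      by (auto simp: not_le) (metis not_le)
    then have "card {f \<in> ?F. \<forall>p. prime p \<and> p \<le> L \<longrightarrow> corank_le_1 n p f} \<le>
        card {f \<in> ?F. \<forall>p. prime p \<longrightarrow> corank_le_1 n p f} + card {f \<in> ?F. \<exists>p. prime p \<and> p > L \<and> \<not> corank_le_1 n p f}"
      using fin by (intro order_trans[OF card_mono card_Un_le]) auto
    then have "D L k \<le> mu_upto k n (cyclic_SNFs n) +
        real (card {f \<in> ?F. \<exists>p. prime p \<and> p > L \<and> \<not> corank_le_1 n p f}) / (2 * real k + 1) ^ (n * n)"
      unfolding D_def mu_upto_cyclic[OF n] add_divide_distrib[symmetric] of_nat_add[symmetric]
      by (intro divide_right_mono of_nat_mono) auto
    also have "\<dots> \<le> mu_upto k n (cyclic_SNFs n) + (real n * 2 ^ n / L + real n * (1 + (real n + 1)\<^sup>2) / (2 * real k + 1))"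
      by (intro add_left_mono large_primes_tail n that)
    finally show ?thesis by (simp add: A_def C_def algebra_simps)
  qed
  show ?thesis
  proof (rule order_tendstoI)
    fix y assume y: "y < Z n"
    have "(\<lambda>L. P L - A / real L) \<longlonglongrightarrow> Z n - 0"
      by (intro tendsto_diff P lim_const_over_n)
    then have "eventually (\<lambda>L. y < P L - A / real L) sequentially"
      using y by (intro order_tendstoD(1)) auto
    then have "eventually (\<lambda>L. y < P L - A / real L \<and> L \<ge> 1) sequentially"
      using eventually_ge_at_top[of 1] by eventually_elim auto
    then obtain L where L: "y < P L - A / real L" "L \<ge> 1" using eventually_happens by fastforce
    have "(\<lambda>k. C / (2 * real k + 1)) \<longlonglongrightarrow> 0" by real_asymp
    then have "(\<lambda>k. D L k - A / L - C / (2 * real k + 1)) \<longlonglongrightarrow> P L - A / L - 0"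
      by (intro tendsto_diff D tendsto_const)
    then have "eventually (\<lambda>k. y < D L k - A / L - C / (2 * real k + 1)) sequentially"
      using L by (intro order_tendstoD(1)) auto
    then show "eventually (\<lambda>k. y < mu_upto k n (cyclic_SNFs n)) sequentially"
      using eventually_ge_at_top[of 1]
    proof eventually_elim
      case (elim k)
      then show ?case using lower[OF L(2), of k] by linarith
    qed
  next
    fix y assume y: "Z n < y"
    then obtain L where L: "P L < y"
      using order_tendstoD(2)[OF P y] eventually_happens by fastforce
    have "eventually (\<lambda>k. D L k < y) sequentially" by (rule order_tendstoD(2)[OF D L])
    then show "eventually (\<lambda>k. mu_upto k n (cyclic_SNFs n) < y) sequentially"
    proof eventually_elim
      case (elim k)
      then show ?case using upper[of k L] by linarith
    qed
  qed
qed

theorem theorem4p9: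
  shows "(\<forall>n\<ge>1. convergent_prod (Z_factor n) \<and>
            convergent (\<lambda>k. mu_upto k n (cyclic_SNFs n)) \<and> mu n (cyclic_SNFs n) = Z n) \<and>
         strict_antimono_on {1..} Z \<and>
         (Z 2 = 1 / zeta 4 \<and> 1 / zeta 4 = 90 / pi ^ 4 \<and> \<bar>90 / pi ^ 4 - 0.923938\<bar> \<le> 5 / 10 ^ 7) \<and>
         (convergent_prod (\<lambda>i. zeta (real (i + 4))) \<and>
            Z \<longlonglongrightarrow> 1 / (zeta 6 * prodinf (\<lambda>i. zeta (real (i + 4)))) \<and>
            \<bar>1 / (zeta 6 * prodinf (\<lambda>i. zeta (real (i + 4)))) - 0.846936\<bar> \<le> 5 / 10 ^ 7)"
proof (intro conjI allI impI)
  fix n :: nat assume n: "1 \<le> n"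
  show "convergent_prod (Z_factor n)" by (rule convergent_Z_factor)
  show "convergent (\<lambda>k. mu_upto k n (cyclic_SNFs n))"
    using mu_upto_tendsto[OF n] by (auto simp: convergent_def)
  show "mu n (cyclic_SNFs n) = Z n" unfolding mu_def by (rule limI[OF mu_upto_tendsto[OF n]])
next
  show "1 / zeta 4 = 90 / pi ^ 4" by (simp add: zeta_4)
qed (rule Z_strict_antimono Z_2 ninety_div_pi_pow4_approx convergent_prod_zeta Z_tendsto Z_limit_approx)+

end
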